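(* Let $c_n=\|\psi_n^{(1)}(\hat{\boldsymbol\theta}_n^{(1)})-\psi_n^{(1)}(\boldsymbol\theta_0)\|_\infty$ and $\theta_{\min}=\inf_{j\in T_0}|\theta_{0j}|$. Assume: (a) there is a constant $L_S>0$ with $|S(\boldsymbol y_1;\boldsymbol\theta_0)-S(\boldsymbol y_2;\boldsymbol\theta_0)|\le L_Ss(|x_1-x_2|+\|\boldsymbol z_1-\boldsymbol z_2\|_\infty)$ for all $\boldsymbol y_i=(\phi(x_i)^\top,\boldsymbol z_i^\top)^\top$, $i=1,2$; (b) $S$ is twice continuously differentiable in $\boldsymbol\theta$, and there is $K_p>0$, possibly depending on $p$, with $\sup_{t\ge0}\mathrm E[|S(\boldsymbol Y_t;\boldsymbol\theta_0)|^4]^{1/4}\le K_p$, $\sup_{t\ge0}\mathrm E[\|\frac{\partial}{\partial\boldsymbol\theta}S(\boldsymbol Y_t;\boldsymbol\theta_0)\|_\infty^4]^{1/4}\le K_p$, $\sup_{t\ge0}\mathrm E[|\sigma(\boldsymbol Y_t;h_0)|^4]^{1/4}\le K_p$; (c) $\inf_{\boldsymbol y\in\mathbb R^p}\inf_{h\in H}\sigma^2(\boldsymbol y;h)>0$; (d) $\mathrm E[\sup_{t\in[t_{i-1}^n,t_i^n]}|X_t-X_{t_{i-1}^n}|^k]+\mathrm E[\sup_{t\in[t_{i-1}^n,t_i^n]}\|\boldsymbol Z_t-\boldsymbol Z_{t_{i-1}^n}\|_\infty^k]\le D_k\Delta_n^{k/2}$, where $D_k>0$ is a constant depending on $k$ and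 $p$; (e) $\Delta_n\asymp n^{-\zeta}$ with $\zeta\in(1/2,1)$, $\log p=o((n\Delta_n)^{1/2})$, and $\max\big\{\frac{K_ps\Delta_n^{1/2}D_2^{1/2}}{\lambda_n},\frac{K_p^2}{\lambda_n}\sqrt{\frac{\log(1+p)}{n\Delta_n}}\big\}\to0$ as $n\to\infty$; (f) there is a constant $\delta>0$ such that $$\mathrm P\left(\inf_{\boldsymbol0\ne\boldsymbol v\in C_{T_0}}\inf_{\boldsymbol\theta\in\Theta}\frac{|\boldsymbol v^\top\boldsymbol V_n^{(1)}(\boldsymbol\theta)\boldsymbol v|}{\|\boldsymbol v_{T_0}\|_1\|\boldsymbol v\|_\infty}>\delta\right)\to1,\qquad n\to\infty;$$ (g) $\theta_{\min}>4c_n/\delta$. Then $$\mathrm P\Big(\|\hat{\boldsymbol\theta}_n^{(1)}-\boldsymbol\theta_0\|_\infty>\tfrac2\delta c_n\Big)\to0,\qquad n\to\infty,$$ and in particular $\|\hat{\boldsymbol\theta}_n^{(1)}-\boldsymbol\theta_0\|_\infty=O_p(\lambda_n)$. Moreover, if the threshold $\tau_n$ satisfies $2c_n/\delta<\tau_n<\theta_{\min}/2$, then $\mathrm P(\hat T_n=T_0)\to1$ as $n\to\infty$.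
   Context: Model: for each $n$, $p=p_1+p_2$ may depend on $n$. On a filtered probability space, $X_t=X_0+\int_0^tS(\boldsymbol Y_r;\boldsymbol\theta_0)\,dr+\int_0^t\sigma(\boldsymbol Y_r;h_0)\,dW_r$, $t\ge0$, with $W$ a one-dimensional standard Brownian motion, $\boldsymbol Z$ an adapted $\mathbb R^{p_2}$-valued covariate process, $\boldsymbol Y_t=(\phi(X_t)^\top,\boldsymbol Z_t^\top)^\top\in\mathbb R^p$ with $\phi:\mathbb R\to\mathbb R^{p_1}$ measurable. For $\boldsymbol\theta=(\boldsymbol\alpha^\top,\boldsymbol\beta^\top)^\top$, $S(\boldsymbol Y_t;\boldsymbol\theta)=\tilde S(\boldsymbol\alpha^\top\phi(X_t),\boldsymbol\beta^\top\boldsymbol Z_t)$, with $\tilde S$ measurable; $\sigma$ is measurable and $\sigma^2=(\sigma)^2$. $\boldsymbol\theta_0\in\Theta=\Theta_\alpha\times\Theta_\beta\subset\mathbb R^p$ and $h_0\in H$ (a metric space) are the true values; $T_0=\{j:\theta_{0j}\ne0\}$, $s=|T_0|$. The processes are observed at equidistant times $0=t_0^n<t_1^n<\dots<t_n^n$, $\Delta_n=t_n^n/n=t_k^n-t_{k-1}^n$. $\psi_n^{(1)}(\boldsymbol\theta)=\frac1{n\Delta_n}\sum_{k=1}^n\frac{\partial}{\partial\boldsymbol\theta}S(\boldsymbol Y_{t_{k-1}^n};\boldsymbol\theta)\{X_{t_k^n}-X_{t_{k-1}^n}-S(\boldsymbol Y_{t_{k-1}^n};\boldsymbol\theta)\Delta_n\}$,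 and $\boldsymbol V_n^{(1)}(\boldsymbol\theta)=\frac{\partial}{\partial\boldsymbol\theta^\top}\psi_n^{(1)}(\boldsymbol\theta)$ ($p\times p$ matrix). $\hat{\boldsymbol\theta}_n^{(1)}$ is a minimizer of $\|\boldsymbol\theta\|_1$ over $\{\boldsymbol\theta\in\Theta:\|\psi_n^{(1)}(\boldsymbol\theta)\|_\infty\le\lambda_n\}$ (existing whenever this set is nonempty), $\lambda_n$ a tuning parameter; $\hat T_n=\{j:|\hat\theta_{nj}^{(1)}|>\tau_n\}$ with threshold $\tau_n$. $\boldsymbol v_T$ is the sub-vector of $\boldsymbol v$ with indices in $T$; $C_{T_0}=\{\boldsymbol v\in\mathbb R^p:\|\boldsymbol v_{T_0^c}\|_1\le\|\boldsymbol v_{T_0}\|_1\}$. Inequalities involving the random quantity $c_n$ hold almost surely for every $n$.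
   Formalization: The formal theorem also assumes that Θ contains the line segment from θ₀ to each of its points (as when Θ is convex); for arbitrary Θ the claim fails, e.g. S̃(a,b)=sin(2πa), φ=1, Z=0, σ=1, Θ={1,2}×{0}, θ₀=(2,0). *)

theory Defs
  imports "HOL-Probability.Probability" "HOL-Library.Landau_Symbols"
begin

section \<open>Vectors of variable dimension\<close>

text \<open>The dimension varies with the sample size, so a vector of length \<open>d\<close> is an extensional
  function on the index set \<open>{..<d}\<close>; this is also the space of the library's finite product
  measure. All norms only look at indices below \<open>d\<close>.\<close>

definition Rvec :: "nat \<Rightarrow> (nat \<Rightarrow> real) set" where
  "Rvec d = PiE {..<d} (\<lambda>_. UNIV)"

definition borel_vec :: "nat \<Rightarrow> (nat \<Rightarrow> real) measure" where
  "borel_vec d = PiM {..<d} (\<lambda>_. borel)"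

definition vjoin :: "nat \<Rightarrow> nat \<Rightarrow> (nat \<Rightarrow> real) \<Rightarrow> (nat \<Rightarrow> real) \<Rightarrow> nat \<Rightarrow> real" where
  "vjoin d1 d2 a b = (\<lambda>j\<in>{..<d1 + d2}. if j < d1 then a j else b (j - d1))"

text \<open>\<open>l1norm T v\<close> is the 1-norm of the sub-vector of \<open>v\<close> with indices in \<open>T\<close>.\<close>

definition l1norm :: "nat set \<Rightarrow> (nat \<Rightarrow> real) \<Rightarrow> real" where
  "l1norm T v = (\<Sum>j\<in>T. \<bar>v j\<bar>)"

text \<open>Inserting \<open>0\<close> only matters for \<open>d = 0\<close>.\<close>

definition linf :: "nat \<Rightarrow> (nat \<Rightarrow> real) \<Rightarrow> real" where
  "linf d v = Max (insert 0 ((\<lambda>j. \<bar>v j\<bar>) ` {..<d}))"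

definition partial_deriv :: "nat \<Rightarrow> ((nat \<Rightarrow> real) \<Rightarrow> real) \<Rightarrow> (nat \<Rightarrow> real) \<Rightarrow> real" where
  "partial_deriv j f \<theta> = deriv (\<lambda>x. f (\<theta>(j := x))) (\<theta> j)"

text \<open>For \<open>U\<close> open in \<open>Rvec d\<close> (with the subspace topology of the product topology, i.e. the usual
  one): all partial derivatives exist and are continuous.\<close>

definition C1_on :: "nat \<Rightarrow> (nat \<Rightarrow> real) set \<Rightarrow> ((nat \<Rightarrow> real) \<Rightarrow> real) \<Rightarrow> bool" where
  "C1_on d U f \<longleftrightarrow>
     (\<forall>j<d. (\<forall>\<theta>\<in>U. (\<lambda>x. f (\<theta>(j := x))) differentiable (at (\<theta> j))) \<and>
            continuous_on U (partial_deriv j f))"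

definition C2_on :: "nat \<Rightarrow> (nat \<Rightarrow> real) set \<Rightarrow> ((nat \<Rightarrow> real) \<Rightarrow> real) \<Rightarrow> bool" where
  "C2_on d U f \<longleftrightarrow> C1_on d U f \<and> (\<forall>j<d. C1_on d U (partial_deriv j f))"

section \<open>Brownian motion and the Ito integral\<close>

definition filtered_prob_space :: "'a measure \<Rightarrow> (real \<Rightarrow> 'a measure) \<Rightarrow> bool" where
  "filtered_prob_space P F \<longleftrightarrow> prob_space P \<and> (\<forall>t\<ge>0. subalgebra P (F t)) \<and>
     (\<forall>s t. 0 \<le> s \<and> s \<le> t \<longrightarrow> sets (F s) \<subseteq> sets (F t))"

definition brownian_motion ::
    "'a measure \<Rightarrow> (real \<Rightarrow> 'a measure) \<Rightarrow> (real \<Rightarrow> 'a \<Rightarrow> real) \<Rightarrow> bool" where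
  "brownian_motion P F W \<longleftrightarrow>
     (\<forall>t\<ge>0. W t \<in> borel_measurable (F t)) \<and>
     (AE \<omega> in P. W 0 \<omega> = 0) \<and>
     (AE \<omega> in P. continuous_on {0..} (\<lambda>t. W t \<omega>)) \<and>
     (\<forall>s t. 0 \<le> s \<and> s < t \<longrightarrow>
        distributed P lborel (\<lambda>\<omega>. W t \<omega> - W s \<omega>) (normal_density 0 (sqrt (t - s))) \<and>
        prob_space.indep_set P (sets (F s))
          {(\<lambda>\<omega>. W t \<omega> - W s \<omega>) -` A \<inter> space P | A. A \<in> sets borel})"

definition progressive :: "(real \<Rightarrow> 'a measure) \<Rightarrow> (real \<Rightarrow> 'a \<Rightarrow> real) \<Rightarrow> bool" where
  "progressive F H \<longleftrightarrow>
     (\<forall>t\<ge>0. (\<lambda>(r, \<omega>). H r \<omega>) \<in> borel_measurable (restrict_space borel {0..t} \<Otimes>\<^sub>M F t))"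

text \<open>An elementary integrand \<open>\<Sum>i<m. \<xi> i * indicator {u i <.. u (i+1)}\<close> with bounded,
  \<open>F (u i)\<close>-measurable coefficients, and its integral over \<open>[0, t]\<close>.\<close>

definition elementary ::
    "(real \<Rightarrow> 'a measure) \<Rightarrow> nat \<Rightarrow> (nat \<Rightarrow> real) \<Rightarrow> (nat \<Rightarrow> 'a \<Rightarrow> real) \<Rightarrow> bool" where
  "elementary F m u \<xi> \<longleftrightarrow> 0 \<le> u 0 \<and>
     (\<forall>i<m. u i < u (Suc i) \<and> \<xi> i \<in> borel_measurable (F (u i)) \<and>
            (\<exists>B. \<forall>\<omega>\<in>space (F (u i)). \<bar>\<xi> i \<omega>\<bar> \<le> B))"

definition elementary_process ::
    "nat \<Rightarrow> (nat \<Rightarrow> real) \<Rightarrow> (nat \<Rightarrow> 'a \<Rightarrow> real) \<Rightarrow> real \<Rightarrow> 'a \<Rightarrow> real" where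
  "elementary_process m u \<xi> r \<omega> = (\<Sum>i<m. \<xi> i \<omega> * indicator {u i<..u (Suc i)} r)"

definition elementary_integral ::
    "(real \<Rightarrow> 'a \<Rightarrow> real) \<Rightarrow> nat \<Rightarrow> (nat \<Rightarrow> real) \<Rightarrow> (nat \<Rightarrow> 'a \<Rightarrow> real) \<Rightarrow> real \<Rightarrow> 'a \<Rightarrow> real" where
  "elementary_integral W m u \<xi> t \<omega> =
     (\<Sum>i<m. \<xi> i \<omega> * (W (min (u (Suc i)) t) \<omega> - W (min (u i) t) \<omega>))"

text \<open>\<open>ito_integral P F W H I\<close>: the process \<open>I\<close> is (a continuous version of) the Ito integral
  of \<open>H\<close> with respect to \<open>W\<close>. This is the L2 construction for progressively measurable integrands
  with finite expectation of the integral of \<open>H\<^sup>2\<close> over each \<open>[0, t]\<close>: the integrals of elementary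
  integrands approximating \<open>H\<close> in L2 converge in L2 to \<open>I\<close>. By the Ito isometry \<open>I\<close> is determined
  up to indistinguishability.\<close>

definition ito_integral ::
    "'a measure \<Rightarrow> (real \<Rightarrow> 'a measure) \<Rightarrow> (real \<Rightarrow> 'a \<Rightarrow> real) \<Rightarrow>
     (real \<Rightarrow> 'a \<Rightarrow> real) \<Rightarrow> (real \<Rightarrow> 'a \<Rightarrow> real) \<Rightarrow> bool" where
  "ito_integral P F W H I \<longleftrightarrow>
     progressive F H \<and>
     (\<forall>t\<ge>0. (\<integral>\<^sup>+\<omega>. (\<integral>\<^sup>+r\<in>{0..t}. ennreal ((H r \<omega>)\<^sup>2) \<partial>lborel) \<partial>P) < \<infinity>) \<and>
     (\<forall>t\<ge>0. I t \<in> borel_measurable P) \<and>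
     (AE \<omega> in P. continuous_on {0..} (\<lambda>t. I t \<omega>)) \<and>
     (\<exists>m u \<xi>. (\<forall>k::nat. elementary F (m k) (u k) (\<xi> k)) \<and>
        (\<forall>t\<ge>0.
          (\<lambda>k. \<integral>\<^sup>+\<omega>. (\<integral>\<^sup>+r\<in>{0..t}.
              ennreal ((elementary_process (m k) (u k) (\<xi> k) r \<omega> - H r \<omega>)\<^sup>2) \<partial>lborel) \<partial>P)
            \<longlonglongrightarrow> 0 \<and>
          (\<lambda>k. \<integral>\<^sup>+\<omega>.
              ennreal ((elementary_integral W (m k) (u k) (\<xi> k) t \<omega> - I t \<omega>)\<^sup>2) \<partial>P)
            \<longlonglongrightarrow> 0))"

section \<open>The diffusion model with covariates\<close>

record ('a, 'h) model =
  Prob :: "'a measure"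
  Filt :: "real \<Rightarrow> 'a measure"
  Wproc :: "real \<Rightarrow> 'a \<Rightarrow> real"
  Xproc :: "real \<Rightarrow> 'a \<Rightarrow> real"
  Zproc :: "real \<Rightarrow> 'a \<Rightarrow> nat \<Rightarrow> real"
  dim1 :: nat
  dim2 :: nat
  phi_map :: "real \<Rightarrow> nat \<Rightarrow> real"
  S_tilde :: "real \<Rightarrow> real \<Rightarrow> real"
  sigma_coef :: "(nat \<Rightarrow> real) \<Rightarrow> 'h \<Rightarrow> real"
  Theta_a :: "(nat \<Rightarrow> real) set"
  Theta_b :: "(nat \<Rightarrow> real) set"
  H_space :: "'h set"
  theta0 :: "nat \<Rightarrow> real"
  h_true :: 'h

definition pdim :: "('a, 'h) model \<Rightarrow> nat" where
  "pdim M = dim1 M + dim2 M"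

definition Param :: "('a, 'h) model \<Rightarrow> (nat \<Rightarrow> real) set" where
  "Param M = {vjoin (dim1 M) (dim2 M) a b | a b. a \<in> Theta_a M \<and> b \<in> Theta_b M}"

definition yvec :: "('a, 'h) model \<Rightarrow> real \<Rightarrow> (nat \<Rightarrow> real) \<Rightarrow> nat \<Rightarrow> real" where
  "yvec M x z = vjoin (dim1 M) (dim2 M) (phi_map M x) z"

definition Yproc :: "('a, 'h) model \<Rightarrow> real \<Rightarrow> 'a \<Rightarrow> nat \<Rightarrow> real" where
  "Yproc M t \<omega> = yvec M (Xproc M t \<omega>) (Zproc M t \<omega>)"

definition drift :: "('a, 'h) model \<Rightarrow> (nat \<Rightarrow> real) \<Rightarrow> (nat \<Rightarrow> real) \<Rightarrow> real" where
  "drift M y \<theta> = S_tilde M (\<Sum>j<dim1 M. \<theta> j * y j) (\<Sum>j=dim1 M..<pdim M. \<theta> j * y j)"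

text \<open>Adaptedness of \<open>Xproc\<close> and progressive measurability of the drift coefficient are implicit in
  speaking of a solution of the integral equation.\<close>

definition diffusion_model :: "('a, 'h::metric_space) model \<Rightarrow> bool" where
  "diffusion_model M \<longleftrightarrow>
     filtered_prob_space (Prob M) (Filt M) \<and>
     brownian_motion (Prob M) (Filt M) (Wproc M) \<and>
     (\<forall>t\<ge>0. Xproc M t \<in> borel_measurable (Filt M t)) \<and>
     (\<forall>t\<ge>0. Zproc M t \<in> measurable (Filt M t) (borel_vec (dim2 M))) \<and>
     phi_map M \<in> measurable borel (borel_vec (dim1 M)) \<and>
     (\<lambda>(a, b). S_tilde M a b) \<in> borel_measurable (borel \<Otimes>\<^sub>M borel) \<and>
     (\<forall>h\<in>H_space M. (\<lambda>y. sigma_coef M y h) \<in> borel_measurable (borel_vec (pdim M))) \<and>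
     Theta_a M \<subseteq> Rvec (dim1 M) \<and> Theta_b M \<subseteq> Rvec (dim2 M) \<and>
     theta0 M \<in> Param M \<and> h_true M \<in> H_space M \<and>
     progressive (Filt M) (\<lambda>r \<omega>. drift M (Yproc M r \<omega>) (theta0 M)) \<and>
     (\<exists>I. ito_integral (Prob M) (Filt M) (Wproc M) (\<lambda>r \<omega>. sigma_coef M (Yproc M r \<omega>) (h_true M)) I \<and>
        (AE \<omega> in Prob M. \<forall>t\<ge>0.
           set_integrable lborel {0..t} (\<lambda>r. drift M (Yproc M r \<omega>) (theta0 M)) \<and>
           Xproc M t \<omega> = Xproc M 0 \<omega> + (LINT r:{0..t}|lborel. drift M (Yproc M r \<omega>) (theta0 M)) + I t \<omega>))"

section \<open>Score, sparsity and the Dantzig selector\<close>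

text \<open>Here \<open>n\<close> is the sample size and \<open>\<Delta>\<close> the mesh; the observation times are \<open>k * \<Delta>\<close>, \<open>k \<le> n\<close>.\<close>

definition psi ::
    "('a, 'h) model \<Rightarrow> nat \<Rightarrow> real \<Rightarrow> 'a \<Rightarrow> (nat \<Rightarrow> real) \<Rightarrow> nat \<Rightarrow> real" where
  "psi M n \<Delta> \<omega> \<theta> j = 1 / (real n * \<Delta>) *
     (\<Sum>k=1..n. partial_deriv j (drift M (Yproc M (real (k - 1) * \<Delta>) \<omega>)) \<theta> *
        (Xproc M (real k * \<Delta>) \<omega> - Xproc M (real (k - 1) * \<Delta>) \<omega>
          - drift M (Yproc M (real (k - 1) * \<Delta>) \<omega>) \<theta> * \<Delta>))"

definition score_jacobian ::
    "('a, 'h) model \<Rightarrow> nat \<Rightarrow> real \<Rightarrow> 'a \<Rightarrow> (nat \<Rightarrow> real) \<Rightarrow> nat \<Rightarrow> nat \<Rightarrow> real" where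
  "score_jacobian M n \<Delta> \<omega> \<theta> i j = partial_deriv j (\<lambda>\<theta>'. psi M n \<Delta> \<omega> \<theta>' i) \<theta>"

definition supp0 :: "('a, 'h) model \<Rightarrow> nat set" where
  "supp0 M = {j. j < pdim M \<and> theta0 M j \<noteq> 0}"

definition sparsity :: "('a, 'h) model \<Rightarrow> nat" where
  "sparsity M = card (supp0 M)"

text \<open>The infimum over the empty set is \<open>\<infinity>\<close>, hence the extended reals.\<close>

definition theta_min :: "('a, 'h) model \<Rightarrow> ereal" where
  "theta_min M = (INF j\<in>supp0 M. ereal \<bar>theta0 M j\<bar>)"

definition cone0 :: "('a, 'h) model \<Rightarrow> (nat \<Rightarrow> real) set" where
  "cone0 M = {v \<in> Rvec (pdim M). l1norm ({..<pdim M} - supp0 M) v \<le> l1norm (supp0 M) v}"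

text \<open>The restricted factor of the score's Jacobian. Extended reals again because the index
  set of the outer infimum is empty when \<open>theta0\<close> vanishes; the denominator is positive for
  every nonzero \<open>v\<close> in the cone.\<close>

definition restricted_factor :: "('a, 'h) model \<Rightarrow> nat \<Rightarrow> real \<Rightarrow> 'a \<Rightarrow> ereal" where
  "restricted_factor M n \<Delta> \<omega> =
     (INF v\<in>{v \<in> cone0 M. \<exists>j<pdim M. v j \<noteq> 0}. INF \<theta>\<in>Param M.
        ereal (\<bar>\<Sum>i<pdim M. \<Sum>j<pdim M. v i * score_jacobian M n \<Delta> \<omega> \<theta> i j * v j\<bar>
               / (l1norm (supp0 M) v * linf (pdim M) v)))"

definition feasible :: "('a, 'h) model \<Rightarrow> nat \<Rightarrow> real \<Rightarrow> real \<Rightarrow> 'a \<Rightarrow> (nat \<Rightarrow> real) set" where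
  "feasible M n \<Delta> l \<omega> = {\<theta> \<in> Param M. linf (pdim M) (psi M n \<Delta> \<omega> \<theta>) \<le> l}"

text \<open>\<open>g\<close> is a measurable, \<open>Param M\<close>-valued map that selects a minimizer of the 1-norm whenever
  the feasible set is nonempty; otherwise its value is arbitrary.\<close>

definition dantzig_selector ::
    "('a, 'h) model \<Rightarrow> nat \<Rightarrow> real \<Rightarrow> real \<Rightarrow> ('a \<Rightarrow> nat \<Rightarrow> real) \<Rightarrow> bool" where
  "dantzig_selector M n \<Delta> l g \<longleftrightarrow>
     g \<in> measurable (Prob M) (borel_vec (pdim M)) \<and>
     (\<forall>\<omega>\<in>space (Prob M). g \<omega> \<in> Param M \<and>
        (feasible M n \<Delta> l \<omega> \<noteq> {} \<longrightarrow>
           is_arg_min (l1norm {..<pdim M}) (\<lambda>\<theta>. \<theta> \<in> feasible M n \<Delta> l \<omega>) (g \<omega>)))"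

definition score_dev ::
    "('a, 'h) model \<Rightarrow> nat \<Rightarrow> real \<Rightarrow> ('a \<Rightarrow> nat \<Rightarrow> real) \<Rightarrow> 'a \<Rightarrow> real" where
  "score_dev M n \<Delta> g \<omega> =
     linf (pdim M) (\<lambda>j. psi M n \<Delta> \<omega> (g \<omega>) j - psi M n \<Delta> \<omega> (theta0 M) j)"

definition est_error :: "('a, 'h) model \<Rightarrow> ('a \<Rightarrow> nat \<Rightarrow> real) \<Rightarrow> 'a \<Rightarrow> real" where
  "est_error M g \<omega> = linf (pdim M) (\<lambda>j. g \<omega> j - theta0 M j)"

definition supp_hat :: "('a, 'h) model \<Rightarrow> ('a \<Rightarrow> nat \<Rightarrow> real) \<Rightarrow> real \<Rightarrow> 'a \<Rightarrow> nat set" where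
  "supp_hat M g t \<omega> = {j. j < pdim M \<and> \<bar>g \<omega> j\<bar> > t}"

text \<open>\<open>R n = O\<^sub>p(a n)\<close>, where \<open>R n\<close> is a random variable on \<open>P n\<close>.\<close>

definition bigo_prob ::
    "(nat \<Rightarrow> 'a measure) \<Rightarrow> (nat \<Rightarrow> 'a \<Rightarrow> real) \<Rightarrow> (nat \<Rightarrow> real) \<Rightarrow> bool" where
  "bigo_prob P R a \<longleftrightarrow>
     (\<forall>\<epsilon>>0. \<exists>C>0. \<forall>\<^sub>F n in sequentially.
        measure (P n) {\<omega> \<in> space (P n). \<bar>R n \<omega>\<bar> > C * a n} \<le> \<epsilon>)"

end

theory Submission
  imports Defs
begin

text \<open>On the event that the score at the true parameter is at most \<open>\<lambda>\<^sub>n\<close>, that parameter is feasible, so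
  minimality of the 1-norm puts the error \<open>v\<close> into the cone. The mean value theorem along the segment
  from the truth to the estimator writes \<open>v\<^sup>T (\<psi>(estimator) - \<psi>(truth))\<close> as \<open>v\<^sup>T V(\<theta>) v\<close>, which
  is at most \<open>2 c\<^sub>n\<close> times the 1-norm of \<open>v\<close> on the support; the restricted factor turns this into the bound
  on the maximum norm of \<open>v\<close>.

  That event has probability tending to one. The score at the truth is a discretisation error, bounded by
  the Lipschitz condition and the increment moments, plus a martingale sum. Its maximum norm is
  dominated by the soft maximum \<open>ln (\<Sum>j. exp (b x\<^sub>j) + exp (- b x\<^sub>j)) / b\<close>. Hoeffding's lemma bounds the
  second-order part of its increments, and the first-order part has mean zero, so the expectation is at
  most \<open>ln (2 p) / b\<close> plus \<open>b / 2\<close> times the sum of the second moments of the increments' maximum norms.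
  These follow from the Ito isometry for elementary integrands, up to the harmless factor 4 lost in the limit.\<close>

section \<open>Functions of a variable number of coordinates\<close>

text \<open>Only fourth moments of the gradient and of the diffusion coefficient are at hand, so no
  exponential inequality is available for a single coordinate of the score, and a union bound would
  cost a power of p. The soft maximum charges the dimension once, as ln (2 p) / b, when the sum is
  still empty; each increment then costs b / 2 times a second moment. With b equal to sqrt (ln (2 p)
  / (n \<Delta>)) / K^2 the two costs are of the same order and give the second term of the rate
  condition. The first term arises in the same way from an AM-GM inequality with a free weight q
  that separates the gradient from the increments of X and Z. Since both estimates are bounds on
  expectations, Markov's inequality concludes.

  The Ito integral is given only as an L2 limit of elementary integrals. Its second moments are
  therefore reached by comparison, (a + b)^2 \<le> 2 a^2 + 2 b^2, once for the integrand and once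
  for the integral: this is the factor 4. The comparison needs bounded weights, whereas the gradient
  is unbounded, so a truncation argument follows it.\<close>

lemma linf_nonneg: "0 \<le> linf d v"
  unfolding linf_def by (intro Max_ge) auto

lemma abs_le_linf: "j < d \<Longrightarrow> \<bar>v j\<bar> \<le> linf d v"
  unfolding linf_def by (intro Max_ge) auto

lemma linf_le_iff: "0 \<le> c \<Longrightarrow> linf d v \<le> c \<longleftrightarrow> (\<forall>j<d. \<bar>v j\<bar> \<le> c)"
  unfolding linf_def by (subst Max_le_iff) auto

lemma linf_cong: "(\<And>j. j < d \<Longrightarrow> \<bar>v j\<bar> = \<bar>w j\<bar>) \<Longrightarrow> linf d v = linf d w"
  using abs_le_linf[of _ d v] abs_le_linf[of _ d w]
  by (intro antisym) (simp_all add: linf_le_iff linf_nonneg)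

lemma linf_zero_dim [simp]: "linf 0 v = 0"
  by (simp add: linf_def)

lemma linf_Suc: "linf (Suc d) v = max \<bar>v d\<bar> (linf d v)"
proof -
  have "insert 0 ((\<lambda>j. \<bar>v j\<bar>) ` {..<Suc d}) = insert \<bar>v d\<bar> (insert 0 ((\<lambda>j. \<bar>v j\<bar>) ` {..<d}))"
    by (auto simp: lessThan_Suc)
  then show ?thesis unfolding linf_def by (simp add: Max_insert)
qed

lemma borel_measurable_linf:
  assumes "\<And>j. j < d \<Longrightarrow> (\<lambda>\<omega>. v \<omega> j) \<in> borel_measurable N"
  shows "(\<lambda>\<omega>. linf d (v \<omega>)) \<in> borel_measurable N"
  using assms
proof (induction d)
  case (Suc d)
  have [measurable]: "(\<lambda>\<omega>. linf d (v \<omega>)) \<in> borel_measurable N" "(\<lambda>\<omega>. v \<omega> d) \<in> borel_measurable N"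
    using Suc by auto
  show ?case unfolding linf_Suc by measurable
qed simp

text \<open>A basic open box of the product topology may restrict every coordinate, but two members
  of \<open>Rvec d\<close> agree at all indices from \<open>d\<close> on. Only the first
  \<open>d\<close> radii matter, and these have a positive minimum.\<close>

lemma Rvec_box_neighbourhood:
  assumes "openin (top_of_set (Rvec d)) U" "x \<in> U"
  obtains e where "e > 0" "\<And>y. y \<in> Rvec d \<Longrightarrow> (\<And>j. j < d \<Longrightarrow> \<bar>y j - x j\<bar> < e) \<Longrightarrow> y \<in> U"
proof -
  obtain T where T: "open T" "U = Rvec d \<inter> T"
    using assms(1) by (auto simp: openin_open)
  have xR: "x \<in> Rvec d" and xT: "x \<in> T" using assms(2) T by auto
  have "openin (product_topology (\<lambda>_::nat. euclidean :: real topology) UNIV) T"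
    using T(1) by (simp add: open_fun_def)
  from product_topology_open_contains_basis[OF this xT]
  obtain X where X: "x \<in> (\<Pi>\<^sub>E i\<in>UNIV. X i)" "\<And>i. open (X i)" "(\<Pi>\<^sub>E i\<in>UNIV. X i) \<subseteq> T"
    by auto
  have "\<exists>e. e > 0 \<and> (\<forall>t. \<bar>t - x j\<bar> < e \<longrightarrow> t \<in> X j)" for j
  proof -
    have "x j \<in> X j" using X(1) by auto
    with X(2)[of j] obtain e where "e > 0" "ball (x j) e \<subseteq> X j"
      using open_contains_ball by blast
    then show ?thesis by (intro exI[of _ e]) (auto simp: dist_real_def subset_iff abs_minus_commute)
  qed
  then obtain e where e: "\<And>j. e j > 0" "\<And>j t. \<bar>t - x j\<bar> < e j \<Longrightarrow> t \<in> X j" by metis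
  \<comment> \<open>The extra 1 keeps the set nonempty when \<open>d\<close> is 0.\<close>
  define e0 where "e0 = Min (insert 1 (e ` {..<d}))"
  have e0: "e0 > 0" "\<And>j. j < d \<Longrightarrow> e0 \<le> e j"
    unfolding e0_def using e(1) by (auto simp: Min_gr_iff intro: Min_le)
  show ?thesis
  proof (rule that[OF e0(1)])
    fix y assume y: "y \<in> Rvec d" "\<And>j. j < d \<Longrightarrow> \<bar>y j - x j\<bar> < e0"
    have "y j \<in> X j" for j
    proof (cases "j < d")
      case True
      then show ?thesis using y(2)[OF True] e0(2)[OF True] by (intro e(2)) linarith
    next
      case False
      then have "y j = x j" using y(1) xR by (auto simp: Rvec_def PiE_def extensional_def)
      then show ?thesis using X(1) by auto
    qed
    then have "y \<in> T" using X(3) by auto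
    then show "y \<in> U" using y T by auto
  qed
qed

text \<open>The mean value inequality for \<open>f\<close> minus the linear function with slope
  \<open>D\<close>. Later \<open>D\<close> is the partial derivative at a nearby base point, and the
  right-hand side is the error of one coordinate step.\<close>

lemma C1_on_coordinate_increment:
  assumes C1: "C1_on d U f" and k: "k < d"
    and U: "\<And>s. s \<in> closed_segment a b \<Longrightarrow> y(k := s) \<in> U"
    and bound: "\<And>s. s \<in> closed_segment a b \<Longrightarrow> \<bar>partial_deriv k f (y(k := s)) - D\<bar> \<le> e"
  shows "\<bar>f (y(k := b)) - f (y(k := a)) - (b - a) * D\<bar> \<le> e * \<bar>b - a\<bar>"
proof -
  let ?g = "\<lambda>s. f (y(k := s)) - s * D"
  have der: "(?g has_field_derivative partial_deriv k f (y(k := s)) - D) (at s within closed_segment a b)"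
    if s: "s \<in> closed_segment a b" for s
  proof -
    have "(\<lambda>x. f ((y(k := s))(k := x))) differentiable (at ((y(k := s)) k))"
      using C1 k U[OF s] unfolding C1_on_def by blast
    then have "(\<lambda>x. f (y(k := x))) differentiable (at s)" by simp
    then have "((\<lambda>x. f (y(k := x))) has_real_derivative deriv (\<lambda>x. f (y(k := x))) s) (at s)"
      by (metis DERIV_imp_deriv real_differentiable_def)
    then have "((\<lambda>x. f (y(k := x))) has_real_derivative partial_deriv k f (y(k := s))) (at s)"
      by (simp add: partial_deriv_def)
    then have "(?g has_field_derivative partial_deriv k f (y(k := s)) - D) (at s)"
      by (auto intro!: derivative_eq_intros)
    then show ?thesis by (rule has_field_derivative_at_within)
  qed
  have "norm (?g b - ?g a) \<le> e * norm (b - a)"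
    by (rule field_differentiable_bound[OF _ der]) (use bound in auto)
  then show ?thesis by (simp add: algebra_simps)
qed

text \<open>The classical passage from continuous partial derivatives to differentiability: the
  coordinates are moved one after the other, and every step is compared with the partial derivative
  at \<open>x\<close> itself. The displaced point is restricted to indices below \<open>d\<close>
  because members of \<open>U\<close> are extensional.\<close>

lemma has_real_derivative_direction:
  assumes U: "openin (top_of_set (Rvec d)) U" and C1: "C1_on d U f" and x: "x \<in> U"
  shows "((\<lambda>h. f (\<lambda>j\<in>{..<d}. x j + h * v j)) has_real_derivative
           (\<Sum>j<d. v j * partial_deriv j f x)) (at 0)"
  unfolding DERIV_def
proof (rule LIM_I)
  fix r :: real assume r: "r > 0"
  \<comment> \<open>The added 1 makes \<open>V\<close> positive even for a zero direction and the
    final estimate strict.\<close>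
  define V where "V = (\<Sum>j<d. \<bar>v j\<bar>) + 1"
  have V: "V > 0" unfolding V_def by (simp add: add_nonneg_pos sum_nonneg)
  have vV: "\<bar>v j\<bar> < V" if "j < d" for j
  proof -
    have "\<bar>v j\<bar> \<le> (\<Sum>j<d. \<bar>v j\<bar>)" using that by (intro member_le_sum) auto
    then show ?thesis by (simp add: V_def)
  qed
  define e where "e = r / V"
  have e: "e > 0" using r V by (simp add: e_def)
  have "\<exists>\<eta>>0. \<forall>y\<in>Rvec d. (\<forall>i<d. \<bar>y i - x i\<bar> < \<eta>) \<longrightarrow> y \<in> U \<and> \<bar>partial_deriv j f y - partial_deriv j f x\<bar> < e"
    if j: "j < d" for j
  proof -
    have "continuous_on U (partial_deriv j f)" using C1 j by (auto simp: C1_on_def)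
    then have "openin (top_of_set U) (U \<inter> partial_deriv j f -` ball (partial_deriv j f x) e)"
      by (rule continuous_openin_preimage_gen) simp
    then have "openin (top_of_set (Rvec d)) (U \<inter> partial_deriv j f -` ball (partial_deriv j f x) e)"
      using U openin_trans by blast
    from Rvec_box_neighbourhood[OF this, of x] obtain \<eta> where "\<eta> > 0"
      "\<And>y. y \<in> Rvec d \<Longrightarrow> (\<And>j. j < d \<Longrightarrow> \<bar>y j - x j\<bar> < \<eta>) \<Longrightarrow> y \<in> U \<inter> partial_deriv j f -` ball (partial_deriv j f x) e"
      using x e by auto
    then show ?thesis by (intro exI[of _ \<eta>]) (auto simp: dist_real_def abs_minus_commute)
  qed
  then obtain \<eta> where \<eta>: "\<And>j. j < d \<Longrightarrow> \<eta> j > 0"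
    "\<And>j y. j < d \<Longrightarrow> y \<in> Rvec d \<Longrightarrow> (\<And>i. i < d \<Longrightarrow> \<bar>y i - x i\<bar> < \<eta> j) \<Longrightarrow> y \<in> U \<and> \<bar>partial_deriv j f y - partial_deriv j f x\<bar> < e"
    by metis
  define \<eta>0 where "\<eta>0 = Min (insert 1 (\<eta> ` {..<d}))"
  have \<eta>0: "\<eta>0 > 0" "\<And>j. j < d \<Longrightarrow> \<eta>0 \<le> \<eta> j"
    unfolding \<eta>0_def using \<eta>(1) by (auto simp: Min_gr_iff intro: Min_le)
  have xR: "x \<in> Rvec d" using U x openin_imp_subset by blast
  have x0: "(\<lambda>j\<in>{..<d}. x j) = x" using xR by (auto simp: Rvec_def)
  let ?L = "\<Sum>j<d. v j * partial_deriv j f x"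
  show "\<exists>s>0. \<forall>h. h \<noteq> 0 \<and> norm (h - 0) < s \<longrightarrow>
     norm ((f (\<lambda>j\<in>{..<d}. x j + (0 + h) * v j) - f (\<lambda>j\<in>{..<d}. x j + 0 * v j)) / h - ?L) < r"
  proof (intro exI[of _ "\<eta>0 / V"] conjI allI impI)
    show "\<eta>0 / V > 0" using \<eta>0 V by simp
    fix h :: real assume h: "h \<noteq> 0 \<and> norm (h - 0) < \<eta>0 / V"
    have hV: "\<bar>h\<bar> * V < \<eta>0" using h V by (simp add: pos_less_divide_eq)
    \<comment> \<open>The first \<open>k\<close> coordinates have already moved. All points between
      \<open>y k\<close> and \<open>y (Suc k)\<close> stay in the box around \<open>x\<close>, hence
      in \<open>U\<close>.\<close>
    define y where "y k = (\<lambda>j\<in>{..<d}. if j < k then x j + h * v j else x j)" for k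
    have step: "\<bar>f (y (Suc k)) - f (y k) - h * (v k * partial_deriv k f x)\<bar> \<le> e * (\<bar>h\<bar> * \<bar>v k\<bar>)" if k: "k < d" for k
    proof -
      have in_box: "(y k)(k := s) \<in> U \<and> \<bar>partial_deriv k f ((y k)(k := s)) - partial_deriv k f x\<bar> < e"
        if s: "s \<in> closed_segment (x k) (x k + h * v k)" for s
      proof (rule \<eta>(2)[OF k])
        show "(y k)(k := s) \<in> Rvec d" using k by (auto simp: Rvec_def y_def PiE_def extensional_def)
        fix i assume i: "i < d"
        have hv: "\<bar>h * v j\<bar> < \<eta>0" if "j < d" for j
        proof -
          have "\<bar>h\<bar> * \<bar>v j\<bar> \<le> \<bar>h\<bar> * V" using vV[OF that] by (intro mult_left_mono) auto
          then show ?thesis using hV by (simp add: abs_mult)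
        qed
        have "\<bar>s - x k\<bar> \<le> \<bar>h * v k\<bar>" using s by (auto simp: closed_segment_eq_real_ivl split: if_splits)
        then have "\<bar>((y k)(k := s)) i - x i\<bar> < \<eta>0"
          using hv[OF k] hv[OF i] \<eta>0(1) i by (auto simp: y_def)
        then show "\<bar>((y k)(k := s)) i - x i\<bar> < \<eta> k" using \<eta>0(2)[OF k] by linarith
      qed
      have *: "y (Suc k) = (y k)(k := x k + h * v k)" "(y k)(k := x k) = y k"
        using k by (auto simp: y_def fun_eq_iff)
      have "\<bar>f ((y k)(k := x k + h * v k)) - f ((y k)(k := x k)) - (x k + h * v k - x k) * partial_deriv k f x\<bar>
          \<le> e * \<bar>x k + h * v k - x k\<bar>"
        by (rule C1_on_coordinate_increment[OF C1 k]) (use in_box in \<open>auto intro: less_imp_le\<close>)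
      then show ?thesis unfolding * by (simp add: abs_mult mult.assoc)
    qed
    have yd: "y d = (\<lambda>j\<in>{..<d}. x j + h * v j)" "y 0 = x"
      using x0 by (auto simp: y_def fun_eq_iff)
    have "f (y d) - f (y 0) - h * ?L = (\<Sum>k<d. f (y (Suc k)) - f (y k) - h * (v k * partial_deriv k f x))"
      using sum_lessThan_telescope[of "\<lambda>k. f (y k)" d] by (simp add: sum_subtractf sum_distrib_left)
    also have "\<bar>\<dots>\<bar> \<le> (\<Sum>k<d. e * (\<bar>h\<bar> * \<bar>v k\<bar>))"
      by (rule order_trans[OF sum_abs sum_mono]) (use step in auto)
    also have "\<dots> = e * \<bar>h\<bar> * (V - 1)" by (simp add: V_def sum_distrib_left mult.assoc)
    also have "\<dots> < e * \<bar>h\<bar> * V" using e h by simp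
    also have "\<dots> = r * \<bar>h\<bar>" using V by (simp add: e_def)
    finally have *: "\<bar>f (y d) - f (y 0) - h * ?L\<bar> < r * \<bar>h\<bar>" .
    have "(f (y d) - f (y 0)) / h - ?L = (f (y d) - f (y 0) - h * ?L) / h"
      using h by (simp add: field_simps)
    then have "\<bar>(f (y d) - f (y 0)) / h - ?L\<bar> < r"
      using * h by (simp add: abs_divide pos_divide_less_eq)
    then show "norm ((f (\<lambda>j\<in>{..<d}. x j + (0 + h) * v j) - f (\<lambda>j\<in>{..<d}. x j + 0 * v j)) / h - ?L) < r"
      by (simp add: yd x0)
  qed
qed

lemma has_real_derivative_along_line:
  assumes U: "openin (top_of_set (Rvec d)) U" and C1: "C1_on d U f"
    and x: "(\<lambda>j\<in>{..<d}. a j + u * v j) \<in> U"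
  shows "((\<lambda>u. f (\<lambda>j\<in>{..<d}. a j + u * v j)) has_real_derivative
           (\<Sum>j<d. v j * partial_deriv j f (\<lambda>j\<in>{..<d}. a j + u * v j))) (at u)"
proof -
  let ?x = "\<lambda>j\<in>{..<d}. a j + u * v j"
  have eq: "(\<lambda>h. f (\<lambda>j\<in>{..<d}. ?x j + h * v j)) = (\<lambda>h. f (\<lambda>j\<in>{..<d}. a j + (u + h) * v j))"
    by (intro ext arg_cong[where f = f]) (auto simp: algebra_simps)
  have "((\<lambda>h. f (\<lambda>j\<in>{..<d}. a j + (u + h) * v j)) has_real_derivative
          (\<Sum>j<d. v j * partial_deriv j f ?x)) (at 0)"
    using has_real_derivative_direction[OF U C1 x, of v] unfolding eq .
  then show ?thesis
    using DERIV_shift[of "\<lambda>u. f (\<lambda>j\<in>{..<d}. a j + u * v j)" _ 0 u] by (simp add: add.commute)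
qed

section \<open>Cone argument\<close>

lemma vjoin_in_Rvec: "vjoin d1 d2 a b \<in> Rvec (d1 + d2)"
  by (simp add: vjoin_def Rvec_def)

lemma Param_subset_Rvec: "Param M \<subseteq> Rvec (pdim M)"
  by (auto simp: Param_def pdim_def vjoin_in_Rvec)

lemma Yproc_in_Rvec: "Yproc M t \<omega> \<in> Rvec (pdim M)"
  by (simp add: Yproc_def yvec_def pdim_def vjoin_in_Rvec)

lemma C1_on_has_partial_deriv:
  assumes "C1_on d U f" "\<theta> \<in> U" "j < d"
  shows "((\<lambda>x. f (\<theta>(j := x))) has_real_derivative partial_deriv j f \<theta>) (at (\<theta> j))"
proof -
  have "(\<lambda>x. f (\<theta>(j := x))) differentiable (at (\<theta> j))"
    using assms unfolding C1_on_def by blast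
  then show ?thesis
    unfolding partial_deriv_def by (metis DERIV_imp_deriv real_differentiable_def)
qed

section \<open>Derivative of the score along a segment\<close>

definition segment_point :: "('a, 'h) model \<Rightarrow> (nat \<Rightarrow> real) \<Rightarrow> real \<Rightarrow> nat \<Rightarrow> real" where
  "segment_point M \<theta> u = (\<lambda>j\<in>{..<pdim M}. theta0 M j + u * (\<theta> j - theta0 M j))"

text \<open>This explicit form is what identifies the derivative along a segment with the Jacobian
  applied to the direction. The neighbourhood \<open>U\<close> depends on \<open>y\<close>, hence on
  \<open>k\<close> and \<open>\<omega>\<close>, so the sum is differentiated term by term instead of
  forming a common neighbourhood for all observations.\<close>

lemma score_jacobian_eq:
  fixes M :: "('a, 'h) model"
  assumes S: "\<And>k. S k = drift M (Yproc M (real (k - 1) * \<Delta>) \<omega>)"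
    and smooth: "\<And>y. y \<in> Rvec (pdim M) \<Longrightarrow>
        \<exists>U. openin (top_of_set (Rvec (pdim M))) U \<and> Param M \<subseteq> U \<and> C2_on (pdim M) U (drift M y)"
    and \<theta>: "\<theta> \<in> Param M" and i: "i < pdim M" and j: "j < pdim M"
  shows "score_jacobian M n \<Delta> \<omega> \<theta> i j = 1 / (real n * \<Delta>) * (\<Sum>k=1..n.
      partial_deriv j (partial_deriv i (S k)) \<theta> *
        (Xproc M (real k * \<Delta>) \<omega> - Xproc M (real (k - 1) * \<Delta>) \<omega> - S k \<theta> * \<Delta>)
      - partial_deriv i (S k) \<theta> * (partial_deriv j (S k) \<theta> * \<Delta>))"
proof -
  have *: "((\<lambda>x. partial_deriv i (S k) (\<theta>(j := x))) has_real_derivative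
            partial_deriv j (partial_deriv i (S k)) \<theta>) (at (\<theta> j)) \<and>
        ((\<lambda>x. S k (\<theta>(j := x))) has_real_derivative partial_deriv j (S k) \<theta>) (at (\<theta> j))" for k
  proof -
    obtain U where "Param M \<subseteq> U" "C2_on (pdim M) U (S k)"
      using smooth[OF Yproc_in_Rvec] unfolding S by blast
    then show ?thesis
      using i j \<theta> by (auto simp: C2_on_def intro!: C1_on_has_partial_deriv)
  qed
  have "((\<lambda>x. psi M n \<Delta> \<omega> (\<theta>(j := x)) i) has_real_derivative 1 / (real n * \<Delta>) * (\<Sum>k=1..n.
      partial_deriv j (partial_deriv i (S k)) \<theta> *
        (Xproc M (real k * \<Delta>) \<omega> - Xproc M (real (k - 1) * \<Delta>) \<omega> - S k \<theta> * \<Delta>)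
      - partial_deriv i (S k) \<theta> * (partial_deriv j (S k) \<theta> * \<Delta>))) (at (\<theta> j))"
    unfolding psi_def S[symmetric]
  proof (intro DERIV_cmult DERIV_sum)
    fix k show "((\<lambda>x. partial_deriv i (S k) (\<theta>(j := x)) *
        (Xproc M (real k * \<Delta>) \<omega> - Xproc M (real (k - 1) * \<Delta>) \<omega> - S k (\<theta>(j := x)) * \<Delta>)) has_real_derivative
      partial_deriv j (partial_deriv i (S k)) \<theta> *
        (Xproc M (real k * \<Delta>) \<omega> - Xproc M (real (k - 1) * \<Delta>) \<omega> - S k \<theta> * \<Delta>)
      - partial_deriv i (S k) \<theta> * (partial_deriv j (S k) \<theta> * \<Delta>)) (at (\<theta> j))"
      using *[of k] by (auto intro!: derivative_eq_intros simp: algebra_simps)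
  qed
  then show ?thesis
    unfolding score_jacobian_def partial_deriv_def[of j "\<lambda>\<theta>'. psi M n \<Delta> \<omega> \<theta>' i"] by (rule DERIV_imp_deriv)
qed

lemma psi_has_derivative_along_segment:
  fixes M :: "('a, 'h) model"
  assumes smooth: "\<And>y. y \<in> Rvec (pdim M) \<Longrightarrow>
        \<exists>U. openin (top_of_set (Rvec (pdim M))) U \<and> Param M \<subseteq> U \<and> C2_on (pdim M) U (drift M y)"
    and x: "segment_point M \<theta> u \<in> Param M" and i: "i < pdim M"
  shows "((\<lambda>u. psi M n \<Delta> \<omega> (segment_point M \<theta> u) i) has_real_derivative
           (\<Sum>j<pdim M. score_jacobian M n \<Delta> \<omega> (segment_point M \<theta> u) i j * (\<theta> j - theta0 M j))) (at u)"
proof -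
  define S where "S k = drift M (Yproc M (real (k - 1) * \<Delta>) \<omega>)" for k
  define v where "v j = \<theta> j - theta0 M j" for j
  let ?x = "segment_point M \<theta>"
  have *: "((\<lambda>u. partial_deriv i (S k) (?x u)) has_real_derivative
            (\<Sum>j<pdim M. v j * partial_deriv j (partial_deriv i (S k)) (?x u))) (at u) \<and>
        ((\<lambda>u. S k (?x u)) has_real_derivative (\<Sum>j<pdim M. v j * partial_deriv j (S k) (?x u))) (at u)" for k
  proof -
    obtain U where "openin (top_of_set (Rvec (pdim M))) U" "Param M \<subseteq> U" "C2_on (pdim M) U (S k)"
      using smooth[OF Yproc_in_Rvec] unfolding S_def by blast
    then show ?thesis
      using i x unfolding segment_point_def v_def[symmetric]
      by (auto simp: C2_on_def intro!: has_real_derivative_along_line)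
  qed
  \<comment> \<open>The direction enters both terms of the product rule linearly; once it is pulled
    out, the summands are those of a Jacobian entry.\<close>
  have pull_sum: "(\<Sum>j<pdim M. v j * a j) * r - q * ((\<Sum>j<pdim M. v j * b j) * \<Delta>)
      = (\<Sum>j<pdim M. (a j * r - q * (b j * \<Delta>)) * v j)" for a b :: "nat \<Rightarrow> real" and r q
    by (simp add: sum_distrib_left sum_distrib_right sum_subtractf algebra_simps)
  let ?R = "\<lambda>k u. Xproc M (real k * \<Delta>) \<omega> - Xproc M (real (k - 1) * \<Delta>) \<omega> - S k (?x u) * \<Delta>"
  have "((\<lambda>u. psi M n \<Delta> \<omega> (?x u) i) has_real_derivative 1 / (real n * \<Delta>) * (\<Sum>k=1..n.
      (\<Sum>j<pdim M. v j * partial_deriv j (partial_deriv i (S k)) (?x u)) * ?R k u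
      - partial_deriv i (S k) (?x u) * ((\<Sum>j<pdim M. v j * partial_deriv j (S k) (?x u)) * \<Delta>))) (at u)"
    unfolding psi_def S_def[symmetric]
  proof (intro DERIV_cmult DERIV_sum)
    fix k show "((\<lambda>u. partial_deriv i (S k) (?x u) * ?R k u) has_real_derivative
      (\<Sum>j<pdim M. v j * partial_deriv j (partial_deriv i (S k)) (?x u)) * ?R k u
      - partial_deriv i (S k) (?x u) * ((\<Sum>j<pdim M. v j * partial_deriv j (S k) (?x u)) * \<Delta>)) (at u)"
      using *[of k] by (auto intro!: derivative_eq_intros simp: algebra_simps)
  qed
  also have "1 / (real n * \<Delta>) * (\<Sum>k=1..n.
      (\<Sum>j<pdim M. v j * partial_deriv j (partial_deriv i (S k)) (?x u)) * ?R k u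
      - partial_deriv i (S k) (?x u) * ((\<Sum>j<pdim M. v j * partial_deriv j (S k) (?x u)) * \<Delta>))
    = 1 / (real n * \<Delta>) * (\<Sum>k=1..n. \<Sum>j<pdim M.
       (partial_deriv j (partial_deriv i (S k)) (?x u) * ?R k u
      - partial_deriv i (S k) (?x u) * (partial_deriv j (S k) (?x u) * \<Delta>)) * v j)"
    unfolding pull_sum ..
  also have "\<dots> = (\<Sum>j<pdim M. score_jacobian M n \<Delta> \<omega> (?x u) i j * v j)"
    unfolding sum.swap[of _ _ "{1..n}"] sum_distrib_left[of "1 / (real n * \<Delta>)"]
    using score_jacobian_eq[of S, OF S_def smooth x i]
    by (intro sum.cong refl) (simp add: sum_distrib_right sum_divide_distrib)
  finally show ?thesis by (simp add: v_def)
qed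

section \<open>Cone condition and deterministic error bound\<close>

lemma l1norm_split:
  assumes "T \<subseteq> {..<d}"
  shows "l1norm {..<d} v = l1norm T v + l1norm ({..<d} - T) v"
  unfolding l1norm_def using assms by (metis add.commute finite_lessThan sum.subset_diff)

text \<open>Off the support the truth vanishes, so there the error equals the estimator. By
  minimality its 1-norm is at most the loss of 1-norm on the support, and the triangle inequality
  bounds that loss by the 1-norm of the error on the support.\<close>

lemma l1_minimizer_in_cone:
  assumes \<theta>: "\<theta> \<in> Param M" and min: "l1norm {..<pdim M} \<theta> \<le> l1norm {..<pdim M} (theta0 M)"
  shows "(\<lambda>j\<in>{..<pdim M}. \<theta> j - theta0 M j) \<in> cone0 M"
proof -
  let ?T = "supp0 M" and ?N = "{..<pdim M} - supp0 M"
  let ?v = "\<lambda>j\<in>{..<pdim M}. \<theta> j - theta0 M j"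
  have T: "?T \<subseteq> {..<pdim M}" by (auto simp: supp0_def)
  have "l1norm ?N ?v = l1norm ?N \<theta>" "l1norm ?N (theta0 M) = 0"
    unfolding l1norm_def by (auto simp: supp0_def)
  moreover have "l1norm ?T (theta0 M) - l1norm ?T \<theta> \<le> l1norm ?T ?v"
    unfolding l1norm_def sum_subtractf[symmetric] using T by (intro sum_mono) auto
  ultimately show ?thesis
    using min unfolding l1norm_split[OF T] by (simp add: cone0_def Rvec_def)
qed

text \<open>This concerns a single \<open>\<omega>\<close>; probability enters only through the
  event on which the premises hold. The premise \<open>segment\<close> makes \<open>Param M\<close>
  star-shaped about the truth, which keeps the intermediate point of the mean value theorem in the
  index set of the inner infimum.\<close>

lemma est_error_le_score_dev:
  fixes M :: "('a, 'h) model"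
  assumes smooth: "\<And>y. y \<in> Rvec (pdim M) \<Longrightarrow>
        \<exists>U. openin (top_of_set (Rvec (pdim M))) U \<and> Param M \<subseteq> U \<and> C2_on (pdim M) U (drift M y)"
    and segment: "\<And>\<theta> u. \<theta> \<in> Param M \<Longrightarrow> u \<in> {0..1} \<Longrightarrow> segment_point M \<theta> u \<in> Param M"
    and theta0: "theta0 M \<in> Param M"
    and g: "g \<omega> \<in> Param M" and min: "l1norm {..<pdim M} (g \<omega>) \<le> l1norm {..<pdim M} (theta0 M)"
    and \<delta>: "\<delta> > 0" and factor: "restricted_factor M n \<Delta> \<omega> > ereal \<delta>"
  shows "est_error M g \<omega> \<le> 2 / \<delta> * score_dev M n \<Delta> g \<omega>"
proof -
  define v where "v = (\<lambda>j\<in>{..<pdim M}. g \<omega> j - theta0 M j)"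
  define c where "c = score_dev M n \<Delta> g \<omega>"
  have c: "c \<ge> 0" unfolding c_def score_dev_def by (rule linf_nonneg)
  have err: "est_error M g \<omega> = linf (pdim M) v"
    unfolding est_error_def v_def by (intro linf_cong) auto
  have cone: "v \<in> cone0 M" unfolding v_def using g min by (rule l1_minimizer_in_cone)
  show ?thesis
  proof (cases "\<exists>j<pdim M. v j \<noteq> 0")
    case False
    then have "linf (pdim M) v \<le> 0" by (simp add: linf_le_iff)
    also have "0 \<le> 2 / \<delta> * c" using c \<delta> by simp
    finally show ?thesis by (simp add: err c_def)
  next
    case True
    then obtain j where j: "j < pdim M" "v j \<noteq> 0" by blast
    have T: "supp0 M \<subseteq> {..<pdim M}" by (auto simp: supp0_def)
    have vp: "linf (pdim M) v > 0" using abs_le_linf[OF j(1), of v] j(2) by linarith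
    have "0 < l1norm {..<pdim M} v"
      unfolding l1norm_def using j by (intro sum_pos2[of _ j]) auto
    \<comment> \<open>The cone condition is used here; it is the source of the 2 in
      \<open>2 / \<delta>\<close>.\<close>
    also have le2: "l1norm {..<pdim M} v \<le> 2 * l1norm (supp0 M) v"
      using cone unfolding l1norm_split[OF T] by (simp add: cone0_def)
    finally have Tp: "l1norm (supp0 M) v > 0" by simp
    let ?x = "segment_point M (g \<omega>)"
    \<comment> \<open>Contracting with \<open>v\<close> before differentiating gives a real-valued
      function, so a single intermediate point serves all coordinates, as the restricted factor
      requires.\<close>
    define G where "G u = (\<Sum>i<pdim M. v i * psi M n \<Delta> \<omega> (?x u) i)" for u
    define Q where "Q \<theta> = (\<Sum>i<pdim M. \<Sum>j<pdim M. v i * score_jacobian M n \<Delta> \<omega> \<theta> i j * v j)" for \<theta>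
    have "(G has_real_derivative Q (?x u)) (at u)" if "0 \<le> u" "u \<le> 1" for u
    proof -
      have "?x u \<in> Param M" using segment[OF g] that by auto
      then have "(G has_real_derivative (\<Sum>i<pdim M. v i * (\<Sum>j<pdim M. score_jacobian M n \<Delta> \<omega> (?x u) i j * (g \<omega> j - theta0 M j)))) (at u)"
        unfolding G_def[abs_def]
        by (intro DERIV_sum DERIV_cmult psi_has_derivative_along_segment[OF smooth]) auto
      also have "(\<Sum>i<pdim M. v i * (\<Sum>j<pdim M. score_jacobian M n \<Delta> \<omega> (?x u) i j * (g \<omega> j - theta0 M j))) = Q (?x u)"
        unfolding Q_def sum_distrib_left by (intro sum.cong refl) (auto simp: v_def)
      finally show ?thesis .
    qed
    from MVT2[OF zero_less_one this] obtain z where z: "0 < z" "z < 1" "G 1 - G 0 = Q (?x z)"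
      by auto
    have zP: "?x z \<in> Param M" using segment[OF g] z by auto
    have ends: "?x 1 = g \<omega>" "?x 0 = theta0 M"
      using g theta0 Param_subset_Rvec[of M] by (auto simp: segment_point_def Rvec_def fun_eq_iff PiE_def extensional_def)
    have "G 1 - G 0 = (\<Sum>i<pdim M. v i * (psi M n \<Delta> \<omega> (g \<omega>) i - psi M n \<Delta> \<omega> (theta0 M) i))"
      unfolding G_def ends by (simp add: sum_subtractf right_diff_distrib)
    also have "\<bar>\<dots>\<bar> \<le> (\<Sum>i<pdim M. \<bar>v i\<bar> * c)"
    proof (intro order_trans[OF sum_abs sum_mono])
      fix i assume "i \<in> {..<pdim M}"
      then have "\<bar>psi M n \<Delta> \<omega> (g \<omega>) i - psi M n \<Delta> \<omega> (theta0 M) i\<bar> \<le> c"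
        unfolding c_def score_dev_def
        using abs_le_linf[of i "pdim M" "\<lambda>i. psi M n \<Delta> \<omega> (g \<omega>) i - psi M n \<Delta> \<omega> (theta0 M) i"] by auto
      then show "\<bar>v i * (psi M n \<Delta> \<omega> (g \<omega>) i - psi M n \<Delta> \<omega> (theta0 M) i)\<bar> \<le> \<bar>v i\<bar> * c"
        unfolding abs_mult by (rule mult_left_mono) simp
    qed
    also have "\<dots> = l1norm {..<pdim M} v * c" by (simp add: l1norm_def sum_distrib_right)
    also have "\<dots> \<le> 2 * l1norm (supp0 M) v * c" using le2 c by (intro mult_right_mono) auto
    finally have upper: "\<bar>Q (?x z)\<bar> \<le> 2 * l1norm (supp0 M) v * c" unfolding z(3) .
    have "restricted_factor M n \<Delta> \<omega> \<le> ereal (\<bar>Q (?x z)\<bar> / (l1norm (supp0 M) v * linf (pdim M) v))"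
      unfolding restricted_factor_def Q_def using cone True zP
      by (intro INF_lower2[of v] INF_lower2[of "?x z"]) auto
    with factor have "ereal \<delta> < ereal (\<bar>Q (?x z)\<bar> / (l1norm (supp0 M) v * linf (pdim M) v))"
      by (rule less_le_trans)
    then have "\<delta> * (l1norm (supp0 M) v * linf (pdim M) v) < \<bar>Q (?x z)\<bar>"
      using Tp vp by (simp add: pos_less_divide_eq)
    with upper have "l1norm (supp0 M) v * (\<delta> * linf (pdim M) v) < l1norm (supp0 M) v * (2 * c)"
      by (simp add: mult_ac)
    then have "\<delta> * linf (pdim M) v < 2 * c" using Tp by simp
    then show ?thesis unfolding err c_def[symmetric] using \<delta> by (simp add: field_simps)
  qed
qed

section \<open>Soft maximum and martingale sums\<close>

text \<open>By convexity each exponential lies below its chord over [-c, c], which reduces the claim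
  to a two-point distribution on -c and c with the same mean. The mean need not be zero: it stays in
  the exponent and later becomes the gradient term.\<close>

lemma finite_Hoeffding_lemma:
  fixes w y :: "'i \<Rightarrow> real"
  assumes w: "\<And>i. i \<in> I \<Longrightarrow> 0 \<le> w i" "sum w I = 1"
    and y: "\<And>i. i \<in> I \<Longrightarrow> \<bar>y i\<bar> \<le> c" and b: "b \<ge> 0"
  shows "(\<Sum>i\<in>I. w i * exp (b * y i)) \<le> exp (b * (\<Sum>i\<in>I. w i * y i) + b\<^sup>2 * c\<^sup>2 / 2)"
proof -
  have "I \<noteq> {}" using w(2) by auto
  then have "c \<ge> 0" using y abs_ge_zero order_trans by blast
  show ?thesis
  proof (cases "c = 0")
    case True
    then have "y i = 0" if "i \<in> I" for i using y[OF that] by simp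
    then show ?thesis using w True by simp
  next
    case False
    then have c: "c > 0" using \<open>c \<ge> 0\<close> by simp
    define m where "m = (\<Sum>i\<in>I. w i * y i)"
    \<comment> \<open>The mass that the two-point distribution with mean \<open>m\<close> puts on
      \<open>c\<close>.\<close>
    define p where "p = (m + c) / (2 * c)"
    have "\<bar>m\<bar> \<le> (\<Sum>i\<in>I. w i * c)"
      unfolding m_def using w y
      by (intro order_trans[OF sum_abs sum_mono]) (auto simp: abs_mult intro!: mult_left_mono)
    then have "\<bar>m\<bar> \<le> c" using w by (simp add: sum_distrib_right[symmetric])
    then have p: "p \<ge> 0" unfolding p_def using c by (intro divide_nonneg_nonneg) auto
    have conv: "exp (b * t) \<le> (c - t) / (2 * c) * exp (- b * c) + (t + c) / (2 * c) * exp (b * c)"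
      if t: "\<bar>t\<bar> \<le> c" for t
    proof -
      define u where "u = (t + c) / (2 * c)"
      have u: "0 \<le> u" "u \<le> 1" using t c by (auto simp: u_def field_simps)
      have "exp (b * ((1 - u) *\<^sub>R (- c) + u *\<^sub>R c)) \<le> (1 - u) * exp (b * (- c)) + u * exp (b * c)"
        using u b by (intro convex_onD[OF convex_on_exp]) auto
      also have "(1 - u) *\<^sub>R (- c) + u *\<^sub>R c = t" using c by (simp add: u_def field_simps)
      also have "1 - u = (c - t) / (2 * c)" using c by (simp add: u_def field_simps)
      finally show ?thesis by (simp add: u_def)
    qed
    have "(\<Sum>i\<in>I. w i * exp (b * y i))
        \<le> (\<Sum>i\<in>I. w i * ((c - y i) / (2 * c) * exp (- b * c) + (y i + c) / (2 * c) * exp (b * c)))"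
      using w y by (intro sum_mono mult_left_mono conv) auto
    also have "\<dots> = (\<Sum>i\<in>I. w i * (exp (- b * c) / 2 + exp (b * c) / 2)
          + w i * y i * (exp (b * c) / (2 * c) - exp (- b * c) / (2 * c)))"
      using c by (intro sum.cong refl) (simp add: field_simps)
    also have "\<dots> = (exp (- b * c) / 2 + exp (b * c) / 2) + m * (exp (b * c) / (2 * c) - exp (- b * c) / (2 * c))"
      unfolding sum.distrib sum_distrib_right[symmetric] m_def w(2) by simp
    also have "\<dots> = exp (- b * c) * (1 + p * (exp (2 * b * c) - 1))"
    proof -
      have "exp (2 * b * c) = exp (b * c) * exp (b * c)" by (simp add: exp_add[symmetric])
      then show ?thesis using c by (simp add: p_def exp_minus field_simps)
    qed
    also have "\<dots> = exp (- b * c + ln (1 + p * (exp (2 * b * c) - 1)))"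
    proof -
      have "1 + p * (exp (2 * b * c) - 1) > 0"
        using p b c by (intro add_pos_nonneg mult_nonneg_nonneg) auto
      then show ?thesis unfolding exp_add by (simp add: mult.commute)
    qed
    also have "\<dots> \<le> exp (b * m + b\<^sup>2 * c\<^sup>2 / 2)"
    proof -
      \<comment> \<open>The standard estimate with h = 2 b c, so that h^2 / 8 equals b^2 c^2 /
        2.\<close>
      have "- (2 * b * c) * p + ln (1 + p * (exp (2 * b * c) - 1)) \<le> (2 * b * c)\<^sup>2 / 8"
        using b c p by (intro Hoeffdings_lemma_aux) auto
      moreover have "(2 * b * c) * p = b * m + b * c" using c by (simp add: p_def field_simps)
      ultimately show ?thesis by (simp add: power_mult_distrib)
    qed
    finally show ?thesis by (simp add: m_def)
  qed
qed

section \<open>The soft maximum\<close>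

definition exp_sum_pm :: "real \<Rightarrow> nat \<Rightarrow> (nat \<Rightarrow> real) \<Rightarrow> real" where
  "exp_sum_pm b d x = (\<Sum>(j, s)\<in>{..<d} \<times> {-1, 1}. exp (b * (s * x j)))"

text \<open>Log-sum-exp over the signed coordinates at inverse temperature \<open>b\<close>; both
  signs are included so that it dominates absolute values.\<close>

definition soft_max :: "real \<Rightarrow> nat \<Rightarrow> (nat \<Rightarrow> real) \<Rightarrow> real" where
  "soft_max b d x = ln (exp_sum_pm b d x) / b"

text \<open>The gradient of \<open>soft_max\<close>: its entry at \<open>j\<close> is the Gibbs
  weight of the index with sign 1 minus that of the index with sign -1.\<close>

definition soft_max_grad :: "real \<Rightarrow> nat \<Rightarrow> (nat \<Rightarrow> real) \<Rightarrow> nat \<Rightarrow> real" where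
  "soft_max_grad b d x j = (exp (b * x j) - exp (- b * x j)) / exp_sum_pm b d x"

lemma exp_sum_pm_eq: "exp_sum_pm b d x = (\<Sum>j<d. exp (b * x j) + exp (- b * x j))"
  unfolding exp_sum_pm_def by (simp add: sum.cartesian_product[symmetric] add.commute)

lemma exp_sum_pm_ge: "j < d \<Longrightarrow> exp (b * x j) + exp (- b * x j) \<le> exp_sum_pm b d x"
  unfolding exp_sum_pm_eq by (rule member_le_sum) (auto intro: add_nonneg_nonneg)

lemma exp_sum_pm_pos: "d > 0 \<Longrightarrow> exp_sum_pm b d x > 0"
  using exp_sum_pm_ge[of 0 d b x] by (meson add_pos_pos exp_gt_zero less_le_trans)

lemma soft_max_zero: "soft_max b d (\<lambda>_. 0) = ln (2 * real d) / b"
  by (simp add: soft_max_def exp_sum_pm_eq mult.commute)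

lemma linf_le_soft_max:
  assumes "b > 0" "d > 0"
  shows "linf d x \<le> soft_max b d x"
proof -
  have *: "\<bar>x j\<bar> \<le> soft_max b d x" if "j < d" for j
  proof -
    have "exp (b * \<bar>x j\<bar>) \<le> exp (b * x j) + exp (- b * x j)" by (cases "x j \<ge> 0") auto
    also have "\<dots> \<le> exp_sum_pm b d x" by (rule exp_sum_pm_ge[OF that])
    finally have "b * \<bar>x j\<bar> \<le> ln (exp_sum_pm b d x)"
      using exp_sum_pm_pos[OF assms(2)] by (simp add: ln_ge_iff)
    then show ?thesis unfolding soft_max_def using assms(1) by (simp add: field_simps)
  qed
  have "0 \<le> soft_max b d x" using *[OF assms(2)] by linarith
  then show ?thesis using * by (simp add: linf_le_iff)
qed

text \<open>This makes the gradient an admissible weight in the orthogonality premise of the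
  martingale inequality.\<close>

lemma abs_soft_max_grad_le: "j < d \<Longrightarrow> \<bar>soft_max_grad b d x j\<bar> \<le> 1"
proof -
  assume j: "j < d"
  then have "exp_sum_pm b d x > 0" by (intro exp_sum_pm_pos) auto
  moreover have "\<bar>exp (b * x j) - exp (- b * x j)\<bar> \<le> exp_sum_pm b d x"
  proof -
    have "\<bar>p - q\<bar> \<le> p + q" if "p > 0" "q > 0" for p q :: real using that by auto
    then show ?thesis using exp_sum_pm_ge[OF j, of b x] by (meson exp_gt_zero order_trans)
  qed
  ultimately show ?thesis unfolding soft_max_grad_def by (simp add: abs_divide)
qed

text \<open>The quotient of the partition functions at \<open>x + z\<close> and at \<open>x\<close>
  is the Gibbs average of \<open>exp (b * (s * z j))\<close>. Hoeffding's bound applies to it: the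
  Gibbs mean of \<open>s * z j\<close> is the gradient term, and the range is controlled by
  \<open>linf d z\<close>.\<close>

lemma soft_max_increment:
  assumes b: "b > 0" and d: "d > 0"
  shows "soft_max b d (\<lambda>j. x j + z j)
    \<le> soft_max b d x + (\<Sum>j<d. soft_max_grad b d x j * z j) + b / 2 * (linf d z)\<^sup>2"
proof -
  let ?I = "{..<d} \<times> {-1, 1::real}"
  let ?Z = "exp_sum_pm b d x"
  have Z: "?Z > 0" by (rule exp_sum_pm_pos[OF d])
  define w where "w = (\<lambda>(j, s). exp (b * (s * x j)) / ?Z)"
  define y where "y = (\<lambda>(j, s). s * z j)"
  have "(\<Sum>i\<in>?I. w i * exp (b * y i)) \<le> exp (b * (\<Sum>i\<in>?I. w i * y i) + b\<^sup>2 * (linf d z)\<^sup>2 / 2)"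
  proof (rule finite_Hoeffding_lemma)
    show "sum w ?I = 1"
      using Z by (simp add: w_def exp_sum_pm_def case_prod_beta sum_divide_distrib[symmetric])
  qed (use b Z in \<open>auto simp: w_def y_def abs_le_linf\<close>)
  moreover have "exp_sum_pm b d (\<lambda>j. x j + z j) = ?Z * (\<Sum>i\<in>?I. w i * exp (b * y i))"
    unfolding sum_distrib_left exp_sum_pm_def[of b d "\<lambda>j. x j + z j"] using Z
    by (intro sum.cong refl) (auto simp: w_def y_def distrib_left exp_add)
  moreover have "(\<Sum>i\<in>?I. w i * y i) = (\<Sum>j<d. soft_max_grad b d x j * z j)"
  proof -
    have "(\<Sum>i\<in>?I. w i * y i) = (\<Sum>j<d. \<Sum>s\<in>{-1, 1}. w (j, s) * y (j, s))"
      unfolding sum.cartesian_product by (intro sum.cong) auto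
    then show ?thesis
      by (simp add: w_def y_def soft_max_grad_def diff_divide_distrib left_diff_distrib)
  qed
  ultimately have "exp_sum_pm b d (\<lambda>j. x j + z j)
      \<le> ?Z * exp (b * (\<Sum>j<d. soft_max_grad b d x j * z j) + b\<^sup>2 * (linf d z)\<^sup>2 / 2)"
    using Z by (simp add: mult_left_mono)
  then have "ln (exp_sum_pm b d (\<lambda>j. x j + z j))
      \<le> ln (?Z * exp (b * (\<Sum>j<d. soft_max_grad b d x j * z j) + b\<^sup>2 * (linf d z)\<^sup>2 / 2))"
    using Z exp_sum_pm_pos[OF d] by (simp add: ln_mono)
  also have "\<dots> = ln ?Z + (b * (\<Sum>j<d. soft_max_grad b d x j * z j) + b\<^sup>2 * (linf d z)\<^sup>2 / 2)"
    using Z by (simp add: ln_mult)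
  finally show ?thesis
    unfolding soft_max_def using b by (simp add: field_simps power2_eq_square)
qed

text \<open>Together with \<open>linf_le_soft_max\<close> this confines the soft maximum to a band
  above the maximum norm, whence its integrability.\<close>

lemma soft_max_le:
  assumes "b > 0" "d > 0"
  shows "soft_max b d x \<le> ln (2 * real d) / b + linf d x"
proof -
  have "exp_sum_pm b d x \<le> (\<Sum>j<d. exp (b * linf d x) + exp (b * linf d x))"
  proof -
    have "b * x j \<le> b * linf d x \<and> - b * x j \<le> b * linf d x" if "j < d" for j
    proof -
      have "b * \<bar>x j\<bar> \<le> b * linf d x"
        using abs_le_linf[OF that, of x] assms(1) by simp
      moreover have "\<bar>b * x j\<bar> = b * \<bar>x j\<bar>" using assms(1) by (simp add: abs_mult)
      ultimately show ?thesis by linarith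
    qed
    then show ?thesis unfolding exp_sum_pm_eq by (intro sum_mono add_mono) auto
  qed
  also have "\<dots> = 2 * real d * exp (b * linf d x)" by simp
  finally have "ln (exp_sum_pm b d x) \<le> ln (2 * real d * exp (b * linf d x))"
    using exp_sum_pm_pos[OF assms(2)] assms(2) by (simp add: ln_mono)
  also have "\<dots> = ln (2 * real d) + b * linf d x" using assms by (simp add: ln_mult)
  finally show ?thesis unfolding soft_max_def using assms by (simp add: field_simps)
qed

text \<open>A Nemirovski-type inequality: the smooth function \<open>soft_max\<close> dominates the maximum norm,
  and its first-order increments vanish in expectation.\<close>

lemma (in prob_space) expectation_linf_martingale_sum:
  fixes \<xi> :: "nat \<Rightarrow> 'a \<Rightarrow> nat \<Rightarrow> real"
  assumes b: "b > 0" and d: "d > 0"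
    and F: "\<And>k. subalgebra M (F k)" "\<And>k. sets (F k) \<subseteq> sets (F (Suc k))"
    and adapted: "\<And>k j. k < n \<Longrightarrow> j < d \<Longrightarrow> (\<lambda>\<omega>. \<xi> k \<omega> j) \<in> borel_measurable (F (Suc k))"
    and sq: "\<And>k. k < n \<Longrightarrow> integrable M (\<lambda>\<omega>. (linf d (\<xi> k \<omega>))\<^sup>2)"
    and orth: "\<And>k j w. k < n \<Longrightarrow> j < d \<Longrightarrow> w \<in> borel_measurable (F k) \<Longrightarrow> (\<And>\<omega>. \<bar>w \<omega>\<bar> \<le> 1) \<Longrightarrow>
        expectation (\<lambda>\<omega>. w \<omega> * \<xi> k \<omega> j) = 0"
  shows "integrable M (\<lambda>\<omega>. linf d (\<lambda>j. \<Sum>k<n. \<xi> k \<omega> j))"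
    and "expectation (\<lambda>\<omega>. linf d (\<lambda>j. \<Sum>k<n. \<xi> k \<omega> j))
      \<le> ln (2 * real d) / b + b / 2 * (\<Sum>k<n. expectation (\<lambda>\<omega>. (linf d (\<xi> k \<omega>))\<^sup>2))"
proof -
  define X where "X m \<omega> j = (\<Sum>k<m. \<xi> k \<omega> j)" for m \<omega> j
  have F_mono: "sets (F k) \<subseteq> sets (F m)" if "k \<le> m" for k m
    using F(2) that by (rule lift_Suc_mono_le)
  have F_space: "space (F k) = space M" for k using F(1) by (simp add: subalgebra_def)
  have mono_meas: "f \<in> borel_measurable (F m)" if "f \<in> borel_measurable (F k)" "k \<le> m" for f :: "'a \<Rightarrow> real" and k m
    using that F_mono[OF that(2)] F_space by (auto simp: measurable_def)
  have M_meas: "f \<in> borel_measurable M" if "f \<in> borel_measurable (F k)" for f :: "'a \<Rightarrow> real" and k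
    using that F(1) measurable_from_subalg by blast
  have \<xi>M: "(\<lambda>\<omega>. \<xi> k \<omega> j) \<in> borel_measurable M" if "k < n" "j < d" for k j
    using adapted[OF that] M_meas by blast
  have X_meas: "(\<lambda>\<omega>. X m \<omega> j) \<in> borel_measurable (F m)" if "m \<le> n" "j < d" for m j
    unfolding X_def using that by (intro borel_measurable_sum mono_meas[OF adapted]) auto
  have \<xi>_int: "integrable M (\<lambda>\<omega>. linf d (\<xi> k \<omega>))" if k: "k < n" for k
    using \<xi>M k by (intro square_integrable_imp_integrable[OF _ sq[OF k]] borel_measurable_linf) auto
  have \<xi>j_int: "integrable M (\<lambda>\<omega>. \<xi> k \<omega> j)" if "k < n" "j < d" for k j
    using \<xi>M[OF that] abs_le_linf[OF that(2)] linf_nonneg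
    by (intro Bochner_Integration.integrable_bound[OF \<xi>_int[OF that(1)]]) auto
  have X_int: "integrable M (\<lambda>\<omega>. linf d (X m \<omega>))" if m: "m \<le> n" for m
  proof (rule Bochner_Integration.integrable_bound)
    show "integrable M (\<lambda>\<omega>. \<Sum>k<m. linf d (\<xi> k \<omega>))"
      using m \<xi>_int by auto
    show "(\<lambda>\<omega>. linf d (X m \<omega>)) \<in> borel_measurable M"
      using X_meas[OF m] M_meas by (intro borel_measurable_linf) blast
    have "linf d (X m \<omega>) \<le> (\<Sum>k<m. linf d (\<xi> k \<omega>))" for \<omega>
      unfolding X_def
      by (subst linf_le_iff) (auto intro!: sum_nonneg linf_nonneg order_trans[OF sum_abs sum_mono] abs_le_linf)
    then show "AE \<omega> in M. norm (linf d (X m \<omega>)) \<le> norm (\<Sum>k<m. linf d (\<xi> k \<omega>))"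
      by (intro AE_I2) (use linf_nonneg sum_nonneg[of "{..<m}" "\<lambda>k. linf d (\<xi> k _)"] in \<open>auto intro: order_trans\<close>)
  qed
  have E_meas: "(\<lambda>\<omega>. exp_sum_pm b d (X m \<omega>)) \<in> borel_measurable (F m)" if m: "m \<le> n" for m
    unfolding exp_sum_pm_eq using X_meas[OF m] by (intro borel_measurable_sum) auto
  have S_meas: "(\<lambda>\<omega>. soft_max b d (X m \<omega>)) \<in> borel_measurable M" if m: "m \<le> n" for m
    unfolding soft_max_def using M_meas[OF E_meas[OF m]] by simp
  have S_int: "integrable M (\<lambda>\<omega>. soft_max b d (X m \<omega>))" if m: "m \<le> n" for m
  proof (rule Bochner_Integration.integrable_bound)
    show "integrable M (\<lambda>\<omega>. ln (2 * real d) / b + linf d (X m \<omega>))"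
      using X_int[OF m] by simp
    show "AE \<omega> in M. norm (soft_max b d (X m \<omega>)) \<le> norm (ln (2 * real d) / b + linf d (X m \<omega>))"
    proof (rule AE_I2)
      fix \<omega>
      have "0 \<le> soft_max b d (X m \<omega>)"
        using linf_le_soft_max[OF b d, of "X m \<omega>"] linf_nonneg[of d "X m \<omega>"] by linarith
      then show "norm (soft_max b d (X m \<omega>)) \<le> norm (ln (2 * real d) / b + linf d (X m \<omega>))"
        using soft_max_le[OF b d, of "X m \<omega>"] by simp
    qed
  qed (rule S_meas[OF m])
  have "expectation (\<lambda>\<omega>. soft_max b d (X m \<omega>))
      \<le> ln (2 * real d) / b + b / 2 * (\<Sum>k<m. expectation (\<lambda>\<omega>. (linf d (\<xi> k \<omega>))\<^sup>2))" if "m \<le> n" for m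
    using that
  proof (induction m)
    \<comment> \<open>The dimension enters here alone: the soft maximum of the empty sum is
      \<open>ln (2 * real d) / b\<close>.\<close>
    case 0
    then show ?case by (simp add: X_def soft_max_zero prob_space)
  next
    case (Suc m)
    then have m: "m < n" by simp
    \<comment> \<open>The gradient is taken at the sum of the first \<open>m\<close> terms. It is
      therefore \<open>F m\<close>-measurable and acts as a predictable weight on the next term, so
      \<open>orth\<close> removes the first-order part.\<close>
    let ?g = "\<lambda>\<omega> j. soft_max_grad b d (X m \<omega>) j"
    have g_meas: "(\<lambda>\<omega>. ?g \<omega> j) \<in> borel_measurable (F m)" if "j < d" for j
    proof -
      have [measurable]: "(\<lambda>\<omega>. exp_sum_pm b d (X m \<omega>)) \<in> borel_measurable (F m)"
          "(\<lambda>\<omega>. X m \<omega> j) \<in> borel_measurable (F m)"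
        using E_meas[of m] X_meas[of m j] m that by auto
      show ?thesis unfolding soft_max_grad_def by measurable
    qed
    have g_int: "integrable M (\<lambda>\<omega>. ?g \<omega> j * \<xi> m \<omega> j)" if j: "j < d" for j
    proof (rule Bochner_Integration.integrable_bound[OF \<xi>j_int[OF m j]])
      show "(\<lambda>\<omega>. ?g \<omega> j * \<xi> m \<omega> j) \<in> borel_measurable M"
        using M_meas[OF g_meas[OF j]] \<xi>M[OF m j] by simp
      show "AE \<omega> in M. norm (?g \<omega> j * \<xi> m \<omega> j) \<le> norm (\<xi> m \<omega> j)"
        using abs_soft_max_grad_le[OF j] by (intro AE_I2) (auto simp: abs_mult intro!: mult_left_le_one_le)
    qed
    have XS: "X (Suc m) \<omega> = (\<lambda>j. X m \<omega> j + \<xi> m \<omega> j)" for \<omega> by (auto simp: X_def)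
    have "expectation (\<lambda>\<omega>. soft_max b d (X (Suc m) \<omega>))
      \<le> expectation (\<lambda>\<omega>. soft_max b d (X m \<omega>) + (\<Sum>j<d. ?g \<omega> j * \<xi> m \<omega> j) + b / 2 * (linf d (\<xi> m \<omega>))\<^sup>2)"
    proof (rule integral_mono)
      show "integrable M (\<lambda>\<omega>. soft_max b d (X (Suc m) \<omega>))" using S_int Suc by blast
      show "integrable M (\<lambda>\<omega>. soft_max b d (X m \<omega>) + (\<Sum>j<d. ?g \<omega> j * \<xi> m \<omega> j) + b / 2 * (linf d (\<xi> m \<omega>))\<^sup>2)"
        using S_int[of m] g_int sq[OF m] m
        by (intro Bochner_Integration.integrable_add Bochner_Integration.integrable_sum integrable_mult_right) auto
    qed (unfold XS, rule soft_max_increment[OF b d])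
    also have "\<dots> = expectation (\<lambda>\<omega>. soft_max b d (X m \<omega>)) + (\<Sum>j<d. expectation (\<lambda>\<omega>. ?g \<omega> j * \<xi> m \<omega> j))
        + b / 2 * expectation (\<lambda>\<omega>. (linf d (\<xi> m \<omega>))\<^sup>2)"
    proof -
      have 1: "integrable M (\<lambda>\<omega>. soft_max b d (X m \<omega>))" using S_int[of m] m by simp
      have 2: "integrable M (\<lambda>\<omega>. \<Sum>j<d. ?g \<omega> j * \<xi> m \<omega> j)"
        using g_int by (intro Bochner_Integration.integrable_sum) auto
      have 3: "integrable M (\<lambda>\<omega>. b / 2 * (linf d (\<xi> m \<omega>))\<^sup>2)" using sq[OF m] by simp
      have 4: "expectation (\<lambda>\<omega>. \<Sum>j<d. ?g \<omega> j * \<xi> m \<omega> j) = (\<Sum>j<d. expectation (\<lambda>\<omega>. ?g \<omega> j * \<xi> m \<omega> j))"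
        using g_int by (intro Bochner_Integration.integral_sum) auto
      show ?thesis
        unfolding Bochner_Integration.integral_add[OF Bochner_Integration.integrable_add[OF 1 2] 3]
          Bochner_Integration.integral_add[OF 1 2] 4 by simp
    qed
    also have "(\<Sum>j<d. expectation (\<lambda>\<omega>. ?g \<omega> j * \<xi> m \<omega> j)) = 0"
    proof (rule sum.neutral, rule ballI)
      fix j assume "j \<in> {..<d}"
      then have j: "j < d" by simp
      show "expectation (\<lambda>\<omega>. ?g \<omega> j * \<xi> m \<omega> j) = 0"
        by (rule orth[OF m j g_meas[OF j] abs_soft_max_grad_le[OF j]])
    qed
    finally show ?case using Suc.IH m by (simp add: distrib_left)
  qed
  from this[of n] have upper: "expectation (\<lambda>\<omega>. soft_max b d (X n \<omega>))
      \<le> ln (2 * real d) / b + b / 2 * (\<Sum>k<n. expectation (\<lambda>\<omega>. (linf d (\<xi> k \<omega>))\<^sup>2))" by simp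
  show "integrable M (\<lambda>\<omega>. linf d (\<lambda>j. \<Sum>k<n. \<xi> k \<omega> j))"
    using X_int[of n] by (simp add: X_def[abs_def])
  have "expectation (\<lambda>\<omega>. linf d (X n \<omega>)) \<le> expectation (\<lambda>\<omega>. soft_max b d (X n \<omega>))"
    using X_int[of n] S_int[of n] linf_le_soft_max[OF b d] by (intro integral_mono) auto
  with upper show "expectation (\<lambda>\<omega>. linf d (\<lambda>j. \<Sum>k<n. \<xi> k \<omega> j))
      \<le> ln (2 * real d) / b + b / 2 * (\<Sum>k<n. expectation (\<lambda>\<omega>. (linf d (\<xi> k \<omega>))\<^sup>2))"
    by (simp add: X_def[abs_def])
qed

section \<open>Elementary stochastic integrals\<close>

lemma (in finite_measure) integrable_bounded_square:
  fixes f :: "'a \<Rightarrow> real"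
  assumes "f \<in> borel_measurable M" "\<And>\<omega>. \<omega> \<in> space M \<Longrightarrow> \<bar>f \<omega>\<bar> \<le> B"
  shows "integrable M (\<lambda>\<omega>. (f \<omega>)\<^sup>2)"
proof (rule integrable_const_bound[where B = "B\<^sup>2"])
  show "AE \<omega> in M. norm ((f \<omega>)\<^sup>2) \<le> B\<^sup>2"
  proof (rule AE_I2)
    fix \<omega> assume "\<omega> \<in> space M"
    then have "\<bar>f \<omega>\<bar> \<le> B" by (rule assms(2))
    then have "\<bar>f \<omega>\<bar>\<^sup>2 \<le> B\<^sup>2" by (rule power_mono) simp
    then show "norm ((f \<omega>)\<^sup>2) \<le> B\<^sup>2" by simp
  qed
qed (use assms(1) in simp)

locale brownian_space =
  fixes P :: "'a measure" and F :: "real \<Rightarrow> 'a measure" and W :: "real \<Rightarrow> 'a \<Rightarrow> real"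
  assumes filtered: "filtered_prob_space P F" and brownian: "brownian_motion P F W"

sublocale brownian_space \<subseteq> prob_space P
  using filtered unfolding filtered_prob_space_def by blast

context brownian_space
begin

lemma subalg: "0 \<le> t \<Longrightarrow> subalgebra P (F t)"
  using filtered unfolding filtered_prob_space_def by blast

lemma space_F: "0 \<le> t \<Longrightarrow> space (F t) = space P"
  using subalg by (simp add: subalgebra_def)

lemma measurable_F_mono:
  assumes "f \<in> measurable (F s) N" "0 \<le> s" "s \<le> t"
  shows "f \<in> measurable (F t) N"
proof -
  have "sets (F s) \<subseteq> sets (F t)" using filtered assms(2,3) by (simp add: filtered_prob_space_def)
  moreover have "space (F s) = space (F t)" using assms(2,3) by (simp add: space_F)
  ultimately have "subalgebra (F t) (F s)" by (simp add: subalgebra_def)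
  then show ?thesis using assms(1) by (rule measurable_from_subalg)
qed

lemma measurable_F_P: "f \<in> measurable (F s) N \<Longrightarrow> 0 \<le> s \<Longrightarrow> f \<in> measurable P N"
  by (rule measurable_from_subalg[OF subalg])

section \<open>Brownian increments and their weighted sums\<close>

lemma W_measurable: "0 \<le> t \<Longrightarrow> W t \<in> borel_measurable (F t)"
  using brownian unfolding brownian_motion_def by blast

lemma W_increment_distributed:
  "0 \<le> s \<Longrightarrow> s < t \<Longrightarrow> distributed P lborel (\<lambda>\<omega>. W t \<omega> - W s \<omega>) (normal_density 0 (sqrt (t - s)))"
  using brownian unfolding brownian_motion_def by blast

text \<open>Independence is given between \<open>F s\<close> and the family of preimages under the
  increment. That family is already a sigma-algebra, and the one generated by \<open>Y\<close> lies
  in \<open>F s\<close>.\<close>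

lemma W_increment_indep:
  fixes Y :: "'a \<Rightarrow> real"
  assumes st: "0 \<le> s" "s < t" and Y: "Y \<in> borel_measurable (F s)"
  shows "indep_var borel Y borel (\<lambda>\<omega>. W t \<omega> - W s \<omega>)"
proof -
  let ?D = "\<lambda>\<omega>. W t \<omega> - W s \<omega>"
  let ?G = "{?D -` A \<inter> space P | A. A \<in> sets borel}"
  have meas: "random_variable borel Y" "random_variable borel ?D"
    using st measurable_F_P[OF Y] measurable_F_P[OF W_measurable[of s]] measurable_F_P[OF W_measurable[of t]]
    by auto
  have ind: "indep_set (sets (F s)) ?G"
    using brownian st unfolding brownian_motion_def by blast
  have sY: "sigma_sets (space P) {Y -` A \<inter> space P | A. A \<in> sets borel} \<subseteq> sets (F s)"
    using sets.sigma_sets_subset[of "{Y -` A \<inter> space P | A. A \<in> sets borel}" "F s"]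
      measurable_sets[OF Y] space_F[OF st(1)] by auto
  have sD: "sigma_sets (space P) ?G = ?G"
  proof -
    have *: "sets (vimage_algebra (space P) ?D borel) = ?G"
      by (rule sets_vimage_algebra2) simp
    show ?thesis
      using sets.sigma_sets_eq[of "vimage_algebra (space P) ?D borel"]
      unfolding * space_vimage_algebra .
  qed
  have "indep_set (sigma_sets (space P) {Y -` A \<inter> space P | A. A \<in> sets borel}) ?G"
    unfolding indep_set_def
  proof (rule indep_sets_mono_sets[OF ind[unfolded indep_set_def]])
    fix b :: bool
    show "case_bool (sigma_sets (space P) {Y -` A \<inter> space P | A. A \<in> sets borel}) ?G b
        \<subseteq> case_bool (sets (F s)) ?G b"
      using sY by (cases b) simp_all
  qed
  then show ?thesis unfolding indep_var_eq sD using meas by blast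
qed

lemma W_increment_moments:
  assumes st: "0 \<le> s" "s < t"
  shows "integrable P (\<lambda>\<omega>. W t \<omega> - W s \<omega>)" "expectation (\<lambda>\<omega>. W t \<omega> - W s \<omega>) = 0"
    "integrable P (\<lambda>\<omega>. (W t \<omega> - W s \<omega>)\<^sup>2)" "expectation (\<lambda>\<omega>. (W t \<omega> - W s \<omega>)\<^sup>2) = t - s"
proof -
  note D = W_increment_distributed[OF st]
  have pos: "0 < sqrt (t - s)" using st by simp
  show "integrable P (\<lambda>\<omega>. W t \<omega> - W s \<omega>)"
    using distributed_integrable[OF D, of "\<lambda>x. x"] integrable_normal_moment_nz_1[OF pos, of 0] by simp
  show E: "expectation (\<lambda>\<omega>. W t \<omega> - W s \<omega>) = 0"
    by (rule normal_distributed_expectation[OF pos D])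
  show "integrable P (\<lambda>\<omega>. (W t \<omega> - W s \<omega>)\<^sup>2)"
    using distributed_integrable[OF D, of "\<lambda>x. x\<^sup>2"] integrable_normal_moment[OF pos, of 0 2] by simp
  show "expectation (\<lambda>\<omega>. (W t \<omega> - W s \<omega>)\<^sup>2) = t - s"
    using normal_distributed_variance[OF pos D] st unfolding E by simp
qed

text \<open>Independence factorises the expectations. The case of equal times is included because
  partition points clamped to an interval may coincide.\<close>

lemma weighted_W_increment:
  fixes Y :: "'a \<Rightarrow> real"
  assumes st: "0 \<le> s" "s \<le> t" and Y: "Y \<in> borel_measurable (F s)" "integrable P Y"
  shows "integrable P (\<lambda>\<omega>. Y \<omega> * (W t \<omega> - W s \<omega>))" "expectation (\<lambda>\<omega>. Y \<omega> * (W t \<omega> - W s \<omega>)) = 0"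
    "integrable P (\<lambda>\<omega>. Y \<omega> * (W t \<omega> - W s \<omega>)\<^sup>2)"
    "expectation (\<lambda>\<omega>. Y \<omega> * (W t \<omega> - W s \<omega>)\<^sup>2) = expectation Y * (t - s)"
proof -
  have "integrable P (\<lambda>\<omega>. Y \<omega> * (W t \<omega> - W s \<omega>)) \<and> expectation (\<lambda>\<omega>. Y \<omega> * (W t \<omega> - W s \<omega>)) = 0 \<and>
    integrable P (\<lambda>\<omega>. Y \<omega> * (W t \<omega> - W s \<omega>)\<^sup>2) \<and>
    expectation (\<lambda>\<omega>. Y \<omega> * (W t \<omega> - W s \<omega>)\<^sup>2) = expectation Y * (t - s)"
  proof (cases "s = t")
    case False
    then have st': "s < t" using st by simp
    note m = W_increment_moments[OF st(1) st']
    note I = W_increment_indep[OF st(1) st' Y(1)]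
    have I2: "indep_var borel Y borel (\<lambda>\<omega>. (W t \<omega> - W s \<omega>)\<^sup>2)"
      using indep_var_compose[OF I, of "\<lambda>x. x" borel "\<lambda>x. x\<^sup>2" borel] by (simp add: o_def)
    show ?thesis
      using indep_var_integrable[OF I Y(2) m(1)] indep_var_lebesgue_integral[OF I Y(2) m(1)]
        indep_var_integrable[OF I2 Y(2) m(3)] indep_var_lebesgue_integral[OF I2 Y(2) m(3)] m by simp
  qed simp
  then show "integrable P (\<lambda>\<omega>. Y \<omega> * (W t \<omega> - W s \<omega>))" "expectation (\<lambda>\<omega>. Y \<omega> * (W t \<omega> - W s \<omega>)) = 0"
    "integrable P (\<lambda>\<omega>. Y \<omega> * (W t \<omega> - W s \<omega>)\<^sup>2)"
    "expectation (\<lambda>\<omega>. Y \<omega> * (W t \<omega> - W s \<omega>)\<^sup>2) = expectation Y * (t - s)" by auto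
qed

text \<open>The Ito isometry for a finite sum, by induction. In the square of the enlarged sum the
  cross term carries a weight known at the left end point of the new increment, so its expectation
  vanishes; bounded coefficients make this weight integrable.\<close>

lemma weighted_W_sum:
  fixes c :: "nat \<Rightarrow> 'a \<Rightarrow> real"
  assumes a: "0 \<le> a 0" "\<And>i. i < m \<Longrightarrow> a i \<le> a (Suc i)"
    and c: "\<And>i. i < m \<Longrightarrow> c i \<in> borel_measurable (F (a i))"
    and bounded: "\<And>i. i < m \<Longrightarrow> \<exists>B. \<forall>\<omega>\<in>space P. \<bar>c i \<omega>\<bar> \<le> B"
  defines "S \<equiv> \<lambda>\<omega>. \<Sum>i<m. c i \<omega> * (W (a (Suc i)) \<omega> - W (a i) \<omega>)"
  shows "integrable P (\<lambda>\<omega>. (S \<omega>)\<^sup>2)" "expectation S = 0"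
    "expectation (\<lambda>\<omega>. (S \<omega>)\<^sup>2) = (\<Sum>i<m. expectation (\<lambda>\<omega>. (c i \<omega>)\<^sup>2) * (a (Suc i) - a i))"
proof -
  have "0 \<le> a m \<and> S \<in> borel_measurable (F (a m)) \<and> integrable P S \<and> integrable P (\<lambda>\<omega>. (S \<omega>)\<^sup>2) \<and> expectation S = 0 \<and>
    expectation (\<lambda>\<omega>. (S \<omega>)\<^sup>2) = (\<Sum>i<m. expectation (\<lambda>\<omega>. (c i \<omega>)\<^sup>2) * (a (Suc i) - a i))"
    unfolding S_def using a(2) c bounded
  proof (induction m)
    case 0
    then show ?case using a(1) by simp
  next
    case (Suc m)
    let ?S = "\<lambda>\<omega>. \<Sum>i<m. c i \<omega> * (W (a (Suc i)) \<omega> - W (a i) \<omega>)"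
    let ?D = "\<lambda>\<omega>. W (a (Suc m)) \<omega> - W (a m) \<omega>"
    have IH: "0 \<le> a m" "?S \<in> borel_measurable (F (a m))" "integrable P ?S" "integrable P (\<lambda>\<omega>. (?S \<omega>)\<^sup>2)"
      "expectation ?S = 0"
      "expectation (\<lambda>\<omega>. (?S \<omega>)\<^sup>2) = (\<Sum>i<m. expectation (\<lambda>\<omega>. (c i \<omega>)\<^sup>2) * (a (Suc i) - a i))"
      using Suc.IH Suc.prems by simp_all
    have le: "a m \<le> a (Suc m)" and cm: "c m \<in> borel_measurable (F (a m))" using Suc.prems by auto
    obtain B where B: "\<And>\<omega>. \<omega> \<in> space P \<Longrightarrow> \<bar>c m \<omega>\<bar> \<le> B" using Suc.prems(3)[of m] by auto
    have cP: "c m \<in> borel_measurable P" using measurable_F_P[OF cm IH(1)] .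
    have B0: "0 \<le> B" using B not_empty by (meson abs_ge_zero ex_in_conv order_trans)
    have ci: "integrable P (c m)"
      using B by (intro integrable_const_bound[where B = B] AE_I2) (auto simp: cP)
    have ci2: "integrable P (\<lambda>\<omega>. (c m \<omega>)\<^sup>2)"
      using cP B by (rule integrable_bounded_square)
    have Sc: "integrable P (\<lambda>\<omega>. 2 * ?S \<omega> * c m \<omega>)"
    proof (rule Bochner_Integration.integrable_bound)
      show "integrable P (\<lambda>\<omega>. (2 * B) * ?S \<omega>)" using IH(3) by simp
      show "(\<lambda>\<omega>. 2 * ?S \<omega> * c m \<omega>) \<in> borel_measurable P" using cP measurable_F_P[OF IH(2,1)] by simp
      show "AE \<omega> in P. norm (2 * ?S \<omega> * c m \<omega>) \<le> norm (2 * B * ?S \<omega>)"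
      proof (rule AE_I2)
        fix \<omega> assume "\<omega> \<in> space P"
        then have "\<bar>?S \<omega>\<bar> * \<bar>c m \<omega>\<bar> \<le> \<bar>?S \<omega>\<bar> * B" using B by (intro mult_left_mono) auto
        then show "norm (2 * ?S \<omega> * c m \<omega>) \<le> norm (2 * B * ?S \<omega>)" using B0 by (simp add: abs_mult mult.commute)
      qed
    qed
    note w1 = weighted_W_increment[OF IH(1) le cm ci]
    note w2 = weighted_W_increment[OF IH(1) le _ ci2]
    note w3 = weighted_W_increment[OF IH(1) le _ Sc]
    have m2: "(\<lambda>\<omega>. (c m \<omega>)\<^sup>2) \<in> borel_measurable (F (a m))" using cm by simp
    have m3: "(\<lambda>\<omega>. 2 * ?S \<omega> * c m \<omega>) \<in> borel_measurable (F (a m))" using cm IH(2) by simp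
    have sq: "(?S \<omega> + c m \<omega> * ?D \<omega>)\<^sup>2 = (?S \<omega>)\<^sup>2 + 2 * ?S \<omega> * c m \<omega> * ?D \<omega> + (c m \<omega>)\<^sup>2 * (?D \<omega>)\<^sup>2" for \<omega>
      by (simp add: power2_eq_square algebra_simps)
    have meas: "(\<lambda>\<omega>. ?S \<omega> + c m \<omega> * ?D \<omega>) \<in> borel_measurable (F (a (Suc m)))"
      using measurable_F_mono[OF IH(2,1) le] measurable_F_mono[OF cm IH(1) le] IH(1) le
        measurable_F_mono[OF W_measurable[OF IH(1)] IH(1) le] W_measurable[of "a (Suc m)"] by simp
    have i12: "integrable P (\<lambda>\<omega>. (?S \<omega>)\<^sup>2 + 2 * ?S \<omega> * c m \<omega> * ?D \<omega>)"
      using IH(4) w3(1)[OF m3] by (rule Bochner_Integration.integrable_add)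
    show ?case
      unfolding sum.lessThan_Suc sq
      unfolding Bochner_Integration.integral_add[OF i12 w2(3)[OF m2]]
        Bochner_Integration.integral_add[OF IH(4) w3(1)[OF m3]] Bochner_Integration.integral_add[OF IH(3) w1(1)]
        w1(2) w2(4)[OF m2] w3(2)[OF m3] IH(5,6)
      using meas IH(1) le IH(3) w1(1) i12 w2(3)[OF m2] by auto
  qed
  then show "integrable P (\<lambda>\<omega>. (S \<omega>)\<^sup>2)" "expectation S = 0"
    "expectation (\<lambda>\<omega>. (S \<omega>)\<^sup>2) = (\<Sum>i<m. expectation (\<lambda>\<omega>. (c i \<omega>)\<^sup>2) * (a (Suc i) - a i))" by auto
qed

section \<open>Elementary integrals between two times\<close>

lemma elementary_increasing:
  assumes "elementary F m u \<xi>" "i \<le> j" "j \<le> m"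
  shows "u i \<le> u j"
  using assms(2,3)
proof (induction j rule: dec_induct)
  case (step k)
  moreover have "u k < u (Suc k)" using assms(1) step by (auto simp: elementary_def)
  ultimately show ?case by simp
qed simp

text \<open>Clamping the partition points to [s, t] turns a difference of two integrals into one sum
  of Brownian increments inside [s, t]; intervals outside collapse to a point.\<close>

lemma elementary_integral_increment:
  assumes st: "s \<le> t"
  shows "elementary_integral W m u \<xi> t \<omega> - elementary_integral W m u \<xi> s \<omega>
    = (\<Sum>i<m. \<xi> i \<omega> * (W (max s (min t (u (Suc i)))) \<omega> - W (max s (min t (u i))) \<omega>))"
proof -
  have inc: "W (min v t) \<omega> - W (min v s) \<omega> = W (max s (min t v)) \<omega> - W s \<omega>" for v
    using st by (cases "s = t"; cases "v \<le> s") (auto simp: min_def max_def)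
  have "W (min v t) \<omega> - W (min w t) \<omega> - (W (min v s) \<omega> - W (min w s) \<omega>)
      = W (max s (min t v)) \<omega> - W (max s (min t w)) \<omega>" for v w
    using inc[of v] inc[of w] by linarith
  then show ?thesis
    unfolding elementary_integral_def sum_subtractf[symmetric] right_diff_distrib[symmetric] by simp
qed

text \<open>The clamped intervals are disjoint, so at most one summand is nonzero and squaring
  produces no cross terms. Equality can fail only at \<open>r = s\<close>, which no clamped
  half-open interval contains.\<close>

lemma elementary_process_sq_ge:
  assumes el: "elementary F m u \<xi>"
  shows "(\<Sum>i<m. (\<xi> i \<omega>)\<^sup>2 * indicator {max s (min t (u i))<..max s (min t (u (Suc i)))} r)
    \<le> (elementary_process m u \<xi> r \<omega>)\<^sup>2 * indicator {s..t} r" (is "?L \<le> ?R")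
proof (cases "\<exists>i<m. r \<in> {max s (min t (u i))<..max s (min t (u (Suc i)))}")
  case True
  then obtain i where i: "i < m" "r \<in> {max s (min t (u i))<..max s (min t (u (Suc i)))}" by blast
  then have r: "r \<in> {u i<..u (Suc i)}" "r \<in> {s..t}" by (auto simp: max_def min_def split: if_splits)
  have other: "r \<notin> {u j<..u (Suc j)}" if "j < m" "j \<noteq> i" for j
  proof (cases "j < i")
    case True
    then show ?thesis using elementary_increasing[OF el, of "Suc j" i] i r by auto
  next
    case False
    then show ?thesis using elementary_increasing[OF el, of "Suc i" j] i r that by auto
  qed
  have other': "r \<notin> {max s (min t (u j))<..max s (min t (u (Suc j)))}" if "j < m" "j \<noteq> i" for j
    using other[OF that] by (auto simp: max_def min_def split: if_splits)
  have "?L = (\<Sum>j\<in>{i}. (\<xi> j \<omega>)\<^sup>2 * indicator {max s (min t (u j))<..max s (min t (u (Suc j)))} r)"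
    using i other' by (intro sum.mono_neutral_right) auto
  also have "\<dots> = (\<xi> i \<omega>)\<^sup>2" using i by simp
  finally have L: "?L = (\<xi> i \<omega>)\<^sup>2" .
  have "elementary_process m u \<xi> r \<omega> = (\<Sum>j\<in>{i}. \<xi> j \<omega> * indicator {u j<..u (Suc j)} r)"
    unfolding elementary_process_def using i other by (intro sum.mono_neutral_right) auto
  also have "\<dots> = \<xi> i \<omega>" using r by simp
  finally show ?thesis unfolding L using r by simp
next
  case False
  then have "?L = 0" by (intro sum.neutral) auto
  then show ?thesis by simp
qed

lemma elementary_process_measurable:
  assumes el: "elementary F m u \<xi>"
  shows "(\<lambda>(\<omega>, r). elementary_process m u \<xi> r \<omega>) \<in> borel_measurable (P \<Otimes>\<^sub>M lborel)"
proof -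
  have "\<xi> i \<in> borel_measurable P" if "i < m" for i
    using el that elementary_increasing[OF el, of 0 i] measurable_F_P[of "\<xi> i" "u i"] by (auto simp: elementary_def)
  then have "(\<lambda>x. \<xi> i (fst x) * indicator {u i<..u (Suc i)} (snd x)) \<in> borel_measurable (P \<Otimes>\<^sub>M lborel)" if "i < m" for i
    using that by measurable
  then show ?thesis unfolding elementary_process_def case_prod_beta by (intro borel_measurable_sum) auto
qed

text \<open>A weight known at time \<open>s\<close> is absorbed into the coefficients; the clamped
  left end points are at least \<open>s\<close>, so measurability there is preserved.\<close>

lemma weighted_elementary_increment:
  assumes st: "0 \<le> s" "s \<le> t" and el: "elementary F m u \<xi>"
    and \<eta>: "\<eta> \<in> borel_measurable (F s)" "\<And>\<omega>. \<bar>\<eta> \<omega>\<bar> \<le> B"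
  defines "D \<equiv> \<lambda>\<omega>. \<eta> \<omega> * (elementary_integral W m u \<xi> t \<omega> - elementary_integral W m u \<xi> s \<omega>)"
  shows "integrable P (\<lambda>\<omega>. (D \<omega>)\<^sup>2)" "expectation D = 0"
    "(\<integral>\<^sup>+\<omega>. ennreal ((D \<omega>)\<^sup>2) \<partial>P)
       \<le> (\<integral>\<^sup>+\<omega>. (\<integral>\<^sup>+r\<in>{s..t}. ennreal ((\<eta> \<omega> * elementary_process m u \<xi> r \<omega>)\<^sup>2) \<partial>lborel) \<partial>P)"
proof -
  define a where "a i = max s (min t (u i))" for i
  \<comment> \<open>On a collapsed interval the coefficient is replaced by 0. If \<open>u i\<close>
    exceeds \<open>t\<close>, then \<open>\<xi> i\<close> need not be measurable at the clamped
    point \<open>a i\<close>, while the increment that it multiplies is zero anyway.\<close>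
  define c where "c i = (if a i < a (Suc i) then \<lambda>\<omega>. \<eta> \<omega> * \<xi> i \<omega> else (\<lambda>_. 0))" for i
  have u: "u i < u (Suc i)" "0 \<le> u i" if "i < m" for i
    using el that elementary_increasing[OF el, of 0 i] by (auto simp: elementary_def)
  have a_mono: "a i \<le> a (Suc i)" if "i < m" for i using u[OF that] by (auto simp: a_def)
  have a0: "0 \<le> a i" for i using st by (simp add: a_def)
  have c_meas: "c i \<in> borel_measurable (F (a i))" if i: "i < m" for i
  proof (cases "a i < a (Suc i)")
    case True
    then have "u i \<le> a i" by (auto simp: a_def max_def min_def split: if_splits)
    have "\<xi> i \<in> borel_measurable (F (u i))" using el i by (simp add: elementary_def)
    then have "\<xi> i \<in> borel_measurable (F (a i))"
      by (rule measurable_F_mono[OF _ u(2)[OF i] \<open>u i \<le> a i\<close>])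
    moreover have "\<eta> \<in> borel_measurable (F (a i))"
      by (rule measurable_F_mono[OF \<eta>(1) st(1)]) (simp add: a_def)
    ultimately show ?thesis using True by (simp add: c_def)
  qed (simp add: c_def)
  have \<eta>P: "\<eta> \<in> borel_measurable P" using measurable_F_P[OF \<eta>(1) st(1)] .
  have c_bd: "\<exists>B. \<forall>\<omega>\<in>space P. \<bar>c i \<omega>\<bar> \<le> B" if i: "i < m" for i
  proof -
    obtain B' where "\<And>\<omega>. \<omega> \<in> space P \<Longrightarrow> \<bar>\<xi> i \<omega>\<bar> \<le> B'"
    proof -
      have "\<exists>B. \<forall>\<omega>\<in>space (F (u i)). \<bar>\<xi> i \<omega>\<bar> \<le> B" using el i by (simp add: elementary_def)
      then show ?thesis using that unfolding space_F[OF u(2)[OF i]] by blast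
    qed
    then have "\<bar>\<eta> \<omega> * \<xi> i \<omega>\<bar> \<le> B * B'" if "\<omega> \<in> space P" for \<omega>
      unfolding abs_mult using \<eta>(2)[of \<omega>] that by (intro mult_mono) auto
    then show ?thesis by (intro exI[of _ "max 0 (B * B')"]) (auto simp: c_def le_max_iff_disj)
  qed
  have cP: "c i \<in> borel_measurable P" if "i < m" for i using measurable_F_P[OF c_meas[OF that] a0] .
  have D: "D \<omega> = (\<Sum>i<m. c i \<omega> * (W (a (Suc i)) \<omega> - W (a i) \<omega>))" for \<omega>
    unfolding D_def elementary_integral_increment[OF st(2)] sum_distrib_left a_def[symmetric]
  proof (intro sum.cong refl)
    fix i assume "i \<in> {..<m}"
    then have "\<not> a i < a (Suc i) \<Longrightarrow> a (Suc i) = a i" using a_mono[of i] by auto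
    then show "\<eta> \<omega> * (\<xi> i \<omega> * (W (a (Suc i)) \<omega> - W (a i) \<omega>)) = c i \<omega> * (W (a (Suc i)) \<omega> - W (a i) \<omega>)"
      by (cases "a i < a (Suc i)") (simp_all add: c_def)
  qed
  note w = weighted_W_sum[of a m c, OF a0 a_mono c_meas c_bd, folded D]
  show D2: "integrable P (\<lambda>\<omega>. (D \<omega>)\<^sup>2)" and "expectation D = 0" using w by auto
  have ci2: "integrable P (\<lambda>\<omega>. (c i \<omega>)\<^sup>2)" if i: "i < m" for i
  proof -
    obtain B where "\<And>\<omega>. \<omega> \<in> space P \<Longrightarrow> \<bar>c i \<omega>\<bar> \<le> B" using c_bd[OF i] by auto
    then show ?thesis by (rule integrable_bounded_square[OF cP[OF i]])
  qed
  have "(\<integral>\<^sup>+\<omega>. ennreal ((D \<omega>)\<^sup>2) \<partial>P) = ennreal (\<Sum>i<m. expectation (\<lambda>\<omega>. (c i \<omega>)\<^sup>2) * (a (Suc i) - a i))"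
    using nn_integral_eq_integral[OF D2] w by simp
  also have "\<dots> = (\<Sum>i<m. (\<integral>\<^sup>+\<omega>. ennreal ((c i \<omega>)\<^sup>2) \<partial>P) * ennreal (a (Suc i) - a i))"
    using a_mono by (subst sum_ennreal[symmetric]) (auto simp: ennreal_mult nn_integral_eq_integral[OF ci2] intro!: sum.cong)
  also have "\<dots> = (\<integral>\<^sup>+\<omega>. (\<Sum>i<m. ennreal ((c i \<omega>)\<^sup>2) * ennreal (a (Suc i) - a i)) \<partial>P)"
    using cP by (subst nn_integral_sum) (auto simp: nn_integral_multc intro!: sum.cong)
  also have "\<dots> \<le> (\<integral>\<^sup>+\<omega>. (\<integral>\<^sup>+r\<in>{s..t}. ennreal ((\<eta> \<omega> * elementary_process m u \<xi> r \<omega>)\<^sup>2) \<partial>lborel) \<partial>P)"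
  proof (rule nn_integral_mono)
    fix \<omega> assume \<omega>: "\<omega> \<in> space P"
    have "(\<Sum>i<m. ennreal ((c i \<omega>)\<^sup>2) * ennreal (a (Suc i) - a i))
        = (\<Sum>i<m. (\<integral>\<^sup>+r. ennreal ((c i \<omega>)\<^sup>2) * indicator {a i<..a (Suc i)} r \<partial>lborel))"
      using a_mono by (intro sum.cong refl) (simp add: nn_integral_cmult_indicator)
    also have "\<dots> = (\<integral>\<^sup>+r. (\<Sum>i<m. ennreal ((c i \<omega>)\<^sup>2) * indicator {a i<..a (Suc i)} r) \<partial>lborel)"
      by (subst nn_integral_sum) auto
    also have "\<dots> \<le> (\<integral>\<^sup>+r\<in>{s..t}. ennreal ((\<eta> \<omega> * elementary_process m u \<xi> r \<omega>)\<^sup>2) \<partial>lborel)"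
    proof (rule nn_integral_mono)
      fix r :: real
      have "(\<Sum>i<m. ennreal ((c i \<omega>)\<^sup>2) * indicator {a i<..a (Suc i)} r)
          = ennreal (\<Sum>i<m. (c i \<omega>)\<^sup>2 * indicator {a i<..a (Suc i)} r)"
        by (subst sum_ennreal[symmetric]) (auto intro!: sum.cong split: split_indicator)
      also have "\<dots> \<le> ennreal ((\<eta> \<omega>)\<^sup>2 * ((elementary_process m u \<xi> r \<omega>)\<^sup>2 * indicator {s..t} r))"
      proof (rule ennreal_leI)
        have "(\<Sum>i<m. (c i \<omega>)\<^sup>2 * indicator {a i<..a (Suc i)} r)
            = (\<eta> \<omega>)\<^sup>2 * (\<Sum>i<m. (\<xi> i \<omega>)\<^sup>2 * indicator {a i<..a (Suc i)} r)"
          unfolding sum_distrib_left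
          by (intro sum.cong refl) (auto simp: c_def power_mult_distrib split: split_indicator)
        also have "\<dots> \<le> (\<eta> \<omega>)\<^sup>2 * ((elementary_process m u \<xi> r \<omega>)\<^sup>2 * indicator {s..t} r)"
          unfolding a_def by (intro mult_left_mono elementary_process_sq_ge[OF el]) auto
        finally show "(\<Sum>i<m. (c i \<omega>)\<^sup>2 * indicator {a i<..a (Suc i)} r)
            \<le> (\<eta> \<omega>)\<^sup>2 * ((elementary_process m u \<xi> r \<omega>)\<^sup>2 * indicator {s..t} r)" .
      qed
      also have "\<dots> = ennreal ((\<eta> \<omega> * elementary_process m u \<xi> r \<omega>)\<^sup>2) * indicator {s..t} r"
        by (auto simp: power_mult_distrib split: split_indicator)
      finally show "(\<Sum>i<m. ennreal ((c i \<omega>)\<^sup>2) * indicator {a i<..a (Suc i)} r)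
          \<le> ennreal ((\<eta> \<omega> * elementary_process m u \<xi> r \<omega>)\<^sup>2) * indicator {s..t} r" .
    qed
    finally show "(\<Sum>i<m. ennreal ((c i \<omega>)\<^sup>2) * ennreal (a (Suc i) - a i))
        \<le> (\<integral>\<^sup>+r\<in>{s..t}. ennreal ((\<eta> \<omega> * elementary_process m u \<xi> r \<omega>)\<^sup>2) \<partial>lborel)" .
  qed
  finally show "(\<integral>\<^sup>+\<omega>. ennreal ((D \<omega>)\<^sup>2) \<partial>P)
       \<le> (\<integral>\<^sup>+\<omega>. (\<integral>\<^sup>+r\<in>{s..t}. ennreal ((\<eta> \<omega> * elementary_process m u \<xi> r \<omega>)\<^sup>2) \<partial>lborel) \<partial>P)" .
qed

end

section \<open>Moments of the Ito integral\<close>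

lemma power2_add_le: "(a + b)\<^sup>2 \<le> 2 * a\<^sup>2 + 2 * b\<^sup>2" for a b :: real
  using zero_le_power2[of "a - b"] by (simp add: power2_eq_square algebra_simps)

lemma power2_diff_le: "(a - b)\<^sup>2 \<le> 2 * a\<^sup>2 + 2 * b\<^sup>2" for a b :: real
  using power2_add_le[of a "- b"] by simp

context brownian_space
begin

text \<open>Clamping the time to [0, t] carries measurability from the restricted space to the full
  product, and the indicator removes the clamped values. Below, \<open>N\<close> is \<open>P\<close>
  for moment bounds and \<open>F t\<close> for the adaptedness of a time integral.\<close>

lemma progressive_measurable:
  assumes H: "progressive F H" and t: "0 \<le> t" and N: "(\<lambda>\<omega>. \<omega>) \<in> measurable N (F t)"
  shows "(\<lambda>x. indicator {0..t} (snd x) * H (snd x) (fst x)) \<in> borel_measurable (N \<Otimes>\<^sub>M lborel)"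
proof -
  have H': "(\<lambda>(r, \<omega>). H r \<omega>) \<in> borel_measurable (restrict_space borel {0..t} \<Otimes>\<^sub>M F t)"
    using H t by (simp add: progressive_def)
  have fst': "fst \<in> measurable (N \<Otimes>\<^sub>M lborel) (F t)"
    using measurable_compose[OF measurable_fst N, of lborel] by simp
  have clamp: "(\<lambda>x. max 0 (min t (snd x))) \<in> measurable (N \<Otimes>\<^sub>M lborel) (restrict_space borel {0..t})"
    using t by (intro measurable_restrict_space2) auto
  have "(\<lambda>x. (max 0 (min t (snd x)), fst x)) \<in> measurable (N \<Otimes>\<^sub>M lborel) (restrict_space borel {0..t} \<Otimes>\<^sub>M F t)"
    using clamp fst' by (rule measurable_Pair)
  from measurable_compose[OF this H']
  have [measurable]: "(\<lambda>x. H (max 0 (min t (snd x))) (fst x)) \<in> borel_measurable (N \<Otimes>\<^sub>M lborel)" by simp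
  have "(\<lambda>x. indicator {0..t} (snd x) * H (max 0 (min t (snd x))) (fst x)) \<in> borel_measurable (N \<Otimes>\<^sub>M lborel)"
    by measurable
  also have "(\<lambda>x. indicator {0..t} (snd x) * H (max 0 (min t (snd x))) (fst x)) = (\<lambda>x. indicator {0..t} (snd x) * H (snd x) (fst x))"
    by (auto simp: fun_eq_iff split: split_indicator)
  finally show ?thesis .
qed

lemma id_measurable_F: "0 \<le> t \<Longrightarrow> (\<lambda>\<omega>. \<omega>) \<in> measurable P (F t)"
  by (rule measurable_F_P) auto

lemma elementary_integral_measurable:
  assumes el: "elementary F m u \<xi>" and t: "0 \<le> t"
  shows "elementary_integral W m u \<xi> t \<in> borel_measurable P"
proof -
  have u: "0 \<le> u i" if "i \<le> m" for i
    using el that elementary_increasing[OF el, of 0 i] by (auto simp: elementary_def)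
  have "\<xi> i \<in> borel_measurable P" if "i < m" for i
    using el that u[of i] by (intro measurable_F_P[of "\<xi> i" "u i"]) (auto simp: elementary_def)
  moreover have "W (min (u i) t) \<in> borel_measurable P" if "i \<le> m" for i
    using u[OF that] t by (intro measurable_F_P[OF W_measurable]) auto
  ultimately show ?thesis
    unfolding elementary_integral_def[abs_def] by (intro borel_measurable_sum borel_measurable_times borel_measurable_diff) auto
qed

text \<open>Weighted increments of the approximating elementary integrals are compared with those of
  \<open>I\<close>; since \<open>\<eta>\<close> is bounded, every remainder is at most a constant
  multiple of a null sequence.\<close>

lemma weighted_ito_increment_bounded:
  assumes ito: "ito_integral P F W H I" and st: "0 \<le> s" "s \<le> t"
    and \<eta>: "\<eta> \<in> borel_measurable (F s)" "\<And>\<omega>. \<bar>\<eta> \<omega>\<bar> \<le> B"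
  defines "X \<equiv> \<lambda>\<omega>. \<eta> \<omega> * (I t \<omega> - I s \<omega>)"
  shows "(\<integral>\<^sup>+\<omega>. ennreal ((X \<omega>)\<^sup>2) \<partial>P)
      \<le> 4 * (\<integral>\<^sup>+\<omega>. (\<integral>\<^sup>+r\<in>{s..t}. ennreal ((\<eta> \<omega> * H r \<omega>)\<^sup>2) \<partial>lborel) \<partial>P)" (is "_ \<le> 4 * ?Q")
    and "expectation X = 0"
proof -
  obtain m u \<xi> where approx: "\<forall>k::nat. elementary F (m k) (u k) (\<xi> k)"
      "\<forall>t\<ge>0. (\<lambda>k. \<integral>\<^sup>+\<omega>. (\<integral>\<^sup>+r\<in>{0..t}.
              ennreal ((elementary_process (m k) (u k) (\<xi> k) r \<omega> - H r \<omega>)\<^sup>2) \<partial>lborel) \<partial>P) \<longlonglongrightarrow> 0 \<and>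
          (\<lambda>k. \<integral>\<^sup>+\<omega>.
              ennreal ((elementary_integral W (m k) (u k) (\<xi> k) t \<omega> - I t \<omega>)\<^sup>2) \<partial>P) \<longlonglongrightarrow> 0"
    using ito unfolding ito_integral_def by (elim conjE exE) (rule that)
  then have el: "\<And>k. elementary F (m k) (u k) (\<xi> k)"
    and conv_H: "\<And>t. t \<ge> 0 \<Longrightarrow> (\<lambda>k. \<integral>\<^sup>+\<omega>. (\<integral>\<^sup>+r\<in>{0..t}.
              ennreal ((elementary_process (m k) (u k) (\<xi> k) r \<omega> - H r \<omega>)\<^sup>2) \<partial>lborel) \<partial>P) \<longlonglongrightarrow> 0"
    and conv_I: "\<And>t. t \<ge> 0 \<Longrightarrow> (\<lambda>k. \<integral>\<^sup>+\<omega>.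
              ennreal ((elementary_integral W (m k) (u k) (\<xi> k) t \<omega> - I t \<omega>)\<^sup>2) \<partial>P) \<longlonglongrightarrow> 0"
    by simp_all
  have H: "progressive F H" and H_fin: "(\<integral>\<^sup>+\<omega>. (\<integral>\<^sup>+r\<in>{0..t}. ennreal ((H r \<omega>)\<^sup>2) \<partial>lborel) \<partial>P) < \<infinity>"
    and I: "\<And>t. 0 \<le> t \<Longrightarrow> I t \<in> borel_measurable P"
    using ito st unfolding ito_integral_def by auto
  have t: "0 \<le> t" using st by simp
  define E where "E k r \<omega> = elementary_process (m k) (u k) (\<xi> k) r \<omega>" for k r \<omega>
  define J where "J k v \<omega> = elementary_integral W (m k) (u k) (\<xi> k) v \<omega>" for k v \<omega>
  define A where "A k = (\<integral>\<^sup>+\<omega>. (\<integral>\<^sup>+r\<in>{0..t}. ennreal ((E k r \<omega> - H r \<omega>)\<^sup>2) \<partial>lborel) \<partial>P)" for k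
  define R where "R k v = (\<integral>\<^sup>+\<omega>. ennreal ((J k v \<omega> - I v \<omega>)\<^sup>2) \<partial>P)" for k v
  define D where "D k \<omega> = \<eta> \<omega> * (J k t \<omega> - J k s \<omega>)" for k \<omega>
  have A: "A \<longlonglongrightarrow> 0" and R: "(\<lambda>k. R k t) \<longlonglongrightarrow> 0" "(\<lambda>k. R k s) \<longlonglongrightarrow> 0"
    using conv_H[OF t] conv_I[OF t] conv_I[OF st(1)] by (simp_all add: A_def[abs_def] E_def R_def J_def)
  have \<eta>P [measurable]: "\<eta> \<in> borel_measurable P" by (rule measurable_F_P[OF \<eta>(1) st(1)])
  have J [measurable]: "J k v \<in> borel_measurable P" if "0 \<le> v" for k v
    unfolding J_def[abs_def] by (rule elementary_integral_measurable[OF el that])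
  note [measurable] = I[OF st(1)] I[OF t] J[OF st(1)] J[OF t]
  have X [measurable]: "X \<in> borel_measurable P" unfolding X_def by measurable
  have D_meas [measurable]: "D k \<in> borel_measurable P" for k unfolding D_def[abs_def] by measurable
  have Hm [measurable]: "(\<lambda>x. indicator {0..t} (snd x) * H (snd x) (fst x)) \<in> borel_measurable (P \<Otimes>\<^sub>M lborel)"
    by (rule progressive_measurable[OF H t id_measurable_F[OF t]])
  have Em [measurable]: "(\<lambda>x. E k (snd x) (fst x)) \<in> borel_measurable (P \<Otimes>\<^sub>M lborel)" for k
    using elementary_process_measurable[OF el, of k] unfolding E_def by (simp add: case_prod_beta')
  have ind: "indicator {s..t} r * x = indicator {s..t} r * (indicator {0..t} r * x)" for r x :: real
    using st by (auto split: split_indicator)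
  define f where "f x = ennreal ((\<eta> (fst x) * (indicator {0..t} (snd x) * H (snd x) (fst x)))\<^sup>2) * indicator {s..t} (snd x)" for x
  define g where "g k x = ennreal ((indicator {0..t} (snd x) * E k (snd x) (fst x) - indicator {0..t} (snd x) * H (snd x) (fst x))\<^sup>2)" for k x
  have fm [measurable]: "f \<in> borel_measurable (P \<Otimes>\<^sub>M lborel)" unfolding f_def[abs_def] by measurable
  have gm [measurable]: "g k \<in> borel_measurable (P \<Otimes>\<^sub>M lborel)" for k unfolding g_def[abs_def] by measurable
  have Q: "?Q = (\<integral>\<^sup>+\<omega>. (\<integral>\<^sup>+r. f (\<omega>, r) \<partial>lborel) \<partial>P)"
    unfolding f_def using st by (intro nn_integral_cong) (auto split: split_indicator)
  have A': "A k = (\<integral>\<^sup>+\<omega>. (\<integral>\<^sup>+r. g k (\<omega>, r) \<partial>lborel) \<partial>P)" for k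
    unfolding g_def A_def by (intro nn_integral_cong) (auto split: split_indicator)
  have bound_D: "(\<integral>\<^sup>+\<omega>. ennreal ((D k \<omega>)\<^sup>2) \<partial>P) \<le> 2 * ?Q + ennreal (2 * B\<^sup>2) * A k" for k
  proof -
    have "(\<integral>\<^sup>+\<omega>. ennreal ((D k \<omega>)\<^sup>2) \<partial>P) \<le> (\<integral>\<^sup>+\<omega>. (\<integral>\<^sup>+r\<in>{s..t}. ennreal ((\<eta> \<omega> * E k r \<omega>)\<^sup>2) \<partial>lborel) \<partial>P)"
      unfolding D_def J_def E_def by (rule weighted_elementary_increment(3)[OF st el \<eta>])
    also have "\<dots> \<le> (\<integral>\<^sup>+\<omega>. (\<integral>\<^sup>+r. 2 * f (\<omega>, r) + ennreal (2 * B\<^sup>2) * g k (\<omega>, r) \<partial>lborel) \<partial>P)"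
    proof (intro nn_integral_mono)
      fix \<omega> r
      show "ennreal ((\<eta> \<omega> * E k r \<omega>)\<^sup>2) * indicator {s..t} r \<le> 2 * f (\<omega>, r) + ennreal (2 * B\<^sup>2) * g k (\<omega>, r)"
      proof (cases "r \<in> {s..t}")
        case True
        then have r: "r \<in> {0..t}" using st by auto
        have "(\<eta> \<omega> * E k r \<omega>)\<^sup>2 = (\<eta> \<omega> * H r \<omega> + \<eta> \<omega> * (E k r \<omega> - H r \<omega>))\<^sup>2"
          by (simp add: algebra_simps)
        also have "\<dots> \<le> 2 * (\<eta> \<omega> * H r \<omega>)\<^sup>2 + 2 * (\<eta> \<omega> * (E k r \<omega> - H r \<omega>))\<^sup>2"
          by (rule power2_add_le)
        also have "(\<eta> \<omega> * (E k r \<omega> - H r \<omega>))\<^sup>2 \<le> B\<^sup>2 * (E k r \<omega> - H r \<omega>)\<^sup>2"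
          unfolding power_mult_distrib using power_mono[OF \<eta>(2)[of \<omega>], of 2] by (intro mult_right_mono) auto
        finally have "(\<eta> \<omega> * E k r \<omega>)\<^sup>2 \<le> 2 * (\<eta> \<omega> * H r \<omega>)\<^sup>2 + 2 * B\<^sup>2 * (E k r \<omega> - H r \<omega>)\<^sup>2" by simp
        then have "ennreal ((\<eta> \<omega> * E k r \<omega>)\<^sup>2) \<le> ennreal (2 * (\<eta> \<omega> * H r \<omega>)\<^sup>2 + 2 * B\<^sup>2 * (E k r \<omega> - H r \<omega>)\<^sup>2)"
          by (rule ennreal_leI)
        also have "\<dots> = 2 * f (\<omega>, r) + ennreal (2 * B\<^sup>2) * g k (\<omega>, r)"
          using True r by (simp add: f_def g_def ennreal_mult ennreal_plus)
        finally show ?thesis using True by simp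
      qed simp
    qed
    also have "\<dots> = (\<integral>\<^sup>+\<omega>. 2 * (\<integral>\<^sup>+r. f (\<omega>, r) \<partial>lborel) + ennreal (2 * B\<^sup>2) * (\<integral>\<^sup>+r. g k (\<omega>, r) \<partial>lborel) \<partial>P)"
      by (intro nn_integral_cong) (simp add: nn_integral_add nn_integral_cmult)
    also have "\<dots> = 2 * ?Q + ennreal (2 * B\<^sup>2) * A k"
      unfolding Q A' by (simp add: nn_integral_add nn_integral_cmult)
    finally show ?thesis .
  qed
  have bound_Z: "(\<integral>\<^sup>+\<omega>. ennreal ((X \<omega> - D k \<omega>)\<^sup>2) \<partial>P) \<le> ennreal (2 * B\<^sup>2) * (R k t + R k s)" for k
  proof -
    have "(\<integral>\<^sup>+\<omega>. ennreal ((X \<omega> - D k \<omega>)\<^sup>2) \<partial>P)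
        \<le> (\<integral>\<^sup>+\<omega>. ennreal (2 * B\<^sup>2) * (ennreal ((J k t \<omega> - I t \<omega>)\<^sup>2) + ennreal ((J k s \<omega> - I s \<omega>)\<^sup>2)) \<partial>P)"
    proof (rule nn_integral_mono)
      fix \<omega>
      have "X \<omega> - D k \<omega> = \<eta> \<omega> * ((J k s \<omega> - I s \<omega>) - (J k t \<omega> - I t \<omega>))"
        by (simp add: X_def D_def algebra_simps)
      then have "(X \<omega> - D k \<omega>)\<^sup>2 = (\<eta> \<omega>)\<^sup>2 * ((J k s \<omega> - I s \<omega>) - (J k t \<omega> - I t \<omega>))\<^sup>2"
        by (simp only: power_mult_distrib)
      also have "\<dots> \<le> B\<^sup>2 * (2 * (J k t \<omega> - I t \<omega>)\<^sup>2 + 2 * (J k s \<omega> - I s \<omega>)\<^sup>2)"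
      proof (rule mult_mono)
        show "(\<eta> \<omega>)\<^sup>2 \<le> B\<^sup>2" using power_mono[OF \<eta>(2)[of \<omega>], of 2] by simp
        show "((J k s \<omega> - I s \<omega>) - (J k t \<omega> - I t \<omega>))\<^sup>2 \<le> 2 * (J k t \<omega> - I t \<omega>)\<^sup>2 + 2 * (J k s \<omega> - I s \<omega>)\<^sup>2"
          using power2_diff_le[of "J k s \<omega> - I s \<omega>" "J k t \<omega> - I t \<omega>"] by linarith
      qed auto
      also have "\<dots> = 2 * B\<^sup>2 * ((J k t \<omega> - I t \<omega>)\<^sup>2 + (J k s \<omega> - I s \<omega>)\<^sup>2)" by simp
      finally have "ennreal ((X \<omega> - D k \<omega>)\<^sup>2) \<le> ennreal (2 * B\<^sup>2 * ((J k t \<omega> - I t \<omega>)\<^sup>2 + (J k s \<omega> - I s \<omega>)\<^sup>2))"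
        by (rule ennreal_leI)
      then show "ennreal ((X \<omega> - D k \<omega>)\<^sup>2)
          \<le> ennreal (2 * B\<^sup>2) * (ennreal ((J k t \<omega> - I t \<omega>)\<^sup>2) + ennreal ((J k s \<omega> - I s \<omega>)\<^sup>2))"
        by (simp add: ennreal_mult ennreal_plus)
    qed
    also have "\<dots> = ennreal (2 * B\<^sup>2) * (R k t + R k s)"
      unfolding R_def by (subst nn_integral_cmult; simp add: nn_integral_add)
    finally show ?thesis .
  qed
  have bound_X: "(\<integral>\<^sup>+\<omega>. ennreal ((X \<omega>)\<^sup>2) \<partial>P)
      \<le> 4 * ?Q + (2 * (ennreal (2 * B\<^sup>2) * A k) + 2 * (ennreal (2 * B\<^sup>2) * (R k t + R k s)))" for k
  proof -
    have "(\<integral>\<^sup>+\<omega>. ennreal ((X \<omega>)\<^sup>2) \<partial>P) \<le> (\<integral>\<^sup>+\<omega>. 2 * ennreal ((D k \<omega>)\<^sup>2) + 2 * ennreal ((X \<omega> - D k \<omega>)\<^sup>2) \<partial>P)"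
    proof (rule nn_integral_mono)
      fix \<omega>
      have "(X \<omega>)\<^sup>2 \<le> 2 * (D k \<omega>)\<^sup>2 + 2 * (X \<omega> - D k \<omega>)\<^sup>2"
        using power2_add_le[of "D k \<omega>" "X \<omega> - D k \<omega>"] by simp
      then have "ennreal ((X \<omega>)\<^sup>2) \<le> ennreal (2 * (D k \<omega>)\<^sup>2 + 2 * (X \<omega> - D k \<omega>)\<^sup>2)" by (rule ennreal_leI)
      then show "ennreal ((X \<omega>)\<^sup>2) \<le> 2 * ennreal ((D k \<omega>)\<^sup>2) + 2 * ennreal ((X \<omega> - D k \<omega>)\<^sup>2)"
        by (simp add: ennreal_mult ennreal_plus)
    qed
    also have "\<dots> = 2 * (\<integral>\<^sup>+\<omega>. ennreal ((D k \<omega>)\<^sup>2) \<partial>P) + 2 * (\<integral>\<^sup>+\<omega>. ennreal ((X \<omega> - D k \<omega>)\<^sup>2) \<partial>P)"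
      by (simp add: nn_integral_add nn_integral_cmult)
    also have "\<dots> \<le> 2 * (2 * ?Q + ennreal (2 * B\<^sup>2) * A k) + 2 * (ennreal (2 * B\<^sup>2) * (R k t + R k s))"
      using bound_D[of k] bound_Z[of k] by (intro add_mono mult_left_mono) auto
    also have "\<dots> = 4 * ?Q + (2 * (ennreal (2 * B\<^sup>2) * A k) + 2 * (ennreal (2 * B\<^sup>2) * (R k t + R k s)))"
      by (simp add: distrib_left add.assoc mult.assoc[symmetric])
    finally show ?thesis .
  qed
  have RR: "(\<lambda>k. ennreal (2 * B\<^sup>2) * (R k t + R k s)) \<longlonglongrightarrow> 0"
    using ennreal_tendsto_cmult[of "ennreal (2 * B\<^sup>2)", OF _ tendsto_add[OF R]] by simp
  have "(\<lambda>k. 4 * ?Q + (2 * (ennreal (2 * B\<^sup>2) * A k) + 2 * (ennreal (2 * B\<^sup>2) * (R k t + R k s))))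
      \<longlonglongrightarrow> 4 * ?Q + (2 * (ennreal (2 * B\<^sup>2) * 0) + 2 * 0)"
    by (intro tendsto_add tendsto_const ennreal_tendsto_cmult A RR) auto
  then have "(\<lambda>k. 4 * ?Q + (2 * (ennreal (2 * B\<^sup>2) * A k) + 2 * (ennreal (2 * B\<^sup>2) * (R k t + R k s)))) \<longlonglongrightarrow> 4 * ?Q"
    by simp
  then show main: "(\<integral>\<^sup>+\<omega>. ennreal ((X \<omega>)\<^sup>2) \<partial>P) \<le> 4 * ?Q"
    by (rule LIMSEQ_le_const) (use bound_X in auto)
  \<comment> \<open>Finiteness makes \<open>X\<close> square integrable, hence integrable, before
    anything is said about its mean.\<close>
  have Q_fin: "?Q < \<infinity>"
  proof -
    have "?Q \<le> (\<integral>\<^sup>+\<omega>. (\<integral>\<^sup>+r. ennreal (B\<^sup>2) * ennreal ((indicator {0..t} r * H r \<omega>)\<^sup>2) \<partial>lborel) \<partial>P)"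
    proof (intro nn_integral_mono)
      fix \<omega> r
      have "(\<eta> \<omega>)\<^sup>2 * (H r \<omega>)\<^sup>2 \<le> B\<^sup>2 * (H r \<omega>)\<^sup>2"
        using power_mono[OF \<eta>(2)[of \<omega>], of 2] by (intro mult_right_mono) auto
      then show "ennreal ((\<eta> \<omega> * H r \<omega>)\<^sup>2) * indicator {s..t} r \<le> ennreal (B\<^sup>2) * ennreal ((indicator {0..t} r * H r \<omega>)\<^sup>2)"
        using st by (auto simp: power_mult_distrib ennreal_mult[symmetric] intro!: ennreal_leI split: split_indicator)
    qed
    also have "\<dots> = ennreal (B\<^sup>2) * (\<integral>\<^sup>+\<omega>. (\<integral>\<^sup>+r\<in>{0..t}. ennreal ((H r \<omega>)\<^sup>2) \<partial>lborel) \<partial>P)"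
    proof -
      define h where "h x = ennreal ((indicator {0..t} (snd x) * H (snd x) (fst x))\<^sup>2)" for x
      have [measurable]: "h \<in> borel_measurable (P \<Otimes>\<^sub>M lborel)" unfolding h_def[abs_def] by measurable
      have "(\<integral>\<^sup>+\<omega>. (\<integral>\<^sup>+r. ennreal (B\<^sup>2) * h (\<omega>, r) \<partial>lborel) \<partial>P)
          = (\<integral>\<^sup>+\<omega>. ennreal (B\<^sup>2) * (\<integral>\<^sup>+r. h (\<omega>, r) \<partial>lborel) \<partial>P)"
        by (intro nn_integral_cong) (simp add: nn_integral_cmult)
      also have "\<dots> = ennreal (B\<^sup>2) * (\<integral>\<^sup>+\<omega>. (\<integral>\<^sup>+r. h (\<omega>, r) \<partial>lborel) \<partial>P)"
        by (simp add: nn_integral_cmult)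
      finally have "(\<integral>\<^sup>+\<omega>. (\<integral>\<^sup>+r. ennreal (B\<^sup>2) * h (\<omega>, r) \<partial>lborel) \<partial>P)
          = ennreal (B\<^sup>2) * (\<integral>\<^sup>+\<omega>. (\<integral>\<^sup>+r. h (\<omega>, r) \<partial>lborel) \<partial>P)" .
      moreover have "h (\<omega>, r) = ennreal ((H r \<omega>)\<^sup>2) * indicator {0..t} r" for \<omega> r
        by (simp add: h_def split: split_indicator)
      ultimately show ?thesis by (simp add: h_def)
    qed
    also have "\<dots> < \<infinity>" using H_fin by (simp add: ennreal_mult_less_top)
    finally show ?thesis .
  qed
  have X2: "integrable P (\<lambda>\<omega>. (X \<omega>)\<^sup>2)"
  proof (rule integrableI_nonneg)
    have "4 * ?Q < \<infinity>" using Q_fin by (simp add: ennreal_mult_less_top)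
    then show "(\<integral>\<^sup>+\<omega>. ennreal ((X \<omega>)\<^sup>2) \<partial>P) < \<infinity>" using main by (rule le_less_trans[rotated])
  qed auto
  have X1: "integrable P X" by (rule square_integrable_imp_integrable[OF X X2])
  \<comment> \<open>The elementary increments have mean zero, so \<open>X\<close> and
    \<open>X - D k\<close> have the same mean. Its square is at most the second moment of
    \<open>X - D k\<close>, which tends to zero.\<close>
  have "ennreal ((expectation X)\<^sup>2) \<le> ennreal (2 * B\<^sup>2) * (R k t + R k s)" for k
  proof -
    have D2: "integrable P (\<lambda>\<omega>. (D k \<omega>)\<^sup>2)" "expectation (D k) = 0"
      using weighted_elementary_increment(1,2)[OF st el \<eta>, of k] unfolding D_def[abs_def] J_def[abs_def] by auto
    have D1: "integrable P (D k)" by (rule square_integrable_imp_integrable[OF D_meas D2(1)])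
    have Z2: "integrable P (\<lambda>\<omega>. (X \<omega> - D k \<omega>)\<^sup>2)"
    proof (rule Bochner_Integration.integrable_bound)
      show "integrable P (\<lambda>\<omega>. 2 * (X \<omega>)\<^sup>2 + 2 * (D k \<omega>)\<^sup>2)" using X2 D2 by simp
      show "AE \<omega> in P. norm ((X \<omega> - D k \<omega>)\<^sup>2) \<le> norm (2 * (X \<omega>)\<^sup>2 + 2 * (D k \<omega>)\<^sup>2)"
      proof (rule AE_I2)
        fix \<omega>
        have "(X \<omega> - D k \<omega>)\<^sup>2 \<le> 2 * (X \<omega>)\<^sup>2 + 2 * (D k \<omega>)\<^sup>2"
          by (rule power2_diff_le)
        then show "norm ((X \<omega> - D k \<omega>)\<^sup>2) \<le> norm (2 * (X \<omega>)\<^sup>2 + 2 * (D k \<omega>)\<^sup>2)" by simp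
      qed
    qed auto
    have EZ: "expectation (\<lambda>\<omega>. X \<omega> - D k \<omega>) = expectation X" using X1 D1 D2(2) by simp
    have "(expectation X)\<^sup>2 \<le> expectation (\<lambda>\<omega>. (X \<omega> - D k \<omega>)\<^sup>2)"
      using variance_eq[of "\<lambda>\<omega>. X \<omega> - D k \<omega>"] variance_positive[of "\<lambda>\<omega>. X \<omega> - D k \<omega>"] X1 D1 Z2 unfolding EZ by simp
    then have "ennreal ((expectation X)\<^sup>2) \<le> ennreal (expectation (\<lambda>\<omega>. (X \<omega> - D k \<omega>)\<^sup>2))" by (rule ennreal_leI)
    also have "\<dots> = (\<integral>\<^sup>+\<omega>. ennreal ((X \<omega> - D k \<omega>)\<^sup>2) \<partial>P)"
      by (rule nn_integral_eq_integral[symmetric, OF Z2]) auto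
    finally show ?thesis using bound_Z order_trans by blast
  qed
  then have "ennreal ((expectation X)\<^sup>2) \<le> 0" by (intro LIMSEQ_le_const[OF RR]) auto
  then show "expectation X = 0" by simp
qed

text \<open>The weights to come are built from gradients, which have moments but no bound.
  Truncation keeps them measurable at time \<open>s\<close>; the second moment passes to the limit
  by monotone convergence and the mean by dominated convergence.\<close>

lemma weighted_ito_increment:
  assumes ito: "ito_integral P F W H I" and st: "0 \<le> s" "s \<le> t"
    and \<eta>: "\<eta> \<in> borel_measurable (F s)" and C: "0 \<le> C"
    and bound: "\<And>r. r \<in> {s..t} \<Longrightarrow> (\<integral>\<^sup>+\<omega>. ennreal ((\<eta> \<omega> * H r \<omega>)\<^sup>2) \<partial>P) \<le> ennreal C"
  defines "X \<equiv> \<lambda>\<omega>. \<eta> \<omega> * (I t \<omega> - I s \<omega>)"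
  shows "integrable P (\<lambda>\<omega>. (X \<omega>)\<^sup>2)" "expectation (\<lambda>\<omega>. (X \<omega>)\<^sup>2) \<le> 4 * C * (t - s)" "expectation X = 0"
proof -
  have t: "0 \<le> t" using st by simp
  have H: "progressive F H" and I: "\<And>t. 0 \<le> t \<Longrightarrow> I t \<in> borel_measurable P"
    using ito unfolding ito_integral_def by auto
  have \<eta>P [measurable]: "\<eta> \<in> borel_measurable P" by (rule measurable_F_P[OF \<eta> st(1)])
  note [measurable] = I[OF st(1)] I[OF t]
  have X [measurable]: "X \<in> borel_measurable P" unfolding X_def by measurable
  define \<eta>k where "\<eta>k k \<omega> = max (- real k) (min (real k) (\<eta> \<omega>))" for k :: nat and \<omega>
  have \<eta>k: "\<eta>k k \<in> borel_measurable (F s)" "\<And>\<omega>. \<bar>\<eta>k k \<omega>\<bar> \<le> real k" for k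
    using \<eta> by (auto simp: \<eta>k_def[abs_def])
  have [measurable]: "\<eta>k k \<in> borel_measurable P" for k by (rule measurable_F_P[OF \<eta>k(1) st(1)])
  have mono: "\<bar>\<eta>k k \<omega>\<bar> \<le> \<bar>\<eta>k l \<omega>\<bar>" if "k \<le> l" for k l \<omega>
    using that by (auto simp: \<eta>k_def)
  have le: "\<bar>\<eta>k k \<omega>\<bar> \<le> \<bar>\<eta> \<omega>\<bar>" for k \<omega> by (auto simp: \<eta>k_def)
  \<comment> \<open>At each point the truncations eventually equal \<open>\<eta>\<close>, so
    pointwise convergence is immediate.\<close>
  have ev: "\<forall>\<^sub>F k in sequentially. \<eta>k k \<omega> = \<eta> \<omega>" for \<omega>
    using eventually_ge_at_top[of "nat \<lceil>\<bar>\<eta> \<omega>\<bar>\<rceil>"]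
  proof eventually_elim
    case (elim k)
    then have "\<bar>\<eta> \<omega>\<bar> \<le> real k" by linarith
    then show ?case by (auto simp: \<eta>k_def)
  qed
  \<comment> \<open>Exchanging the integrals turns the bound at each fixed time into one that is
    linear in the length of the interval.\<close>
  have Q: "(\<integral>\<^sup>+\<omega>. (\<integral>\<^sup>+r\<in>{s..t}. ennreal ((\<eta> \<omega> * H r \<omega>)\<^sup>2) \<partial>lborel) \<partial>P) \<le> ennreal (C * (t - s))"
  proof -
    interpret pair_sigma_finite P lborel ..
    have Hm [measurable]: "(\<lambda>x. indicator {0..t} (snd x) * H (snd x) (fst x)) \<in> borel_measurable (P \<Otimes>\<^sub>M lborel)"
      by (rule progressive_measurable[OF H t id_measurable_F[OF t]])
    define f where "f = (\<lambda>(\<omega>, r). ennreal ((\<eta> \<omega> * (indicator {0..t} r * H r \<omega>))\<^sup>2) * indicator {s..t} r)"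
    have [measurable]: "f \<in> borel_measurable (P \<Otimes>\<^sub>M lborel)"
      unfolding f_def case_prod_beta' by measurable
    have f: "f (\<omega>, r) = ennreal ((\<eta> \<omega> * H r \<omega>)\<^sup>2) * indicator {s..t} r" for \<omega> r
      unfolding f_def using st by (auto split: split_indicator)
    have "(\<integral>\<^sup>+\<omega>. (\<integral>\<^sup>+r\<in>{s..t}. ennreal ((\<eta> \<omega> * H r \<omega>)\<^sup>2) \<partial>lborel) \<partial>P) = (\<integral>\<^sup>+\<omega>. (\<integral>\<^sup>+r. f (\<omega>, r) \<partial>lborel) \<partial>P)"
      by (simp add: f)
    also have "\<dots> = (\<integral>\<^sup>+r. (\<integral>\<^sup>+\<omega>. f (\<omega>, r) \<partial>P) \<partial>lborel)"
      by (rule Fubini'[symmetric]) simp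
    also have "\<dots> \<le> (\<integral>\<^sup>+r. ennreal C * indicator {s..t} r \<partial>lborel)"
    proof (rule nn_integral_mono)
      fix r :: real
      show "(\<integral>\<^sup>+\<omega>. f (\<omega>, r) \<partial>P) \<le> ennreal C * indicator {s..t} r"
        using bound[of r] by (auto simp: f split: split_indicator)
    qed
    also have "\<dots> = ennreal (C * (t - s))"
      using st C by (simp add: nn_integral_cmult_indicator ennreal_mult)
    finally show ?thesis .
  qed
  have bound_k: "(\<integral>\<^sup>+\<omega>. ennreal ((\<eta>k k \<omega> * (I t \<omega> - I s \<omega>))\<^sup>2) \<partial>P) \<le> ennreal (4 * C * (t - s))" for k
  proof -
    have "(\<integral>\<^sup>+\<omega>. ennreal ((\<eta>k k \<omega> * (I t \<omega> - I s \<omega>))\<^sup>2) \<partial>P)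
        \<le> 4 * (\<integral>\<^sup>+\<omega>. (\<integral>\<^sup>+r\<in>{s..t}. ennreal ((\<eta>k k \<omega> * H r \<omega>)\<^sup>2) \<partial>lborel) \<partial>P)"
      by (rule weighted_ito_increment_bounded(1)[OF ito st \<eta>k])
    also have "\<dots> \<le> 4 * (\<integral>\<^sup>+\<omega>. (\<integral>\<^sup>+r\<in>{s..t}. ennreal ((\<eta> \<omega> * H r \<omega>)\<^sup>2) \<partial>lborel) \<partial>P)"
      by (intro mult_left_mono nn_integral_mono mult_right_mono ennreal_leI)
         (auto simp: power_mult_distrib abs_le_square_iff[symmetric] le intro!: mult_right_mono)
    also have "\<dots> \<le> 4 * ennreal (C * (t - s))" using Q by (intro mult_left_mono) auto
    also have "\<dots> = ennreal (4 * C * (t - s))" using C st by (simp add: ennreal_mult mult.assoc)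
    finally show ?thesis .
  qed
  have "(\<lambda>k. \<integral>\<^sup>+\<omega>. ennreal ((\<eta>k k \<omega> * (I t \<omega> - I s \<omega>))\<^sup>2) \<partial>P) \<longlonglongrightarrow> (\<integral>\<^sup>+\<omega>. ennreal ((X \<omega>)\<^sup>2) \<partial>P)"
  proof (rule nn_integral_LIMSEQ)
    show "incseq (\<lambda>k \<omega>. ennreal ((\<eta>k k \<omega> * (I t \<omega> - I s \<omega>))\<^sup>2))"
      using mono by (auto simp: incseq_def le_fun_def power_mult_distrib abs_le_square_iff[symmetric] intro!: ennreal_leI mult_right_mono)
    show "(\<lambda>k. ennreal ((\<eta>k k \<omega> * (I t \<omega> - I s \<omega>))\<^sup>2)) \<longlonglongrightarrow> ennreal ((X \<omega>)\<^sup>2)" for \<omega>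
      by (rule tendsto_eventually) (use ev[of \<omega>] in eventually_elim, simp add: X_def)
  qed measurable
  then have fin: "(\<integral>\<^sup>+\<omega>. ennreal ((X \<omega>)\<^sup>2) \<partial>P) \<le> ennreal (4 * C * (t - s))"
    by (rule LIMSEQ_le_const2) (use bound_k in auto)
  show X2: "integrable P (\<lambda>\<omega>. (X \<omega>)\<^sup>2)"
  proof (rule integrableI_nonneg)
    show "(\<integral>\<^sup>+\<omega>. ennreal ((X \<omega>)\<^sup>2) \<partial>P) < \<infinity>" using fin by (rule le_less_trans) simp
  qed auto
  have "ennreal (expectation (\<lambda>\<omega>. (X \<omega>)\<^sup>2)) \<le> ennreal (4 * C * (t - s))"
    using fin nn_integral_eq_integral[OF X2] by simp
  then show "expectation (\<lambda>\<omega>. (X \<omega>)\<^sup>2) \<le> 4 * C * (t - s)"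
    using C st by (subst (asm) ennreal_le_iff) auto
  have X1: "integrable P X" by (rule square_integrable_imp_integrable[OF X X2])
  have "(\<lambda>k. expectation (\<lambda>\<omega>. \<eta>k k \<omega> * (I t \<omega> - I s \<omega>))) \<longlonglongrightarrow> expectation X"
  proof (rule integral_dominated_convergence)
    show "integrable P (\<lambda>\<omega>. \<bar>X \<omega>\<bar>)" using X1 by simp
    show "AE \<omega> in P. (\<lambda>k. \<eta>k k \<omega> * (I t \<omega> - I s \<omega>)) \<longlonglongrightarrow> X \<omega>"
    proof (rule AE_I2)
      fix \<omega> show "(\<lambda>k. \<eta>k k \<omega> * (I t \<omega> - I s \<omega>)) \<longlonglongrightarrow> X \<omega>"
        by (rule tendsto_eventually) (use ev[of \<omega>] in eventually_elim, simp add: X_def)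
    qed
    show "AE \<omega> in P. norm (\<eta>k k \<omega> * (I t \<omega> - I s \<omega>)) \<le> \<bar>X \<omega>\<bar>" for k
      using le by (intro AE_I2) (auto simp: X_def abs_mult intro!: mult_right_mono)
  qed auto
  moreover have "expectation (\<lambda>\<omega>. \<eta>k k \<omega> * (I t \<omega> - I s \<omega>)) = 0" for k
    by (rule weighted_ito_increment_bounded(2)[OF ito st \<eta>k])
  ultimately show "expectation X = 0" using LIMSEQ_unique[OF _ tendsto_const] by simp
qed

end

section \<open>The score at the true parameter\<close>

lemma linf_mult_right: "linf d (\<lambda>j. v j * c) = linf d v * \<bar>c\<bar>"
proof (rule antisym)
  show "linf d (\<lambda>j. v j * c) \<le> linf d v * \<bar>c\<bar>"
    by (simp add: linf_le_iff linf_nonneg abs_mult abs_le_linf mult_right_mono)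
  show "linf d v * \<bar>c\<bar> \<le> linf d (\<lambda>j. v j * c)"
  proof (cases "c = 0")
    case False
    have "\<forall>j<d. \<bar>v j\<bar> \<le> linf d (\<lambda>j. v j * c) / \<bar>c\<bar>"
      using False abs_le_linf[of _ d "\<lambda>j. v j * c"] by (simp add: pos_le_divide_eq abs_mult)
    moreover have "0 \<le> linf d (\<lambda>j. v j * c) / \<bar>c\<bar>" by (simp add: linf_nonneg)
    ultimately have "linf d v \<le> linf d (\<lambda>j. v j * c) / \<bar>c\<bar>" using linf_le_iff by blast
    then show ?thesis using False by (simp add: pos_le_divide_eq)
  qed (simp add: linf_nonneg)
qed

lemma powr_quarter_le_imp: "0 \<le> x \<Longrightarrow> x powr (1/4) \<le> K \<Longrightarrow> x \<le> K ^ 4" for x K :: real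
proof -
  assume x: "0 \<le> x" and le: "x powr (1/4) \<le> K"
  have "x = (x powr (1/4)) ^ 4"
    using x by (cases "x = 0") (simp_all add: powr_realpow[symmetric] powr_powr)
  also have "\<dots> \<le> K ^ 4" using le by (intro power_mono) auto
  finally show ?thesis .
qed

text \<open>One sample size, with the constants K_p and D_2 frozen to the reals \<open>K\<close> and
  \<open>D2\<close>. The limit in n is taken only in the final theorem, so all bounds proved here
  have explicit constants.\<close>

locale score_setting =
  fixes M :: "('a, 'h::metric_space) model" and n :: nat and \<Delta> L K D2 :: real
  assumes model: "diffusion_model M" and n: "n \<ge> 1" and mesh: "\<Delta> > 0" and L: "L > 0"
    and lipschitz: "\<And>x1 x2 z1 z2. z1 \<in> Rvec (dim2 M) \<Longrightarrow> z2 \<in> Rvec (dim2 M) \<Longrightarrow>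
        \<bar>drift M (yvec M x1 z1) (theta0 M) - drift M (yvec M x2 z2) (theta0 M)\<bar>
          \<le> L * real (sparsity M) * (\<bar>x1 - x2\<bar> + linf (dim2 M) (\<lambda>j. z1 j - z2 j))"
    and smooth: "\<And>y. y \<in> Rvec (pdim M) \<Longrightarrow>
        \<exists>U. openin (top_of_set (Rvec (pdim M))) U \<and> Param M \<subseteq> U \<and> C2_on (pdim M) U (drift M y)"
    and K: "K > 0"
    and grad_moment: "\<And>t. t \<ge> 0 \<Longrightarrow>
        integrable (Prob M) (\<lambda>\<omega>. linf (pdim M) (\<lambda>j. partial_deriv j (drift M (Yproc M t \<omega>)) (theta0 M)) ^ 4) \<and>
        (\<integral>\<omega>. linf (pdim M) (\<lambda>j. partial_deriv j (drift M (Yproc M t \<omega>)) (theta0 M)) ^ 4 \<partial>Prob M) powr (1/4) \<le> K"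
    and sigma_moment: "\<And>t. t \<ge> 0 \<Longrightarrow>
        integrable (Prob M) (\<lambda>\<omega>. \<bar>sigma_coef M (Yproc M t \<omega>) (h_true M)\<bar> ^ 4) \<and>
        (\<integral>\<omega>. \<bar>sigma_coef M (Yproc M t \<omega>) (h_true M)\<bar> ^ 4 \<partial>Prob M) powr (1/4) \<le> K"
    and D2: "D2 > 0"
    and increments_measurable: "\<And>i. i \<in> {1..n} \<Longrightarrow>
        (\<lambda>\<omega>. SUP t\<in>{real (i - 1) * \<Delta>..real i * \<Delta>}.
            ennreal (\<bar>Xproc M t \<omega> - Xproc M (real (i - 1) * \<Delta>) \<omega>\<bar> ^ 2)) \<in> borel_measurable (Prob M) \<and>
        (\<lambda>\<omega>. SUP t\<in>{real (i - 1) * \<Delta>..real i * \<Delta>}.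
            ennreal (linf (dim2 M) (\<lambda>j. Zproc M t \<omega> j - Zproc M (real (i - 1) * \<Delta>) \<omega> j) ^ 2))
          \<in> borel_measurable (Prob M)"
    and increments_moment: "\<And>i. i \<in> {1..n} \<Longrightarrow>
        (\<integral>\<^sup>+\<omega>. (SUP t\<in>{real (i - 1) * \<Delta>..real i * \<Delta>}.
            ennreal (\<bar>Xproc M t \<omega> - Xproc M (real (i - 1) * \<Delta>) \<omega>\<bar> ^ 2)) \<partial>Prob M) +
        (\<integral>\<^sup>+\<omega>. (SUP t\<in>{real (i - 1) * \<Delta>..real i * \<Delta>}.
            ennreal (linf (dim2 M) (\<lambda>j. Zproc M t \<omega> j - Zproc M (real (i - 1) * \<Delta>) \<omega> j) ^ 2)) \<partial>Prob M)
        \<le> ennreal (D2 * \<Delta>)"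

sublocale score_setting \<subseteq> brownian_space "Prob M" "Filt M" "Wproc M"
  by unfold_locales (use model in \<open>auto simp: diffusion_model_def\<close>)

context score_setting
begin

abbreviation "P \<equiv> Prob M"
abbreviation "F \<equiv> Filt M"
abbreviation "p \<equiv> pdim M"

definition S :: "real \<Rightarrow> 'a \<Rightarrow> real" where
  "S r \<omega> = drift M (Yproc M r \<omega>) (theta0 M)"

definition grad :: "nat \<Rightarrow> 'a \<Rightarrow> nat \<Rightarrow> real" where
  "grad k \<omega> j = partial_deriv j (drift M (Yproc M (real k * \<Delta>) \<omega>)) (theta0 M)"

section \<open>Measurability and moments of the coefficients\<close>

lemma X_measurable: "0 \<le> t \<Longrightarrow> Xproc M t \<in> borel_measurable (F t)"
  using model unfolding diffusion_model_def by blast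

lemma Z_measurable: "0 \<le> t \<Longrightarrow> Zproc M t \<in> measurable (F t) (borel_vec (dim2 M))"
  using model unfolding diffusion_model_def by blast

lemma Z_in_Rvec: "0 \<le> t \<Longrightarrow> \<omega> \<in> space P \<Longrightarrow> Zproc M t \<omega> \<in> Rvec (dim2 M)"
  using measurable_space[OF Z_measurable, of t \<omega>] space_F[of t]
  by (simp add: borel_vec_def Rvec_def space_PiM)

lemma Y_component_measurable:
  assumes t: "0 \<le> t" and j: "j < p"
  shows "(\<lambda>\<omega>. Yproc M t \<omega> j) \<in> borel_measurable (F t)"
proof (cases "j < dim1 M")
  case True
  have "phi_map M \<in> measurable borel (borel_vec (dim1 M))"
    using model unfolding diffusion_model_def by blast
  from measurable_compose[OF measurable_compose[OF X_measurable[OF t] this], of "\<lambda>f. f j" borel]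
  show ?thesis using True j
    by (simp add: Yproc_def yvec_def vjoin_def pdim_def borel_vec_def measurable_component_singleton)
next
  case False
  then have "j - dim1 M < dim2 M" using j by (simp add: pdim_def)
  with measurable_compose[OF Z_measurable[OF t], of "\<lambda>f. f (j - dim1 M)" borel]
  show ?thesis using False j
    by (simp add: Yproc_def yvec_def vjoin_def pdim_def borel_vec_def measurable_component_singleton)
qed

lemma drift_measurable:
  assumes t: "0 \<le> t"
  shows "(\<lambda>\<omega>. drift M (Yproc M t \<omega>) \<theta>) \<in> borel_measurable (F t)"
proof -
  have St: "(\<lambda>(a, b). S_tilde M a b) \<in> borel_measurable (borel \<Otimes>\<^sub>M borel)"
    using model unfolding diffusion_model_def by blast
  have "(\<lambda>\<omega>. (\<Sum>j<dim1 M. \<theta> j * Yproc M t \<omega> j, \<Sum>j=dim1 M..<p. \<theta> j * Yproc M t \<omega> j))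
      \<in> measurable (F t) (borel \<Otimes>\<^sub>M borel)"
    using Y_component_measurable[OF t]
    by (intro measurable_Pair borel_measurable_sum borel_measurable_times) (auto simp: pdim_def)
  from measurable_compose[OF this St] show ?thesis by (simp add: drift_def)
qed

lemma theta0_in_Param: "theta0 M \<in> Param M"
  using model unfolding diffusion_model_def by blast

text \<open>A partial derivative is a limit of difference quotients along 1 / (m + 1). The shifted
  parameter may leave \<open>Param M\<close>, but the drift is measurable in \<open>\<omega>\<close>
  for every parameter.\<close>

lemma grad_measurable:
  assumes j: "j < p"
  shows "(\<lambda>\<omega>. grad k \<omega> j) \<in> borel_measurable (F (real k * \<Delta>))"
proof -
  let ?t = "real k * \<Delta>"
  have t: "0 \<le> ?t" using mesh by simp
  let ?f = "\<lambda>m \<omega>. (drift M (Yproc M ?t \<omega>) ((theta0 M)(j := theta0 M j + inverse (real (Suc m)))) - drift M (Yproc M ?t \<omega>) (theta0 M)) / inverse (real (Suc m))"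
  show ?thesis
  proof (rule borel_measurable_LIMSEQ_real)
    show "?f m \<in> borel_measurable (F ?t)" for m
      using drift_measurable[OF t] by (intro borel_measurable_divide borel_measurable_diff) auto
    show "(\<lambda>m. ?f m \<omega>) \<longlonglongrightarrow> grad k \<omega> j" for \<omega>
    proof -
      obtain U where U: "Param M \<subseteq> U" "C2_on p U (drift M (Yproc M ?t \<omega>))"
        using smooth[OF Yproc_in_Rvec] by blast
      then have "((\<lambda>x. drift M (Yproc M ?t \<omega>) ((theta0 M)(j := x))) has_real_derivative grad k \<omega> j) (at (theta0 M j))"
        unfolding grad_def using j theta0_in_Param by (intro C1_on_has_partial_deriv[of p U]) (auto simp: C2_on_def)
      then have "((\<lambda>h. (drift M (Yproc M ?t \<omega>) ((theta0 M)(j := theta0 M j + h)) - drift M (Yproc M ?t \<omega>) (theta0 M)) / h) \<longlongrightarrow> grad k \<omega> j) (at 0)"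
        by (simp add: DERIV_def)
      moreover have "filterlim (\<lambda>m. inverse (real (Suc m))) (at 0) sequentially"
        unfolding filterlim_at using LIMSEQ_inverse_real_of_nat by simp
      ultimately show ?thesis by (rule filterlim_compose)
    qed
  qed
qed

lemma linf_grad_measurable: "(\<lambda>\<omega>. linf p (grad k \<omega>)) \<in> borel_measurable (F (real k * \<Delta>))"
  by (intro borel_measurable_linf grad_measurable)

lemma linf_grad_moment:
  "integrable P (\<lambda>\<omega>. linf p (grad k \<omega>) ^ 4)" "expectation (\<lambda>\<omega>. linf p (grad k \<omega>) ^ 4) \<le> K ^ 4"
proof -
  have m: "integrable P (\<lambda>\<omega>. linf p (grad k \<omega>) ^ 4) \<and> (expectation (\<lambda>\<omega>. linf p (grad k \<omega>) ^ 4)) powr (1/4) \<le> K"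
    unfolding grad_def by (rule grad_moment) (use mesh in simp)
  then show "integrable P (\<lambda>\<omega>. linf p (grad k \<omega>) ^ 4)" ..
  show "expectation (\<lambda>\<omega>. linf p (grad k \<omega>) ^ 4) \<le> K ^ 4"
    by (rule powr_quarter_le_imp[OF _ conjunct2[OF m]]) (simp add: linf_nonneg)
qed

text \<open>Gradient and diffusion coefficient are taken at different times, and only their separate
  fourth moments are known. The inequality 2 x y \<le> x^2 + y^2, applied to their squares, splits
  the product accordingly.\<close>

lemma weighted_sigma_moment:
  assumes r: "0 \<le> r" and \<eta>: "\<And>\<omega>. \<bar>\<eta> \<omega>\<bar> \<le> linf p (grad k \<omega>)"
  shows "(\<integral>\<^sup>+\<omega>. ennreal ((\<eta> \<omega> * sigma_coef M (Yproc M r \<omega>) (h_true M))\<^sup>2) \<partial>P) \<le> ennreal (K ^ 4)"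
proof -
  let ?\<sigma> = "\<lambda>\<omega>. sigma_coef M (Yproc M r \<omega>) (h_true M)"
  have s: "integrable P (\<lambda>\<omega>. \<bar>?\<sigma> \<omega>\<bar> ^ 4)" "expectation (\<lambda>\<omega>. \<bar>?\<sigma> \<omega>\<bar> ^ 4) \<le> K ^ 4"
    using sigma_moment[OF r] by (auto intro!: powr_quarter_le_imp)
  have int: "integrable P (\<lambda>\<omega>. (linf p (grad k \<omega>) ^ 4 + \<bar>?\<sigma> \<omega>\<bar> ^ 4) / 2)"
    using s linf_grad_moment[of k] by simp
  have "(\<integral>\<^sup>+\<omega>. ennreal ((\<eta> \<omega> * ?\<sigma> \<omega>)\<^sup>2) \<partial>P) \<le> (\<integral>\<^sup>+\<omega>. ennreal ((linf p (grad k \<omega>) ^ 4 + \<bar>?\<sigma> \<omega>\<bar> ^ 4) / 2) \<partial>P)"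
  proof (intro nn_integral_mono ennreal_leI)
    fix \<omega>
    have "(\<eta> \<omega> * ?\<sigma> \<omega>)\<^sup>2 \<le> (linf p (grad k \<omega>))\<^sup>2 * (\<bar>?\<sigma> \<omega>\<bar>)\<^sup>2"
      unfolding power_mult_distrib using power_mono[OF \<eta>[of \<omega>], of 2] by (intro mult_mono) auto
    also have "\<dots> \<le> (linf p (grad k \<omega>) ^ 4 + \<bar>?\<sigma> \<omega>\<bar> ^ 4) / 2"
      using sum_squares_bound[of "(linf p (grad k \<omega>))\<^sup>2" "(\<bar>?\<sigma> \<omega>\<bar>)\<^sup>2"] by (simp add: power_even_abs)
    finally show "(\<eta> \<omega> * ?\<sigma> \<omega>)\<^sup>2 \<le> (linf p (grad k \<omega>) ^ 4 + \<bar>?\<sigma> \<omega>\<bar> ^ 4) / 2" .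
  qed
  also have "\<dots> = ennreal (expectation (\<lambda>\<omega>. (linf p (grad k \<omega>) ^ 4 + \<bar>?\<sigma> \<omega>\<bar> ^ 4) / 2))"
    by (intro nn_integral_eq_integral[OF int]) (auto simp: linf_nonneg)
  also have "\<dots> \<le> ennreal (K ^ 4)"
  proof (rule ennreal_leI)
    have "expectation (\<lambda>\<omega>. (linf p (grad k \<omega>) ^ 4 + \<bar>?\<sigma> \<omega>\<bar> ^ 4) / 2)
        = (expectation (\<lambda>\<omega>. linf p (grad k \<omega>) ^ 4) + expectation (\<lambda>\<omega>. \<bar>?\<sigma> \<omega>\<bar> ^ 4)) / 2"
      using s linf_grad_moment[of k] by simp
    then show "expectation (\<lambda>\<omega>. (linf p (grad k \<omega>) ^ 4 + \<bar>?\<sigma> \<omega>\<bar> ^ 4) / 2) \<le> K ^ 4"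
      using s linf_grad_moment[of k] by simp
  qed
  finally show ?thesis .
qed

text \<open>The Ito integral itself is only measurable with respect to \<open>P\<close>; its modification
  \<open>noise\<close> is adapted.\<close>

definition noise :: "real \<Rightarrow> 'a \<Rightarrow> real" where
  "noise t \<omega> = Xproc M t \<omega> - Xproc M 0 \<omega> - (LINT r:{0..t}|lborel. S r \<omega>)"

lemma noise_measurable:
  assumes t: "0 \<le> t"
  shows "noise t \<in> borel_measurable (F t)"
proof -
  have prog: "progressive F S"
    using model unfolding diffusion_model_def S_def[abs_def] by blast
  have "(\<lambda>x. indicator {0..t} (snd x) * S (snd x) (fst x)) \<in> borel_measurable (F t \<Otimes>\<^sub>M lborel)"
    by (rule progressive_measurable[OF prog t]) simp
  then have "(\<lambda>\<omega>. \<integral>r. indicator {0..t} r * S r \<omega> \<partial>lborel) \<in> borel_measurable (F t)"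
    by (intro lborel.borel_measurable_lebesgue_integral) (simp add: case_prod_beta')
  then show ?thesis
    unfolding noise_def[abs_def] set_lebesgue_integral_def
    using X_measurable[OF t] measurable_F_mono[OF X_measurable[of 0], of t] t by simp
qed

lemma noise_ito:
  obtains I where "ito_integral P F (Wproc M) (\<lambda>r \<omega>. sigma_coef M (Yproc M r \<omega>) (h_true M)) I"
    "AE \<omega> in P. \<forall>t\<ge>0. set_integrable lborel {0..t} (\<lambda>r. S r \<omega>) \<and> noise t \<omega> = I t \<omega>"
proof -
  have "\<exists>I. ito_integral P F (Wproc M) (\<lambda>r \<omega>. sigma_coef M (Yproc M r \<omega>) (h_true M)) I \<and>
    (AE \<omega> in P. \<forall>t\<ge>0. set_integrable lborel {0..t} (\<lambda>r. S r \<omega>) \<and>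
           Xproc M t \<omega> = Xproc M 0 \<omega> + (LINT r:{0..t}|lborel. S r \<omega>) + I t \<omega>)"
    using model unfolding diffusion_model_def S_def by (elim conjE)
  then obtain I where I: "ito_integral P F (Wproc M) (\<lambda>r \<omega>. sigma_coef M (Yproc M r \<omega>) (h_true M)) I"
    "AE \<omega> in P. \<forall>t\<ge>0. set_integrable lborel {0..t} (\<lambda>r. S r \<omega>) \<and>
           Xproc M t \<omega> = Xproc M 0 \<omega> + (LINT r:{0..t}|lborel. S r \<omega>) + I t \<omega>"
    by (elim exE conjE)
  from I(2) have "AE \<omega> in P. \<forall>t\<ge>0. set_integrable lborel {0..t} (\<lambda>r. S r \<omega>) \<and> noise t \<omega> = I t \<omega>"
  proof eventually_elim
    case (elim \<omega>)
    show ?case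
    proof (intro allI impI)
      fix t :: real assume "0 \<le> t"
      with elim have "set_integrable lborel {0..t} (\<lambda>r. S r \<omega>)"
        "Xproc M t \<omega> = Xproc M 0 \<omega> + (LINT r:{0..t}|lborel. S r \<omega>) + I t \<omega>" by blast+
      then show "set_integrable lborel {0..t} (\<lambda>r. S r \<omega>) \<and> noise t \<omega> = I t \<omega>"
        unfolding noise_def by linarith
    qed
  qed
  with I(1) show ?thesis by (rule that)
qed

lemma S_integrable: "AE \<omega> in P. \<forall>t\<ge>0. set_integrable lborel {0..t} (\<lambda>r. S r \<omega>)"
proof (rule noise_ito)
  fix I assume "AE \<omega> in P. \<forall>t\<ge>0. set_integrable lborel {0..t} (\<lambda>r. S r \<omega>) \<and> noise t \<omega> = I t \<omega>"
  then show ?thesis by eventually_elim blast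
qed

text \<open>The domination premise covers both weights that occur: the maximum norm of the gradient,
  for the second moments, and one gradient coordinate times a factor bounded by 1, for the
  orthogonality.\<close>

lemma weighted_noise_increment:
  assumes \<eta>: "\<eta> \<in> borel_measurable (F (real k * \<Delta>))" "\<And>\<omega>. \<bar>\<eta> \<omega>\<bar> \<le> linf p (grad k \<omega>)"
  defines "X \<equiv> \<lambda>\<omega>. \<eta> \<omega> * (noise (real (Suc k) * \<Delta>) \<omega> - noise (real k * \<Delta>) \<omega>)"
  shows "integrable P (\<lambda>\<omega>. (X \<omega>)\<^sup>2)" "expectation (\<lambda>\<omega>. (X \<omega>)\<^sup>2) \<le> 4 * K ^ 4 * \<Delta>" "expectation X = 0"
proof -
  let ?s = "real k * \<Delta>" and ?t = "real (Suc k) * \<Delta>"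
  have st: "0 \<le> ?s" "?s \<le> ?t" using mesh by (auto intro!: mult_right_mono)
  obtain I where I: "ito_integral P F (Wproc M) (\<lambda>r \<omega>. sigma_coef M (Yproc M r \<omega>) (h_true M)) I"
    "AE \<omega> in P. \<forall>t\<ge>0. set_integrable lborel {0..t} (\<lambda>r. S r \<omega>) \<and> noise t \<omega> = I t \<omega>" by (rule noise_ito)
  let ?X = "\<lambda>\<omega>. \<eta> \<omega> * (I ?t \<omega> - I ?s \<omega>)"
  have eq: "AE \<omega> in P. X \<omega> = ?X \<omega>"
    using I(2) by eventually_elim (use st in \<open>simp add: X_def\<close>)
  have [measurable]: "\<eta> \<in> borel_measurable P" "noise ?s \<in> borel_measurable P" "noise ?t \<in> borel_measurable P"
    using measurable_F_P[OF \<eta>(1)] measurable_F_P[OF noise_measurable[of ?s]] measurable_F_P[OF noise_measurable[of ?t]] st by auto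
  have [measurable]: "X \<in> borel_measurable P" unfolding X_def by measurable
  have [measurable]: "I ?s \<in> borel_measurable P" "I ?t \<in> borel_measurable P"
    using I(1) st unfolding ito_integral_def by auto
  have C: "0 \<le> K ^ 4" using K by simp
  have b: "(\<integral>\<^sup>+\<omega>. ennreal ((\<eta> \<omega> * sigma_coef M (Yproc M r \<omega>) (h_true M))\<^sup>2) \<partial>P) \<le> ennreal (K ^ 4)"
    if "r \<in> {?s..?t}" for r
    using that st by (intro weighted_sigma_moment[OF _ \<eta>(2)]) auto
  note w = weighted_ito_increment[OF I(1) st \<eta>(1) C b]
  have eq2: "AE \<omega> in P. (X \<omega>)\<^sup>2 = (?X \<omega>)\<^sup>2" using eq by eventually_elim simp
  have len: "?t - ?s = \<Delta>" by (simp add: algebra_simps)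
  show "integrable P (\<lambda>\<omega>. (X \<omega>)\<^sup>2)" by (subst integrable_cong_AE[OF _ _ eq2]) (use w(1) in \<open>auto simp del: of_nat_Suc\<close>)
  show "expectation (\<lambda>\<omega>. (X \<omega>)\<^sup>2) \<le> 4 * K ^ 4 * \<Delta>"
    by (subst integral_cong_AE[OF _ _ eq2]) (use w(2)[unfolded len] in \<open>auto simp del: of_nat_Suc\<close>)
  show "expectation X = 0" by (subst integral_cong_AE[OF _ _ eq]) (use w(3) in \<open>auto simp del: of_nat_Suc\<close>)
qed

text \<open>The martingale inequality on the grid filtration. The scalar noise increment factors out
  of the maximum norm, so each second moment is at most \<open>4 * K ^ 4 * \<Delta>\<close>.\<close>

lemma noise_score_expectation:
  assumes b: "b > 0" and p: "p > 0"
  defines "m \<equiv> \<lambda>\<omega>. linf p (\<lambda>j. \<Sum>k<n. grad k \<omega> j * (noise (real (Suc k) * \<Delta>) \<omega> - noise (real k * \<Delta>) \<omega>))"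
  shows "integrable P m" "expectation m \<le> ln (2 * real p) / b + 2 * b * K ^ 4 * (real n * \<Delta>)"
proof -
  let ?J = "\<lambda>k \<omega>. noise (real (Suc k) * \<Delta>) \<omega> - noise (real k * \<Delta>) \<omega>"
  let ?\<xi> = "\<lambda>k \<omega> j. grad k \<omega> j * ?J k \<omega>"
  have le: "real k * \<Delta> \<le> real (Suc k) * \<Delta>" for k using mesh by (intro mult_right_mono) auto
  have t0: "0 \<le> real k * \<Delta>" for k using mesh by simp
  have sq: "(linf p (?\<xi> k \<omega>))\<^sup>2 = (linf p (grad k \<omega>) * ?J k \<omega>)\<^sup>2" for k \<omega>
    unfolding linf_mult_right by (simp add: power_mult_distrib)
  note w = weighted_noise_increment[OF linf_grad_measurable, simplified abs_of_nonneg[OF linf_nonneg], OF order_refl]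
  have sub: "sets (F (real k * \<Delta>)) \<subseteq> sets (F (real (Suc k) * \<Delta>))" for k
    using filtered t0[of k] le[of k] unfolding filtered_prob_space_def by blast
  have adapted: "(\<lambda>\<omega>. ?\<xi> k \<omega> j) \<in> borel_measurable (F (real (Suc k) * \<Delta>))" if "j < p" for k j
    using measurable_F_mono[OF grad_measurable[OF that] t0 le] noise_measurable[OF t0]
      measurable_F_mono[OF noise_measurable[OF t0] t0 le] by (intro borel_measurable_times borel_measurable_diff)
  have orth: "expectation (\<lambda>\<omega>. v \<omega> * ?\<xi> k \<omega> j) = 0"
    if j: "j < p" and v: "v \<in> borel_measurable (F (real k * \<Delta>))" "\<And>\<omega>. \<bar>v \<omega>\<bar> \<le> 1" for k j v
  proof -
    have "expectation (\<lambda>\<omega>. (v \<omega> * grad k \<omega> j) * ?J k \<omega>) = 0"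
    proof (rule weighted_noise_increment(3))
      show "(\<lambda>\<omega>. v \<omega> * grad k \<omega> j) \<in> borel_measurable (F (real k * \<Delta>))"
        using v(1) grad_measurable[OF j] by simp
      show "\<bar>v \<omega> * grad k \<omega> j\<bar> \<le> linf p (grad k \<omega>)" for \<omega>
        unfolding abs_mult using mult_mono[OF v(2)[of \<omega>] abs_le_linf[OF j, of "grad k \<omega>"]] by simp
    qed
    then show ?thesis by (simp add: mult.assoc)
  qed
  have sq_int: "integrable P (\<lambda>\<omega>. (linf p (?\<xi> k \<omega>))\<^sup>2)" for k
    unfolding sq by (rule w(1))
  have sq_le: "expectation (\<lambda>\<omega>. (linf p (?\<xi> k \<omega>))\<^sup>2) \<le> 4 * K ^ 4 * \<Delta>" for k
    unfolding sq by (rule w(2))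
  note max = expectation_linf_martingale_sum[OF b p, of "\<lambda>k. F (real k * \<Delta>)" n ?\<xi>,
      OF subalg[OF t0] sub adapted sq_int orth]
  show "integrable P m" unfolding m_def by (rule max(1))
  have "expectation m \<le> ln (2 * real p) / b + b / 2 * (\<Sum>k<n. expectation (\<lambda>\<omega>. (linf p (?\<xi> k \<omega>))\<^sup>2))"
    unfolding m_def by (rule max(2))
  also have "\<dots> \<le> ln (2 * real p) / b + b / 2 * (\<Sum>k<n. 4 * K ^ 4 * \<Delta>)"
    using b sq_le by (intro add_left_mono mult_left_mono sum_mono) auto
  also have "\<dots> = ln (2 * real p) / b + 2 * b * K ^ 4 * (real n * \<Delta>)" by simp
  finally show "expectation m \<le> ln (2 * real p) / b + 2 * b * K ^ 4 * (real n * \<Delta>)" .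
qed

end

section \<open>Discretisation error of the drift\<close>

context score_setting
begin

text \<open>The half-open interval is disjoint from the preceding closed one, so the integrals from
  0 split exactly.\<close>

definition disc :: "nat \<Rightarrow> 'a \<Rightarrow> real" where
  "disc k \<omega> = (LINT r:{real k * \<Delta><..real (Suc k) * \<Delta>}|lborel. S r \<omega> - S (real k * \<Delta>) \<omega>)"

lemma increment_decomposition:
  assumes int: "\<forall>t\<ge>0. set_integrable lborel {0..t} (\<lambda>r. S r \<omega>)"
  shows "Xproc M (real (Suc k) * \<Delta>) \<omega> - Xproc M (real k * \<Delta>) \<omega> - S (real k * \<Delta>) \<omega> * \<Delta>
    = noise (real (Suc k) * \<Delta>) \<omega> - noise (real k * \<Delta>) \<omega> + disc k \<omega>"
proof -
  define a b c where "a = real k * \<Delta>" and "b = real (Suc k) * \<Delta>" and "c = S a \<omega>"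
  have ab: "0 \<le> a" "a \<le> b" "b - a = \<Delta>" using mesh by (auto simp: a_def b_def algebra_simps)
  have i0: "set_integrable lborel {0..b} (\<lambda>r. S r \<omega>)" using int ab by auto
  have i1: "set_integrable lborel {0..a} (\<lambda>r. S r \<omega>)" using int ab by auto
  have i2: "set_integrable lborel {a<..b} (\<lambda>r. S r \<omega>)"
    by (rule set_integrable_subset[OF i0]) (use ab in auto)
  have i3: "set_integrable lborel {a<..b} (\<lambda>r. c)"
    unfolding set_integrable_def using ab by simp
  have un: "{0..b} = {0..a} \<union> {a<..b}" using ab by auto
  have "(LINT r:{0..b}|lborel. S r \<omega>) = (LINT r:{0..a}|lborel. S r \<omega>) + (LINT r:{a<..b}|lborel. S r \<omega>)"
    unfolding un by (rule set_integral_Un[OF _ i1 i2]) auto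
  moreover have "disc k \<omega> = (LINT r:{a<..b}|lborel. S r \<omega>) - (LINT r:{a<..b}|lborel. c)"
    unfolding disc_def a_def[symmetric] b_def[symmetric] c_def[symmetric] by (rule set_integral_diff(2)[OF i2 i3])
  moreover have "(LINT r:{a<..b}|lborel. c) = c * \<Delta>"
    unfolding set_lebesgue_integral_def using ab by simp
  ultimately show ?thesis
    unfolding noise_def a_def[symmetric] b_def[symmetric] c_def[symmetric] by simp
qed

definition noise_score :: "'a \<Rightarrow> real" where
  "noise_score \<omega> = linf p (\<lambda>j. \<Sum>k<n. grad k \<omega> j * (noise (real (Suc k) * \<Delta>) \<omega> - noise (real k * \<Delta>) \<omega>))"

lemma linf_psi_le:
  assumes int: "\<forall>t\<ge>0. set_integrable lborel {0..t} (\<lambda>r. S r \<omega>)"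
  shows "linf p (psi M n \<Delta> \<omega> (theta0 M))
    \<le> 1 / (real n * \<Delta>) * (noise_score \<omega> + (\<Sum>k<n. linf p (grad k \<omega>) * \<bar>disc k \<omega>\<bar>))"
    (is "_ \<le> ?c * (_ + ?D)")
proof -
  have c: "?c \<ge> 0" using mesh by simp
  let ?N = "\<lambda>j. \<Sum>k<n. grad k \<omega> j * (noise (real (Suc k) * \<Delta>) \<omega> - noise (real k * \<Delta>) \<omega>)"
  have "\<bar>psi M n \<Delta> \<omega> (theta0 M) j\<bar> \<le> ?c * (noise_score \<omega> + ?D)" if j: "j < p" for j
  proof -
    \<comment> \<open>In \<open>psi\<close> the summands are counted from 1 and evaluated at the
      left end point \<open>k - 1\<close>; after the shift \<open>k\<close> itself is the left end
      point.\<close>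
    have "psi M n \<Delta> \<omega> (theta0 M) j
        = ?c * (\<Sum>k<n. grad k \<omega> j * (noise (real (Suc k) * \<Delta>) \<omega> - noise (real k * \<Delta>) \<omega> + disc k \<omega>))"
      unfolding psi_def increment_decomposition[OF int, symmetric] One_nat_def sum.atLeast1_atMost_eq
      by (simp add: grad_def S_def)
    also have "\<dots> = ?c * (?N j + (\<Sum>k<n. grad k \<omega> j * disc k \<omega>))"
      by (simp only: distrib_left sum.distrib)
    finally have eq: "psi M n \<Delta> \<omega> (theta0 M) j = ?c * (?N j + (\<Sum>k<n. grad k \<omega> j * disc k \<omega>))" .
    have "\<bar>psi M n \<Delta> \<omega> (theta0 M) j\<bar> \<le> ?c * (\<bar>?N j\<bar> + (\<Sum>k<n. \<bar>grad k \<omega> j * disc k \<omega>\<bar>))"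
    proof -
      have "\<bar>?N j + (\<Sum>k<n. grad k \<omega> j * disc k \<omega>)\<bar> \<le> \<bar>?N j\<bar> + (\<Sum>k<n. \<bar>grad k \<omega> j * disc k \<omega>\<bar>)"
        using sum_abs[of "\<lambda>k. grad k \<omega> j * disc k \<omega>" "{..<n}"] by linarith
      then show ?thesis unfolding eq abs_mult[of ?c] abs_of_nonneg[OF c] by (rule mult_left_mono[OF _ c])
    qed
    also have "\<dots> \<le> ?c * (noise_score \<omega> + ?D)"
      unfolding noise_score_def using abs_le_linf[OF j, of ?N] abs_le_linf[OF j] c
      by (intro mult_left_mono add_mono sum_mono) (auto simp: abs_mult intro!: mult_right_mono)
    finally show ?thesis .
  qed
  moreover have "0 \<le> ?c * (noise_score \<omega> + ?D)"
    using c by (intro mult_nonneg_nonneg add_nonneg_nonneg sum_nonneg) (auto simp: noise_score_def linf_nonneg)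
  ultimately show ?thesis by (simp only: linf_le_iff) blast
qed

text \<open>Extended values are kept because the supremum may be infinite on exceptional
  paths.\<close>

definition supX :: "nat \<Rightarrow> 'a \<Rightarrow> ennreal" where
  "supX k \<omega> = (SUP t\<in>{real k * \<Delta>..real (Suc k) * \<Delta>}. ennreal (\<bar>Xproc M t \<omega> - Xproc M (real k * \<Delta>) \<omega>\<bar> ^ 2))"

definition supZ :: "nat \<Rightarrow> 'a \<Rightarrow> ennreal" where
  "supZ k \<omega> = (SUP t\<in>{real k * \<Delta>..real (Suc k) * \<Delta>}.
     ennreal (linf (dim2 M) (\<lambda>j. Zproc M t \<omega> j - Zproc M (real k * \<Delta>) \<omega> j) ^ 2))"

lemma sup_measurable: "k < n \<Longrightarrow> supX k \<in> borel_measurable P" "k < n \<Longrightarrow> supZ k \<in> borel_measurable P"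
  using increments_measurable[of "Suc k"] by (auto simp: supX_def[abs_def] supZ_def[abs_def] simp del: of_nat_Suc)

lemma sup_moment: "k < n \<Longrightarrow> (\<integral>\<^sup>+\<omega>. supX k \<omega> \<partial>P) + (\<integral>\<^sup>+\<omega>. supZ k \<omega> \<partial>P) \<le> ennreal (D2 * \<Delta>)"
  using increments_moment[of "Suc k"] by (simp add: supX_def supZ_def del: of_nat_Suc)

text \<open>The weight \<open>q\<close> is that of the AM-GM inequality separating the gradient from the increments.\<close>

definition env :: "real \<Rightarrow> nat \<Rightarrow> 'a \<Rightarrow> ennreal" where
  "env q k \<omega> = ennreal (L * real (sparsity M)) *
     (ennreal (q / 2) * ennreal ((linf p (grad k \<omega>))\<^sup>2) + ennreal (1 / q) * (supX k \<omega> + supZ k \<omega>))"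

text \<open>The Lipschitz condition bounds the integrand at each time by the suprema over the whole
  step. The resulting envelope is constant in time, so integrating it over the step only multiplies
  it by the mesh.\<close>

lemma weighted_disc_le:
  assumes int: "\<forall>t\<ge>0. set_integrable lborel {0..t} (\<lambda>r. S r \<omega>)" and \<omega>: "\<omega> \<in> space P" and q: "q > 0"
  shows "ennreal (linf p (grad k \<omega>) * \<bar>disc k \<omega>\<bar>) \<le> ennreal \<Delta> * env q k \<omega>"
proof -
  define a b where "a = real k * \<Delta>" and "b = real (Suc k) * \<Delta>"
  have ab: "0 \<le> a" "a \<le> b" "b - a = \<Delta>" using mesh by (auto simp: a_def b_def algebra_simps)
  let ?e = "linf p (grad k \<omega>)"
  let ?f = "\<lambda>r. indicator {a<..b} r *\<^sub>R (S r \<omega> - S a \<omega>)"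
  have e: "?e \<ge> 0" by (rule linf_nonneg)
  have i0: "set_integrable lborel {0..b} (\<lambda>r. S r \<omega>)" using int ab by auto
  have i1: "set_integrable lborel {a<..b} (\<lambda>r. S r \<omega>)"
    by (rule set_integrable_subset[OF i0]) (use ab in auto)
  have i2: "set_integrable lborel {a<..b} (\<lambda>r. S a \<omega>)"
    unfolding set_integrable_def using ab by simp
  have f_int: "integrable lborel ?f"
    using set_integral_diff(1)[OF i1 i2] unfolding set_integrable_def .
  have pointwise: "ennreal ?e * ennreal (norm (?f r)) \<le> env q k \<omega> * indicator {a<..b} r" for r
  proof (cases "r \<in> {a<..b}")
    case True
    then have r: "0 \<le> r" "r \<in> {a..b}" using ab by auto
    define x where "x = \<bar>Xproc M r \<omega> - Xproc M a \<omega>\<bar>"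
    define z where "z = linf (dim2 M) (\<lambda>j. Zproc M r \<omega> j - Zproc M a \<omega> j)"
    have xz: "x \<ge> 0" "z \<ge> 0" by (auto simp: x_def z_def linf_nonneg)
    have "\<bar>S r \<omega> - S a \<omega>\<bar> \<le> L * real (sparsity M) * (x + z)"
      unfolding S_def Yproc_def x_def z_def
      by (rule lipschitz) (use r ab \<omega> Z_in_Rvec in auto)
    then have "?e * \<bar>S r \<omega> - S a \<omega>\<bar> \<le> ?e * (L * real (sparsity M) * (x + z))"
      using e by (rule mult_left_mono)
    also have "\<dots> = L * real (sparsity M) * (?e * (x + z))" by simp
    \<comment> \<open>This is 2 (q e) (x + z) \<le> (q e)^2 + (x + z)^2, with (x + z)^2 bounded by 2
      x^2 + 2 z^2, divided by 2 q.\<close>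
    also have "\<dots> \<le> L * real (sparsity M) * (q / 2 * ?e\<^sup>2 + 1 / q * (x\<^sup>2 + z\<^sup>2))"
    proof (rule mult_left_mono)
      have "2 * ((q * ?e) * (x + z)) \<le> (q * ?e)\<^sup>2 + (x + z)\<^sup>2" by (rule order_trans[OF _ sum_squares_bound]) simp
      also have "(x + z)\<^sup>2 \<le> 2 * x\<^sup>2 + 2 * z\<^sup>2" by (rule power2_add_le)
      finally have le: "2 * ((q * ?e) * (x + z)) \<le> (q * ?e)\<^sup>2 + (2 * x\<^sup>2 + 2 * z\<^sup>2)" by simp
      have "q * (q / 2 * ?e\<^sup>2 + 1 / q * (x\<^sup>2 + z\<^sup>2)) = (q * ?e)\<^sup>2 / 2 + (x\<^sup>2 + z\<^sup>2)"
        using q by (simp add: distrib_left power2_eq_square)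
      with le have "q * (?e * (x + z)) \<le> q * (q / 2 * ?e\<^sup>2 + 1 / q * (x\<^sup>2 + z\<^sup>2))"
        by (simp add: mult.assoc)
      then show "?e * (x + z) \<le> q / 2 * ?e\<^sup>2 + 1 / q * (x\<^sup>2 + z\<^sup>2)" using q by simp
      show "0 \<le> L * real (sparsity M)" using L by simp
    qed
    finally have "ennreal (?e * \<bar>S r \<omega> - S a \<omega>\<bar>) \<le> ennreal (L * real (sparsity M) * (q / 2 * ?e\<^sup>2 + 1 / q * (x\<^sup>2 + z\<^sup>2)))"
      by (rule ennreal_leI)
    also have "\<dots> = ennreal (L * real (sparsity M)) * (ennreal (q / 2) * ennreal (?e\<^sup>2) + ennreal (1 / q) * (ennreal (x\<^sup>2) + ennreal (z\<^sup>2)))"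
      using q L by (simp add: ennreal_mult[symmetric] ennreal_plus[symmetric] del: ennreal_plus)
    also have "\<dots> \<le> env q k \<omega>"
      unfolding env_def supX_def supZ_def a_def[symmetric] b_def[symmetric] x_def z_def
      using r by (intro mult_left_mono add_mono order_refl SUP_upper2[of r]) auto
    finally show ?thesis using True e by (simp add: ennreal_mult)
  qed simp
  have "ennreal (?e * \<bar>disc k \<omega>\<bar>) = ennreal ?e * ennreal (norm (integral\<^sup>L lborel ?f))"
    unfolding disc_def a_def[symmetric] b_def[symmetric] set_lebesgue_integral_def using e by (simp add: ennreal_mult)
  also have "\<dots> \<le> ennreal ?e * (\<integral>\<^sup>+r. ennreal (norm (?f r)) \<partial>lborel)"
    by (intro mult_left_mono integral_norm_bound_ennreal f_int) auto
  also have "\<dots> = (\<integral>\<^sup>+r. ennreal ?e * ennreal (norm (?f r)) \<partial>lborel)"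
    using borel_measurable_integrable[OF f_int] by (intro nn_integral_cmult[symmetric]) simp
  also have "\<dots> \<le> (\<integral>\<^sup>+r. env q k \<omega> * indicator {a<..b} r \<partial>lborel)"
    by (rule nn_integral_mono[OF pointwise])
  also have "\<dots> = ennreal \<Delta> * env q k \<omega>"
    using ab by (subst nn_integral_cmult_indicator) (simp_all add: mult.commute)
  finally show ?thesis .
qed

text \<open>Jensen's inequality in AM-GM form: 2 K^2 e^2 \<le> K^4 + e^4. Dividing by 2 K^2 and
  using the fourth-moment bound K^4 gives the sharp constant.\<close>

lemma grad_second_moment: "(\<integral>\<^sup>+\<omega>. ennreal ((linf p (grad k \<omega>))\<^sup>2) \<partial>P) \<le> ennreal (K\<^sup>2)"
proof -
  let ?e = "\<lambda>\<omega>. linf p (grad k \<omega>)"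
  have int: "integrable P (\<lambda>\<omega>. (K\<^sup>2 + ?e \<omega> ^ 4 / K\<^sup>2) / 2)" using linf_grad_moment[of k] by simp
  have "(\<integral>\<^sup>+\<omega>. ennreal ((?e \<omega>)\<^sup>2) \<partial>P) \<le> (\<integral>\<^sup>+\<omega>. ennreal ((K\<^sup>2 + ?e \<omega> ^ 4 / K\<^sup>2) / 2) \<partial>P)"
  proof (intro nn_integral_mono ennreal_leI)
    fix \<omega>
    have "2 * K\<^sup>2 * (?e \<omega>)\<^sup>2 \<le> (K\<^sup>2)\<^sup>2 + ((?e \<omega>)\<^sup>2)\<^sup>2" by (rule sum_squares_bound)
    then show "(?e \<omega>)\<^sup>2 \<le> (K\<^sup>2 + ?e \<omega> ^ 4 / K\<^sup>2) / 2" using K by (simp add: field_simps power2_eq_square eval_nat_numeral)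
  qed
  also have "\<dots> = ennreal (expectation (\<lambda>\<omega>. (K\<^sup>2 + ?e \<omega> ^ 4 / K\<^sup>2) / 2))"
    by (intro nn_integral_eq_integral[OF int]) (auto simp: linf_nonneg)
  also have "\<dots> \<le> ennreal (K\<^sup>2)"
  proof (rule ennreal_leI)
    have "expectation (\<lambda>\<omega>. (K\<^sup>2 + ?e \<omega> ^ 4 / K\<^sup>2) / 2) = (K\<^sup>2 + expectation (\<lambda>\<omega>. ?e \<omega> ^ 4) / K\<^sup>2) / 2"
      using linf_grad_moment[of k] by (simp add: prob_space)
    also have "\<dots> \<le> (K\<^sup>2 + K ^ 4 / K\<^sup>2) / 2"
      using linf_grad_moment[of k] by (intro divide_right_mono add_left_mono) auto
    also have "\<dots> = K\<^sup>2" using K by (simp add: field_simps eval_nat_numeral)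
    finally show "expectation (\<lambda>\<omega>. (K\<^sup>2 + ?e \<omega> ^ 4 / K\<^sup>2) / 2) \<le> K\<^sup>2" .
  qed
  finally show ?thesis .
qed

lemma linf_grad_measurable_P: "(\<lambda>\<omega>. linf p (grad k \<omega>)) \<in> borel_measurable P"
  by (rule measurable_F_P[OF linf_grad_measurable]) (use mesh in simp)

lemma env_measurable: "k < n \<Longrightarrow> env q k \<in> borel_measurable P"
  using sup_measurable[of k] linf_grad_measurable_P[of k] unfolding env_def[abs_def] by simp

lemma env_expectation:
  assumes q: "q > 0" and k: "k < n"
  shows "(\<integral>\<^sup>+\<omega>. env q k \<omega> \<partial>P) \<le> ennreal (L * real (sparsity M) * (q / 2 * K\<^sup>2 + 1 / q * (D2 * \<Delta>)))"
proof -
  note [measurable] = sup_measurable[OF k] linf_grad_measurable_P[of k]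
  have "(\<integral>\<^sup>+\<omega>. env q k \<omega> \<partial>P) = ennreal (L * real (sparsity M)) *
     (ennreal (q / 2) * (\<integral>\<^sup>+\<omega>. ennreal ((linf p (grad k \<omega>))\<^sup>2) \<partial>P)
       + ennreal (1 / q) * ((\<integral>\<^sup>+\<omega>. supX k \<omega> \<partial>P) + (\<integral>\<^sup>+\<omega>. supZ k \<omega> \<partial>P)))"
    unfolding env_def by (simp add: nn_integral_cmult nn_integral_add)
  also have "\<dots> \<le> ennreal (L * real (sparsity M)) * (ennreal (q / 2) * ennreal (K\<^sup>2) + ennreal (1 / q) * ennreal (D2 * \<Delta>))"
    by (intro mult_left_mono add_mono grad_second_moment sup_moment[OF k]) auto
  also have "\<dots> = ennreal (L * real (sparsity M) * (q / 2 * K\<^sup>2 + 1 / q * (D2 * \<Delta>)))"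
    using q L D2 mesh by (simp add: ennreal_mult[symmetric] ennreal_plus[symmetric] del: ennreal_plus)
  finally show ?thesis .
qed

section \<open>Expectation and tail of the score\<close>

lemma psi_measurable: "j < p \<Longrightarrow> (\<lambda>\<omega>. psi M n \<Delta> \<omega> (theta0 M) j) \<in> borel_measurable P"
proof -
  assume j: "j < p"
  have t: "0 \<le> real k * \<Delta>" for k using mesh by simp
  have "(\<lambda>\<omega>. partial_deriv j (drift M (Yproc M (real k * \<Delta>) \<omega>)) (theta0 M)) \<in> borel_measurable P" for k
    using measurable_F_P[OF grad_measurable[OF j] t] unfolding grad_def .
  moreover have "Xproc M (real k * \<Delta>) \<in> borel_measurable P" for k
    by (rule measurable_F_P[OF X_measurable[OF t] t])
  moreover have "(\<lambda>\<omega>. drift M (Yproc M (real k * \<Delta>) \<omega>) (theta0 M)) \<in> borel_measurable P" for k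
    by (rule measurable_F_P[OF drift_measurable[OF t] t])
  ultimately show ?thesis unfolding psi_def
    by (intro borel_measurable_times borel_measurable_const borel_measurable_sum borel_measurable_diff)
qed

text \<open>Two parameters stay free: \<open>b\<close> belongs to the noise and \<open>q\<close> to
  the discretisation error, and the tail bound chooses them.\<close>

lemma linf_psi_expectation:
  assumes b: "b > 0" and p: "p > 0" and q: "q > 0"
  shows "(\<integral>\<^sup>+\<omega>. ennreal (linf p (psi M n \<Delta> \<omega> (theta0 M))) \<partial>P)
    \<le> ennreal (1 / (real n * \<Delta>) * (ln (2 * real p) / b + 2 * b * K ^ 4 * (real n * \<Delta>))
        + L * real (sparsity M) * (q / 2 * K\<^sup>2 + 1 / q * (D2 * \<Delta>)))"
proof -
  let ?c = "1 / (real n * \<Delta>)"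
  have c: "?c \<ge> 0" using mesh by simp
  note ns = noise_score_expectation[OF b p, folded noise_score_def]
  have ns0: "noise_score \<omega> \<ge> 0" for \<omega> by (simp add: noise_score_def linf_nonneg)
  have [measurable]: "noise_score \<in> borel_measurable P" using ns(1) by auto
  have [measurable]: "env q k \<in> borel_measurable P" if "k < n" for k using env_measurable[OF that] .
  \<comment> \<open>The mesh cancels, so the discretisation error becomes an average over the
    \<open>n\<close> steps.\<close>
  have scale: "ennreal ?c * (ennreal \<Delta> * e) = ennreal (1 / real n) * e" for e
    using mesh c by (simp add: mult.assoc[symmetric] ennreal_mult[symmetric])
  have split: "ennreal (?c * (N + (\<Sum>k<n. t k))) = ennreal ?c * ennreal N + (\<Sum>k<n. ennreal ?c * ennreal (t k))"
    if "0 \<le> N" "\<And>k. 0 \<le> t k" for N and t :: "nat \<Rightarrow> real"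
  proof -
    have "ennreal (?c * (N + (\<Sum>k<n. t k))) = ennreal ?c * ennreal (N + (\<Sum>k<n. t k))"
      using c that by (intro ennreal_mult) (auto intro!: add_nonneg_nonneg sum_nonneg)
    also have "ennreal (N + (\<Sum>k<n. t k)) = ennreal N + (\<Sum>k<n. ennreal (t k))"
      using that by (simp add: ennreal_plus sum_nonneg sum_ennreal)
    finally show ?thesis by (simp only: distrib_left sum_distrib_left)
  qed
  have le: "AE \<omega> in P. ennreal (linf p (psi M n \<Delta> \<omega> (theta0 M)))
      \<le> ennreal ?c * ennreal (noise_score \<omega>) + (\<Sum>k<n. ennreal (1 / real n) * env q k \<omega>)"
    using S_integrable AE_space
  proof eventually_elim
    case (elim \<omega>)
    have "ennreal (linf p (psi M n \<Delta> \<omega> (theta0 M)))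
        \<le> ennreal (?c * (noise_score \<omega> + (\<Sum>k<n. linf p (grad k \<omega>) * \<bar>disc k \<omega>\<bar>)))"
      by (rule ennreal_leI[OF linf_psi_le[OF elim(1)]])
    also have "\<dots> = ennreal ?c * ennreal (noise_score \<omega>) + (\<Sum>k<n. ennreal ?c * ennreal (linf p (grad k \<omega>) * \<bar>disc k \<omega>\<bar>))"
      by (rule split) (auto simp: ns0 linf_nonneg)
    also have "\<dots> \<le> ennreal ?c * ennreal (noise_score \<omega>) + (\<Sum>k<n. ennreal ?c * (ennreal \<Delta> * env q k \<omega>))"
      by (intro add_left_mono sum_mono mult_left_mono weighted_disc_le[OF elim q]) auto
    also have "\<dots> = ennreal ?c * ennreal (noise_score \<omega>) + (\<Sum>k<n. ennreal (1 / real n) * env q k \<omega>)"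
      by (simp only: scale)
    finally show ?case .
  qed
  have "(\<integral>\<^sup>+\<omega>. ennreal (linf p (psi M n \<Delta> \<omega> (theta0 M))) \<partial>P)
      \<le> (\<integral>\<^sup>+\<omega>. ennreal ?c * ennreal (noise_score \<omega>) + (\<Sum>k<n. ennreal (1 / real n) * env q k \<omega>) \<partial>P)"
    by (rule nn_integral_mono_AE[OF le])
  also have "\<dots> = ennreal ?c * (\<integral>\<^sup>+\<omega>. ennreal (noise_score \<omega>) \<partial>P) + (\<Sum>k<n. ennreal (1 / real n) * (\<integral>\<^sup>+\<omega>. env q k \<omega> \<partial>P))"
  proof -
    have m: "(\<lambda>\<omega>. ennreal (1 / real n) * env q k \<omega>) \<in> borel_measurable P" if "k \<in> {..<n}" for k
      using env_measurable[of k q] that by simp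
    have s: "(\<integral>\<^sup>+\<omega>. (\<Sum>k<n. ennreal (1 / real n) * env q k \<omega>) \<partial>P) = (\<Sum>k<n. ennreal (1 / real n) * (\<integral>\<^sup>+\<omega>. env q k \<omega> \<partial>P))"
    proof -
      have "(\<integral>\<^sup>+\<omega>. (\<Sum>k<n. ennreal (1 / real n) * env q k \<omega>) \<partial>P) = (\<Sum>k<n. (\<integral>\<^sup>+\<omega>. ennreal (1 / real n) * env q k \<omega> \<partial>P))"
        by (rule nn_integral_sum) (rule m)
      also have "\<dots> = (\<Sum>k<n. ennreal (1 / real n) * (\<integral>\<^sup>+\<omega>. env q k \<omega> \<partial>P))"
        using env_measurable by (intro sum.cong refl nn_integral_cmult) auto
      finally show ?thesis .
    qed
    show ?thesis
      by (subst nn_integral_add) (use m in \<open>auto simp: s nn_integral_cmult intro!: borel_measurable_sum\<close>)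
  qed
  also have "\<dots> \<le> ennreal ?c * ennreal (ln (2 * real p) / b + 2 * b * K ^ 4 * (real n * \<Delta>))
      + (\<Sum>k<n. ennreal (1 / real n) * ennreal (L * real (sparsity M) * (q / 2 * K\<^sup>2 + 1 / q * (D2 * \<Delta>))))"
  proof (intro add_mono mult_left_mono sum_mono)
    show "(\<integral>\<^sup>+\<omega>. ennreal (noise_score \<omega>) \<partial>P) \<le> ennreal (ln (2 * real p) / b + 2 * b * K ^ 4 * (real n * \<Delta>))"
      using ns ns0 by (simp add: nn_integral_eq_integral ennreal_leI)
  qed (use env_expectation[OF q] in auto)
  also have "\<dots> = ennreal (?c * (ln (2 * real p) / b + 2 * b * K ^ 4 * (real n * \<Delta>))
        + L * real (sparsity M) * (q / 2 * K\<^sup>2 + 1 / q * (D2 * \<Delta>)))"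
  proof -
    have e0: "0 \<le> L * real (sparsity M) * (q / 2 * K\<^sup>2 + 1 / q * (D2 * \<Delta>))" using L q D2 mesh by simp
    have "(\<Sum>k<n. ennreal (1 / real n) * ennreal (L * real (sparsity M) * (q / 2 * K\<^sup>2 + 1 / q * (D2 * \<Delta>))))
        = ennreal (L * real (sparsity M) * (q / 2 * K\<^sup>2 + 1 / q * (D2 * \<Delta>)))"
      using n e0 by (simp add: ennreal_mult[symmetric] ennreal_of_nat_eq_real_of_nat del: ennreal_plus)
    moreover have "0 \<le> ln (2 * real p) / b + 2 * b * K ^ 4 * (real n * \<Delta>)"
      using b p mesh K by (intro add_nonneg_nonneg divide_nonneg_pos mult_nonneg_nonneg ln_ge_zero) auto
    ultimately show ?thesis using c e0
      by (simp only: ennreal_mult[OF c, symmetric] ennreal_plus[symmetric] mult_nonneg_nonneg)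
  qed
  finally show ?thesis .
qed

text \<open>Markov's inequality applied to the expectation bound. The maximum consists of the two
  terms of the rate condition, and the factor in front depends on \<open>L\<close> alone, so it is
  the same for every sample size.\<close>

lemma prob_linf_psi_gt:
  assumes l: "l > 0"
  shows "{\<omega> \<in> space P. linf p (psi M n \<Delta> \<omega> (theta0 M)) > l} \<in> sets P"
    "prob {\<omega> \<in> space P. linf p (psi M n \<Delta> \<omega> (theta0 M)) > l}
      \<le> (2 * L + 6) * max (K * real (sparsity M) * \<Delta> powr (1/2) * D2 powr (1/2) / l)
                          (K\<^sup>2 / l * sqrt (ln (1 + real p) / (real n * \<Delta>)))"
proof -
  let ?B = "{\<omega> \<in> space P. linf p (psi M n \<Delta> \<omega> (theta0 M)) > l}"
  let ?s = "real (sparsity M)" and ?N = "real n * \<Delta>"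
  let ?r1 = "K * ?s * \<Delta> powr (1/2) * D2 powr (1/2) / l" and ?r2 = "K\<^sup>2 / l * sqrt (ln (1 + real p) / ?N)"
  have [measurable]: "(\<lambda>\<omega>. linf p (psi M n \<Delta> \<omega> (theta0 M))) \<in> borel_measurable P"
    by (intro borel_measurable_linf psi_measurable)
  show B: "?B \<in> sets P" by measurable
  have N: "?N > 0" using n mesh by simp
  have r: "?r1 \<ge> 0" "?r2 \<ge> 0" using K l D2 N by auto
  show "prob ?B \<le> (2 * L + 6) * max ?r1 ?r2"
  proof (cases "p = 0")
    case True
    then have "?B = {}" using l by auto
    then have "prob ?B = 0" by (simp only: measure_empty)
    moreover have "0 \<le> (2 * L + 6) * max ?r1 ?r2" using r(1) L by (intro mult_nonneg_nonneg) (auto simp: le_max_iff_disj)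
    ultimately show ?thesis by (simp only:)
  next
    case False
    then have p: "p > 0" by simp
    define lg where "lg = ln (2 * real p)"
    have lg: "lg > 0" using p by (simp add: lg_def)
    \<comment> \<open>\<open>b\<close> and \<open>q\<close> balance the two summands in which each of them occurs in the bound on the expectation.\<close>
    define w where "w = sqrt (lg / ?N)"
    have w: "w > 0" "w\<^sup>2 = lg / ?N" using lg N by (auto simp: w_def)
    define b where "b = w / K\<^sup>2"
    have b: "b > 0" using w K by (simp add: b_def)
    define d where "d = sqrt (D2 * \<Delta>)"
    have d: "d > 0" "d\<^sup>2 = D2 * \<Delta>" using D2 mesh by (auto simp: d_def)
    define q where "q = d / K"
    have q: "q > 0" using d K by (simp add: q_def)
    have e1: "1 / ?N * (ln (2 * real p) / b + 2 * b * K ^ 4 * ?N) = 3 * K\<^sup>2 * w"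
    proof -
      have "1 / ?N * (ln (2 * real p) / b + 2 * b * K ^ 4 * ?N) = (lg / ?N) / b + 2 * b * K ^ 4"
        using n mesh by (simp add: lg_def distrib_left)
      also have "\<dots> = K\<^sup>2 * w + 2 * K\<^sup>2 * w"
        unfolding w(2)[symmetric] b_def using w(1) K by (simp add: power2_eq_square eval_nat_numeral)
      finally show ?thesis by simp
    qed
    have e2: "q / 2 * K\<^sup>2 + 1 / q * (D2 * \<Delta>) = 3 / 2 * (K * d)"
      unfolding d(2)[symmetric] q_def using d(1) K by (simp add: power2_eq_square)
    have "ennreal l * emeasure P ?B = (\<integral>\<^sup>+\<omega>. ennreal l * indicator ?B \<omega> \<partial>P)"
      using B by (simp add: nn_integral_cmult_indicator)
    also have "\<dots> \<le> (\<integral>\<^sup>+\<omega>. ennreal (linf p (psi M n \<Delta> \<omega> (theta0 M))) \<partial>P)"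
      by (intro nn_integral_mono) (auto split: split_indicator intro!: ennreal_leI)
    also have "\<dots> \<le> ennreal (3 * K\<^sup>2 * w + L * ?s * (3 / 2 * (K * d)))"
      using linf_psi_expectation[OF b p q] unfolding e1 e2 .
    finally have "ennreal (l * prob ?B) \<le> ennreal (3 * K\<^sup>2 * w + L * ?s * (3 / 2 * (K * d)))"
      using l by (simp add: emeasure_eq_measure ennreal_mult)
    then have "l * prob ?B \<le> 3 * K\<^sup>2 * w + L * ?s * (3 / 2 * (K * d))"
      using w d L K by (subst (asm) ennreal_le_iff) auto
    then have "prob ?B \<le> (3 * K\<^sup>2 * w + L * ?s * (3 / 2 * (K * d))) / l"
      using l by (simp add: pos_le_divide_eq mult.commute)
    also have "\<dots> = 3 * (K\<^sup>2 / l * w) + 3 / 2 * L * (K * ?s * d / l)"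
      by (simp add: add_divide_distrib mult_ac)
    also have "\<dots> \<le> 6 * ?r2 + 2 * L * ?r1"
    proof (rule add_mono)
      \<comment> \<open>From 2 p \<le> (1 + p)^2 the logarithm of 2 p is at most twice that of 1 +
        p. It is relaxed to four times, whose root is 2, so the factor 3 becomes 6.\<close>
      have "lg \<le> ln ((1 + real p)\<^sup>2)"
        unfolding lg_def using p by (intro ln_mono) (auto simp: power2_eq_square algebra_simps)
      also have "\<dots> \<le> 4 * ln (1 + real p)" by (simp add: ln_realpow)
      finally have "w \<le> sqrt (4 * (ln (1 + real p) / ?N))"
        unfolding w_def using N by (intro real_sqrt_le_mono) (simp add: divide_right_mono)
      also have "\<dots> = 2 * sqrt (ln (1 + real p) / ?N)" by (simp only: real_sqrt_mult) simp
      finally have "K\<^sup>2 / l * w \<le> K\<^sup>2 / l * (2 * sqrt (ln (1 + real p) / ?N))"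
        using l by (intro mult_left_mono) auto
      then show "3 * (K\<^sup>2 / l * w) \<le> 6 * ?r2" by simp
      have "K * ?s * d / l = ?r1"
        unfolding d_def using D2 mesh by (simp add: powr_half_sqrt real_sqrt_mult)
      then show "3 / 2 * L * (K * ?s * d / l) \<le> 2 * L * ?r1"
        by (simp only:) (rule mult_right_mono[OF _ r(1)], use L in simp)
    qed
    also have "\<dots> \<le> 6 * max ?r1 ?r2 + 2 * L * max ?r1 ?r2"
      using L by (intro add_mono mult_left_mono) auto
    also have "\<dots> = (2 * L + 6) * max ?r1 ?r2" by (simp add: algebra_simps)
    finally show ?thesis .
  qed
qed

end

section \<open>Consistency and support recovery\<close>

text \<open>Estimator and truth are both feasible here. The triangle inequality through zero then
  bounds the score deviation, which converts a bound in c_n into one in \<lambda>_n.\<close>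

lemma dantzig_selector_feasible:
  assumes sel: "dantzig_selector M n \<Delta> l g" and \<omega>: "\<omega> \<in> space (Prob M)"
    and \<theta>0: "theta0 M \<in> Param M" "linf (pdim M) (psi M n \<Delta> \<omega> (theta0 M)) \<le> l"
  shows "g \<omega> \<in> Param M" "l1norm {..<pdim M} (g \<omega>) \<le> l1norm {..<pdim M} (theta0 M)"
    "score_dev M n \<Delta> g \<omega> \<le> 2 * l"
proof -
  have feas: "theta0 M \<in> feasible M n \<Delta> l \<omega>" using \<theta>0 by (simp add: feasible_def)
  then have min: "is_arg_min (l1norm {..<pdim M}) (\<lambda>\<theta>. \<theta> \<in> feasible M n \<Delta> l \<omega>) (g \<omega>)"
    using sel \<omega> unfolding dantzig_selector_def by blast
  then have g: "g \<omega> \<in> feasible M n \<Delta> l \<omega>" by (simp add: is_arg_min_linorder)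
  then show "g \<omega> \<in> Param M" by (simp add: feasible_def)
  show "l1norm {..<pdim M} (g \<omega>) \<le> l1norm {..<pdim M} (theta0 M)"
    using min feas by (simp add: is_arg_min_linorder)
  have l: "0 \<le> l" using linf_nonneg \<theta>0(2) by (rule order_trans)
  have "\<bar>psi M n \<Delta> \<omega> (g \<omega>) j - psi M n \<Delta> \<omega> (theta0 M) j\<bar> \<le> 2 * l" if "j < pdim M" for j
  proof -
    have "\<bar>psi M n \<Delta> \<omega> (g \<omega>) j\<bar> \<le> l" "\<bar>psi M n \<Delta> \<omega> (theta0 M) j\<bar> \<le> l"
      using g \<theta>0 that l by (simp_all add: feasible_def linf_le_iff)
    then show ?thesis by linarith
  qed
  then show "score_dev M n \<Delta> g \<omega> \<le> 2 * l" using l by (simp add: score_dev_def linf_le_iff)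
qed

text \<open>Off the support the estimator is at most the error, hence below \<open>t\<close>. On the
  support the true value exceeds \<open>2 * t\<close> in modulus, and an error below
  \<open>t\<close> leaves more than \<open>t\<close>.\<close>

lemma supp_hat_eq_supp0:
  assumes err: "est_error M g \<omega> < t" and t: "ereal t < theta_min M / 2"
  shows "supp_hat M g t \<omega> = supp0 M"
proof -
  have "t < \<bar>g \<omega> j\<bar> \<longleftrightarrow> theta0 M j \<noteq> 0" if j: "j < pdim M" for j
  proof -
    have e: "\<bar>g \<omega> j - theta0 M j\<bar> < t"
      using abs_le_linf[OF j, of "\<lambda>j. g \<omega> j - theta0 M j"] err by (simp add: est_error_def)
    show ?thesis
    proof (cases "theta0 M j = 0")
      case True
      then show ?thesis using e by simp
    next
      case False
      then have "theta_min M \<le> ereal \<bar>theta0 M j\<bar>"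
        unfolding theta_min_def using j by (intro INF_lower) (simp add: supp0_def)
      then have "theta_min M / 2 \<le> ereal \<bar>theta0 M j\<bar> / 2" by (intro ereal_divide_right_mono) auto
      then have "ereal t < ereal \<bar>theta0 M j\<bar> / 2" using t by (rule less_le_trans[rotated])
      then have "t < \<bar>theta0 M j\<bar> / 2" by simp
      then show ?thesis using e False by linarith
    qed
  qed
  then show ?thesis by (auto simp: supp_hat_def supp0_def)
qed

theorem theorem4p4:
  fixes M :: "nat \<Rightarrow> ('a, 'h::metric_space) model"
    and \<Delta> lam :: "nat \<Rightarrow> real"
    and \<theta>hat :: "nat \<Rightarrow> 'a \<Rightarrow> nat \<Rightarrow> real"
    and L_S \<delta> \<zeta> :: real
    and K :: "nat \<Rightarrow> real"
    and D :: "nat \<Rightarrow> nat \<Rightarrow> real"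
  assumes model: "\<And>n. n \<ge> 1 \<Longrightarrow> diffusion_model (M n)"
    and segment: "\<And>n \<theta> u. n \<ge> 1 \<Longrightarrow> \<theta> \<in> Param (M n) \<Longrightarrow> u \<in> {0..1} \<Longrightarrow>
        (\<lambda>j\<in>{..<pdim (M n)}. theta0 (M n) j + u * (\<theta> j - theta0 (M n) j)) \<in> Param (M n)"
    and mesh: "\<And>n. n \<ge> 1 \<Longrightarrow> \<Delta> n > 0"
    and tuning: "\<And>n. n \<ge> 1 \<Longrightarrow> lam n > 0"
    and estimator: "\<And>n. n \<ge> 1 \<Longrightarrow> dantzig_selector (M n) n (\<Delta> n) (lam n) (\<theta>hat n)"
    and a_pos: "L_S > 0"
    and a: "\<And>n x1 x2 z1 z2. n \<ge> 1 \<Longrightarrow> z1 \<in> Rvec (dim2 (M n)) \<Longrightarrow> z2 \<in> Rvec (dim2 (M n)) \<Longrightarrow>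
        \<bar>drift (M n) (yvec (M n) x1 z1) (theta0 (M n)) - drift (M n) (yvec (M n) x2 z2) (theta0 (M n))\<bar>
          \<le> L_S * real (sparsity (M n)) * (\<bar>x1 - x2\<bar> + linf (dim2 (M n)) (\<lambda>j. z1 j - z2 j))"
    and b_smooth: "\<And>n y. n \<ge> 1 \<Longrightarrow> y \<in> Rvec (pdim (M n)) \<Longrightarrow>
        \<exists>U. openin (top_of_set (Rvec (pdim (M n)))) U \<and> Param (M n) \<subseteq> U \<and>
            C2_on (pdim (M n)) U (drift (M n) y)"
    and b_pos: "\<And>n. n \<ge> 1 \<Longrightarrow> K (pdim (M n)) > 0"
    and b_S: "\<And>n t. n \<ge> 1 \<Longrightarrow> t \<ge> 0 \<Longrightarrow>
        integrable (Prob (M n)) (\<lambda>\<omega>. \<bar>drift (M n) (Yproc (M n) t \<omega>) (theta0 (M n))\<bar> ^ 4) \<and>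
        (\<integral>\<omega>. \<bar>drift (M n) (Yproc (M n) t \<omega>) (theta0 (M n))\<bar> ^ 4 \<partial>Prob (M n)) powr (1/4) \<le> K (pdim (M n))"
    and b_dS: "\<And>n t. n \<ge> 1 \<Longrightarrow> t \<ge> 0 \<Longrightarrow>
        integrable (Prob (M n)) (\<lambda>\<omega>. linf (pdim (M n))
          (\<lambda>j. partial_deriv j (drift (M n) (Yproc (M n) t \<omega>)) (theta0 (M n))) ^ 4) \<and>
        (\<integral>\<omega>. linf (pdim (M n))
          (\<lambda>j. partial_deriv j (drift (M n) (Yproc (M n) t \<omega>)) (theta0 (M n))) ^ 4 \<partial>Prob (M n)) powr (1/4)
          \<le> K (pdim (M n))"
    and b_sigma: "\<And>n t. n \<ge> 1 \<Longrightarrow> t \<ge> 0 \<Longrightarrow>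
        integrable (Prob (M n)) (\<lambda>\<omega>. \<bar>sigma_coef (M n) (Yproc (M n) t \<omega>) (h_true (M n))\<bar> ^ 4) \<and>
        (\<integral>\<omega>. \<bar>sigma_coef (M n) (Yproc (M n) t \<omega>) (h_true (M n))\<bar> ^ 4 \<partial>Prob (M n)) powr (1/4) \<le> K (pdim (M n))"
    and c: "\<And>n. n \<ge> 1 \<Longrightarrow>
        (INF y\<in>Rvec (pdim (M n)). INF h\<in>H_space (M n). (sigma_coef (M n) y h)\<^sup>2) > 0"
    and d_pos: "\<And>n k. n \<ge> 1 \<Longrightarrow> k \<ge> 1 \<Longrightarrow> D k (pdim (M n)) > 0"
    and d_meas: "\<And>n i k. n \<ge> 1 \<Longrightarrow> i \<in> {1..n} \<Longrightarrow> k \<ge> 1 \<Longrightarrow>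
        (\<lambda>\<omega>. SUP t\<in>{real (i - 1) * \<Delta> n..real i * \<Delta> n}.
            ennreal (\<bar>Xproc (M n) t \<omega> - Xproc (M n) (real (i - 1) * \<Delta> n) \<omega>\<bar> ^ k))
          \<in> borel_measurable (Prob (M n)) \<and>
        (\<lambda>\<omega>. SUP t\<in>{real (i - 1) * \<Delta> n..real i * \<Delta> n}.
            ennreal (linf (dim2 (M n))
              (\<lambda>j. Zproc (M n) t \<omega> j - Zproc (M n) (real (i - 1) * \<Delta> n) \<omega> j) ^ k))
          \<in> borel_measurable (Prob (M n))"
    and d: "\<And>n i k. n \<ge> 1 \<Longrightarrow> i \<in> {1..n} \<Longrightarrow> k \<ge> 1 \<Longrightarrow>
        (\<integral>\<^sup>+\<omega>. (SUP t\<in>{real (i - 1) * \<Delta> n..real i * \<Delta> n}.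
            ennreal (\<bar>Xproc (M n) t \<omega> - Xproc (M n) (real (i - 1) * \<Delta> n) \<omega>\<bar> ^ k)) \<partial>Prob (M n)) +
        (\<integral>\<^sup>+\<omega>. (SUP t\<in>{real (i - 1) * \<Delta> n..real i * \<Delta> n}.
            ennreal (linf (dim2 (M n))
              (\<lambda>j. Zproc (M n) t \<omega> j - Zproc (M n) (real (i - 1) * \<Delta> n) \<omega> j) ^ k)) \<partial>Prob (M n))
        \<le> ennreal (D k (pdim (M n)) * \<Delta> n powr (real k / 2))"
    and e_zeta: "1/2 < \<zeta>" "\<zeta> < 1"
    and e_mesh: "\<Delta> \<in> \<Theta>(\<lambda>n. real n powr (- \<zeta>))"
    and e_dim: "(\<lambda>n. ln (real (pdim (M n)))) \<in> o(\<lambda>n. (real n * \<Delta> n) powr (1/2))"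
    and e_rate: "(\<lambda>n. max
          (K (pdim (M n)) * real (sparsity (M n)) * \<Delta> n powr (1/2) * D 2 (pdim (M n)) powr (1/2)
             / lam n)
          ((K (pdim (M n)))\<^sup>2 / lam n * sqrt (ln (1 + real (pdim (M n))) / (real n * \<Delta> n))))
        \<longlonglongrightarrow> 0"
    and f_pos: "\<delta> > 0"
    and f: "(\<lambda>n. measure (Prob (M n))
          {\<omega> \<in> space (Prob (M n)). restricted_factor (M n) n (\<Delta> n) \<omega> > ereal \<delta>}) \<longlonglongrightarrow> 1"
    and g: "\<And>n. n \<ge> 1 \<Longrightarrow> AE \<omega> in Prob (M n).
        theta_min (M n) > ereal (4 * score_dev (M n) n (\<Delta> n) (\<theta>hat n) \<omega> / \<delta>)"
  shows "(\<lambda>n. measure (Prob (M n)) {\<omega> \<in> space (Prob (M n)).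
            est_error (M n) (\<theta>hat n) \<omega> > 2 / \<delta> * score_dev (M n) n (\<Delta> n) (\<theta>hat n) \<omega>})
          \<longlonglongrightarrow> 0 \<and>
         bigo_prob (\<lambda>n. Prob (M n)) (\<lambda>n. est_error (M n) (\<theta>hat n)) lam \<and>
         (\<forall>\<tau> :: nat \<Rightarrow> 'a \<Rightarrow> real.
            (\<forall>n\<ge>1. \<tau> n \<in> borel_measurable (Prob (M n))) \<longrightarrow>
            (\<forall>n\<ge>1. AE \<omega> in Prob (M n).
                2 * score_dev (M n) n (\<Delta> n) (\<theta>hat n) \<omega> / \<delta> < \<tau> n \<omega> \<and>
                ereal (\<tau> n \<omega>) < theta_min (M n) / 2) \<longrightarrow>
            (\<lambda>n. measure (Prob (M n)) {\<omega> \<in> space (Prob (M n)).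
                supp_hat (M n) (\<theta>hat n) (\<tau> n \<omega>) \<omega> = supp0 (M n)}) \<longlonglongrightarrow> 1)"
proof -
  define B where "B n = {\<omega> \<in> space (Prob (M n)). linf (pdim (M n)) (psi (M n) n (\<Delta> n) \<omega> (theta0 (M n))) > lam n}" for n
  define G where "G n = {\<omega> \<in> space (Prob (M n)). restricted_factor (M n) n (\<Delta> n) \<omega> > ereal \<delta>}" for n
  let ?rate = "\<lambda>n. max
          (K (pdim (M n)) * real (sparsity (M n)) * \<Delta> n powr (1/2) * D 2 (pdim (M n)) powr (1/2) / lam n)
          ((K (pdim (M n)))\<^sup>2 / lam n * sqrt (ln (1 + real (pdim (M n))) / (real n * \<Delta> n)))"
  have setting: "score_setting (M n) n (\<Delta> n) L_S (K (pdim (M n))) (D 2 (pdim (M n)))" if n: "n \<ge> 1" for n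
  proof
    show "diffusion_model (M n)" by (rule model[OF n])
    show "0 < D 2 (pdim (M n))" by (rule d_pos[OF n]) simp
    fix i assume i: "i \<in> {1..n}"
    show "(\<lambda>\<omega>. SUP t\<in>{real (i - 1) * \<Delta> n..real i * \<Delta> n}.
            ennreal (\<bar>Xproc (M n) t \<omega> - Xproc (M n) (real (i - 1) * \<Delta> n) \<omega>\<bar> ^ 2)) \<in> borel_measurable (Prob (M n)) \<and>
        (\<lambda>\<omega>. SUP t\<in>{real (i - 1) * \<Delta> n..real i * \<Delta> n}.
            ennreal (linf (dim2 (M n)) (\<lambda>j. Zproc (M n) t \<omega> j - Zproc (M n) (real (i - 1) * \<Delta> n) \<omega> j) ^ 2))
          \<in> borel_measurable (Prob (M n))"
      by (rule d_meas[OF n i]) simp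
    \<comment> \<open>The moment condition is used with exponent 2, where the power of the mesh is
      the mesh itself.\<close>
    have "\<Delta> n powr (real 2 / 2) = \<Delta> n" using mesh[OF n] by simp
    then show "(\<integral>\<^sup>+\<omega>. (SUP t\<in>{real (i - 1) * \<Delta> n..real i * \<Delta> n}.
            ennreal (\<bar>Xproc (M n) t \<omega> - Xproc (M n) (real (i - 1) * \<Delta> n) \<omega>\<bar> ^ 2)) \<partial>Prob (M n)) +
        (\<integral>\<^sup>+\<omega>. (SUP t\<in>{real (i - 1) * \<Delta> n..real i * \<Delta> n}.
            ennreal (linf (dim2 (M n)) (\<lambda>j. Zproc (M n) t \<omega> j - Zproc (M n) (real (i - 1) * \<Delta> n) \<omega> j) ^ 2)) \<partial>Prob (M n))
        \<le> ennreal (D 2 (pdim (M n)) * \<Delta> n)"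
      using d[OF n i, of 2] by (simp only:)
  qed (use n mesh[OF n] a_pos a[OF n] b_smooth[OF n] b_pos[OF n] b_dS[OF n] b_sigma[OF n] in \<open>simp_all\<close>)
  have prob: "prob_space (Prob (M n))" if "n \<ge> 1" for n
    using model[OF that] by (simp add: diffusion_model_def filtered_prob_space_def)
  have B: "B n \<in> sets (Prob (M n))" "measure (Prob (M n)) (B n) \<le> (2 * L_S + 6) * ?rate n" if n: "n \<ge> 1" for n
    unfolding B_def using score_setting.prob_linf_psi_gt[OF setting[OF n] tuning[OF n]] by auto
  have B_lim: "(\<lambda>n. measure (Prob (M n)) (B n)) \<longlonglongrightarrow> 0"
  proof (rule tendsto_sandwich[OF _ _ tendsto_const])
    show "\<forall>\<^sub>F n in sequentially. measure (Prob (M n)) (B n) \<le> (2 * L_S + 6) * ?rate n"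
      using eventually_ge_at_top[of 1] by eventually_elim (rule B(2))
    show "(\<lambda>n. (2 * L_S + 6) * ?rate n) \<longlonglongrightarrow> 0"
      by (rule tendsto_mult_right_zero[OF e_rate])
  qed simp
  have key: "est_error (M n) (\<theta>hat n) \<omega> \<le> 2 / \<delta> * score_dev (M n) n (\<Delta> n) (\<theta>hat n) \<omega>"
    "score_dev (M n) n (\<Delta> n) (\<theta>hat n) \<omega> \<le> 2 * lam n"
    if n: "n \<ge> 1" and \<omega>: "\<omega> \<in> space (Prob (M n))" "\<omega> \<in> G n" "\<omega> \<notin> B n" for n \<omega>
  proof -
    have \<theta>0: "theta0 (M n) \<in> Param (M n)" using model[OF n] by (simp add: diffusion_model_def)
    note sel = dantzig_selector_feasible[OF estimator[OF n] \<omega>(1) \<theta>0]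
    have psi: "linf (pdim (M n)) (psi (M n) n (\<Delta> n) \<omega> (theta0 (M n))) \<le> lam n"
      using \<omega> by (auto simp: B_def)
    show "score_dev (M n) n (\<Delta> n) (\<theta>hat n) \<omega> \<le> 2 * lam n" by (rule sel(3)[OF psi])
    show "est_error (M n) (\<theta>hat n) \<omega> \<le> 2 / \<delta> * score_dev (M n) n (\<Delta> n) (\<theta>hat n) \<omega>"
    proof (rule est_error_le_score_dev[of "M n" "\<theta>hat n" \<omega>, OF b_smooth[OF n] _ \<theta>0 sel(1)[OF psi] sel(2)[OF psi] f_pos])
      show "segment_point (M n) \<theta> u \<in> Param (M n)" if "\<theta> \<in> Param (M n)" "u \<in> {0..1}" for \<theta> u
        unfolding segment_point_def by (rule segment[OF n that])
      show "ereal \<delta> < restricted_factor (M n) n (\<Delta> n) \<omega>" using \<omega>(2) by (simp add: G_def)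
    qed
  qed
  \<comment> \<open>The pattern shared by all three claims: up to a null set, the event
    \<open>A n\<close> forces \<open>G n\<close> to fail or \<open>B n\<close> to occur.\<close>
  have vanish: "(\<lambda>n. measure (Prob (M n)) (A n)) \<longlonglongrightarrow> 0"
    if A: "\<And>n. n \<ge> 1 \<Longrightarrow> AE \<omega> in Prob (M n). \<omega> \<in> G n \<longrightarrow> \<omega> \<notin> B n \<longrightarrow> \<omega> \<notin> A n" for A
  proof (rule tendsto_sandwich[OF _ _ tendsto_const])
    have "\<forall>\<^sub>F n in sequentially. measure (Prob (M n)) (G n) > 0"
      using f unfolding G_def[symmetric] by (rule order_tendstoD) simp
    then show "\<forall>\<^sub>F n in sequentially. measure (Prob (M n)) (A n) \<le> (1 - measure (Prob (M n)) (G n)) + measure (Prob (M n)) (B n)"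
      using eventually_ge_at_top[of 1]
    proof eventually_elim
      case (elim n)
      interpret prob_space "Prob (M n)" by (rule prob[OF elim(2)])
      \<comment> \<open>Measurability of \<open>G n\<close> is read off from its probability: a set
        outside the sigma-algebra has measure 0 by convention, whereas these measures tend to
        1.\<close>
      have G: "G n \<in> sets (Prob (M n))"
        using elim(1) measure_notin_sets[of "G n" "Prob (M n)"] by auto
      show ?case
      proof (cases "A n \<in> sets (Prob (M n))")
        case True
        have "prob (A n) \<le> prob ((space (Prob (M n)) - G n) \<union> B n)"
        proof (rule finite_measure_mono_AE)
          show "AE \<omega> in Prob (M n). \<omega> \<in> A n \<longrightarrow> \<omega> \<in> (space (Prob (M n)) - G n) \<union> B n"
            using A[OF elim(2)] AE_space by eventually_elim blast
        qed (use G B(1)[OF elim(2)] in auto)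
        also have "\<dots> \<le> prob (space (Prob (M n)) - G n) + prob (B n)"
          using G B(1)[OF elim(2)] by (intro measure_Un_le) auto
        finally show ?thesis by (simp add: prob_compl[OF G])
      next
        \<comment> \<open>By the same convention a nonmeasurable \<open>A n\<close> has measure 0,
          and the bound is trivial.\<close>
        case False
        then show ?thesis by (simp add: measure_notin_sets add_nonneg_nonneg)
      qed
    qed
    show "(\<lambda>n. (1 - measure (Prob (M n)) (G n)) + measure (Prob (M n)) (B n)) \<longlonglongrightarrow> 0"
      using tendsto_add[OF tendsto_diff[OF tendsto_const f, of 1] B_lim] by (simp add: G_def)
  qed simp
  have consistency: "(\<lambda>n. measure (Prob (M n)) {\<omega> \<in> space (Prob (M n)).
            est_error (M n) (\<theta>hat n) \<omega> > 2 / \<delta> * score_dev (M n) n (\<Delta> n) (\<theta>hat n) \<omega>}) \<longlonglongrightarrow> 0"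
    by (rule vanish, rule AE_I2) (use key in \<open>auto simp: not_less\<close>)
  \<comment> \<open>The constant is \<open>2 / \<delta>\<close> times the factor 2 from the bound of
    the score deviation by \<open>2 * lam n\<close>.\<close>
  have tail: "(\<lambda>n. measure (Prob (M n)) {\<omega> \<in> space (Prob (M n)). \<bar>est_error (M n) (\<theta>hat n) \<omega>\<bar> > 4 / \<delta> * lam n}) \<longlonglongrightarrow> 0"
  proof (rule vanish, rule AE_I2, intro impI)
    fix n \<omega> assume *: "1 \<le> n" "\<omega> \<in> space (Prob (M n))" "\<omega> \<in> G n" "\<omega> \<notin> B n"
    have "est_error (M n) (\<theta>hat n) \<omega> \<le> 2 / \<delta> * (2 * lam n)"
      using key[OF *] f_pos by (meson divide_nonneg_pos mult_left_mono order_trans zero_le_numeral)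
    moreover have "0 \<le> est_error (M n) (\<theta>hat n) \<omega>" by (simp add: est_error_def linf_nonneg)
    ultimately show "\<omega> \<notin> {\<omega> \<in> space (Prob (M n)). \<bar>est_error (M n) (\<theta>hat n) \<omega>\<bar> > 4 / \<delta> * lam n}" by simp
  qed
  have rate: "bigo_prob (\<lambda>n. Prob (M n)) (\<lambda>n. est_error (M n) (\<theta>hat n)) lam"
    unfolding bigo_prob_def
  proof (intro allI impI exI[of _ "4 / \<delta>"] conjI)
    fix \<epsilon> :: real assume "\<epsilon> > 0"
    then show "\<forall>\<^sub>F n in sequentially. measure (Prob (M n))
        {\<omega> \<in> space (Prob (M n)). \<bar>est_error (M n) (\<theta>hat n) \<omega>\<bar> > 4 / \<delta> * lam n} \<le> \<epsilon>"
      by (rule eventually_mono[OF order_tendstoD(2)[OF tail]]) simp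
  qed (use f_pos in simp)
  have selection: "(\<lambda>n. measure (Prob (M n)) {\<omega> \<in> space (Prob (M n)).
                supp_hat (M n) (\<theta>hat n) (\<tau> n \<omega>) \<omega> = supp0 (M n)}) \<longlonglongrightarrow> 1"
    if \<tau>: "\<forall>n\<ge>1. \<tau> n \<in> borel_measurable (Prob (M n))"
      "\<forall>n\<ge>1. AE \<omega> in Prob (M n). 2 * score_dev (M n) n (\<Delta> n) (\<theta>hat n) \<omega> / \<delta> < \<tau> n \<omega> \<and>
                ereal (\<tau> n \<omega>) < theta_min (M n) / 2" for \<tau> :: "nat \<Rightarrow> 'a \<Rightarrow> real"
  proof -
    define T where "T n = {\<omega> \<in> space (Prob (M n)). supp_hat (M n) (\<theta>hat n) (\<tau> n \<omega>) \<omega> = supp0 (M n)}" for n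
    \<comment> \<open>For a limit equal to 1 the convention on nonmeasurable sets works in the wrong
      direction. Measurability is therefore established here, from that of the estimator and of the
      threshold.\<close>
    have T: "T n \<in> sets (Prob (M n))" if n: "n \<ge> 1" for n
    proof -
      have [measurable]: "(\<lambda>\<omega>. \<theta>hat n \<omega> j) \<in> borel_measurable (Prob (M n))" if "j < pdim (M n)" for j
      proof -
        have "\<theta>hat n \<in> measurable (Prob (M n)) (borel_vec (pdim (M n)))"
          using estimator[OF n] by (simp add: dantzig_selector_def)
        from measurable_compose[OF this, of "\<lambda>f. f j" borel] show ?thesis
          using that by (simp add: borel_vec_def measurable_component_singleton)
      qed
      have [measurable]: "\<tau> n \<in> borel_measurable (Prob (M n))" using \<tau>(1) n by blast
      have "T n = {\<omega> \<in> space (Prob (M n)). \<forall>j\<in>{..<pdim (M n)}. (\<bar>\<theta>hat n \<omega> j\<bar> > \<tau> n \<omega>) = (theta0 (M n) j \<noteq> 0)}"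
        by (auto simp: T_def supp_hat_def supp0_def)
      also have "\<dots> \<in> sets (Prob (M n))"
        by (intro sets.sets_Collect_finite_All) auto
      finally show ?thesis .
    qed
    have "(\<lambda>n. measure (Prob (M n)) (space (Prob (M n)) - T n)) \<longlonglongrightarrow> 0"
    proof (rule vanish)
      fix n :: nat assume n: "1 \<le> n"
      show "AE \<omega> in Prob (M n). \<omega> \<in> G n \<longrightarrow> \<omega> \<notin> B n \<longrightarrow> \<omega> \<notin> space (Prob (M n)) - T n"
        using \<tau>(2)[rule_format, OF n] AE_space
      proof eventually_elim
        case (elim \<omega>)
        show ?case
        proof (intro impI)
          assume "\<omega> \<in> G n" "\<omega> \<notin> B n"
          then have "est_error (M n) (\<theta>hat n) \<omega> < \<tau> n \<omega>"
            using key(1)[OF n elim(2)] elim(1) by simp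
          then have "supp_hat (M n) (\<theta>hat n) (\<tau> n \<omega>) \<omega> = supp0 (M n)"
            using elim(1) by (intro supp_hat_eq_supp0) auto
          then show "\<omega> \<notin> space (Prob (M n)) - T n" by (simp add: T_def)
        qed
      qed
    qed
    then have "(\<lambda>n. 1 - measure (Prob (M n)) (space (Prob (M n)) - T n)) \<longlonglongrightarrow> 1"
      using tendsto_diff[OF tendsto_const[of 1]] by force
    moreover have "\<forall>\<^sub>F n in sequentially. 1 - measure (Prob (M n)) (space (Prob (M n)) - T n) = measure (Prob (M n)) (T n)"
      using eventually_ge_at_top[of 1]
    proof eventually_elim
      case (elim n)
      show ?case using prob_space.prob_compl[OF prob[OF elim] T[OF elim]] by simp
    qed
    ultimately show ?thesis unfolding T_def[symmetric] by (rule Lim_transform_eventually)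
  qed
  show ?thesis using consistency rate selection by blast
qed

end
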